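(* Let $D$ be a smooth and bounded domain of a Carnot group $\mathbb{G}$ with $\dim_h\mathbb{G}\geq 3$, let $2^*=\frac{2\dim_h\mathbb{G}}{\dim_h\mathbb{G}-2}$, and let $g:\mathbb{R}\to\mathbb{R}$ be a continuous function for which there exist $a_1,a_2>0$ and $p\in[1,2^* )$ such that $$|g(t)|\leq a_1+a_2|t|^{p-1}\quad\text{for every } t\in\mathbb{R}.$$ Then for every $\mu>0$ there exists an open interval $\Lambda_\mu\subset(0,+\infty)$ such that for every $\lambda\in\Lambda_\mu$ the subelliptic critical problem $$\begin{cases}-\Delta_{\mathbb{G}}u=\mu|u|^{2^*-2}u+\lambda g(u) & \text{in } D,\\ u|_{\partial D}=0,\end{cases}$$ admits at least one weak solution in the Folland-Stein space $S^1_0(D)$.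
   Context: A homogeneous group is a Lie group $\mathbb{G}=(\mathbb{R}^n,\circ)$ equipped with a family of group automorphisms (dilatations) $\{\delta_\eta\}_{\eta>0}$ of the form $\delta_\eta(\xi^{(1)},\dots,\xi^{(r)})=(\eta\xi^{(1)},\eta^2\xi^{(2)},\dots,\eta^r\xi^{(r)})$, where $\xi^{(k)}\in\mathbb{R}^{n_k}$ and $\sum_{k=1}^rn_k=n$. Its homogeneous dimension is $\dim_h\mathbb{G}=\sum_{k=1}^rkn_k$. A Carnot group is a homogeneous group whose Lie algebra $\mathfrak{g}$ of left invariant vector fields is stratified: $\mathfrak{g}=\bigoplus_{k=1}^rV_k$ with linear subspaces $V_k$, $\dim V_k=n_k$, $[V_1,V_k]=V_{k+1}$ for $1\leq k\leq r-1$, and $[V_1,V_r]=\{0\}$. Here $[V_1,V_k]$ is the subspace generated by the commutators $[X,Y]$ with $X\in V_1$, $Y\in V_k$. Fix a basis $\{X_1,\dots,X_{n_1}\}$ of $V_1$. The horizontal gradient is $\nabla_{\mathbb{G}}=(X_1,\dots,X_{n_1})$ and the subelliptic Laplacian is $\Delta_{\mathbb{G}}=\sum_{k=1}^{n_1}X_k^2$. Integrals are with respect to Lebesgue measure $d\xi$ on $\mathbb{R}^n$. The Folland-Stein space $S^1_0(D)$ is the completion of $C_0^\infty(D)$ with respect to the norm $\|u\|_{S^1_0(D)}=\left(\int_D|\nabla_{\mathbb{G}}u(\xi)|^2\,d\xi\right)^{1/2}$. It embeds continuously into $L^{2^*}(D)$ and compactly into $L^q(D)$ for $1\leq q<2^*$.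 A weak solution of the problem is a function $u\in S^1_0(D)$ such that for all $\varphi\in S^1_0(D)$ $$\int_D\langle\nabla_{\mathbb{G}}u(\xi),\nabla_{\mathbb{G}}\varphi(\xi)\rangle\,d\xi-\mu\int_D|u(\xi)|^{2^*-2}u(\xi)\varphi(\xi)\,d\xi=\lambda\int_Dg(u(\xi))\varphi(\xi)\,d\xi.$$ "Open interval" means nonempty open interval. A smooth bounded domain is a nonempty bounded connected open set with smooth boundary. *)

theory Defs
  imports "HOL-Analysis.Analysis" "HOL-Library.Function_Algebras"
begin

section \<open>Smooth functions\<close>

text \<open>Continuous partial derivatives of all orders; meant for open \<open>S\<close>.\<close>

primrec Ck_on :: "nat \<Rightarrow> ('a::euclidean_space \<Rightarrow> 'b::real_normed_vector) \<Rightarrow> 'a set \<Rightarrow> bool" where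
  "Ck_on 0 f S \<longleftrightarrow> continuous_on S f"
| "Ck_on (Suc k) f S \<longleftrightarrow>
     (\<forall>x\<in>S. f differentiable (at x)) \<and>
     (\<forall>b\<in>Basis. Ck_on k (\<lambda>x. frechet_derivative f (at x) b) S)"

definition smooth_on :: "('a::euclidean_space \<Rightarrow> 'b::real_normed_vector) \<Rightarrow> 'a set \<Rightarrow> bool" where
  "smooth_on f S \<longleftrightarrow> (\<forall>k. Ck_on k f S)"

text \<open>A defining function: \<open>D\<close> lies locally on one side of the smooth hypersurface \<open>\<rho> = 0\<close>.\<close>

definition smooth_boundary :: "'a::euclidean_space set \<Rightarrow> bool" where
  "smooth_boundary D \<longleftrightarrow>
     (\<forall>z\<in>frontier D. \<exists>U (\<rho> :: 'a \<Rightarrow> real).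
        open U \<and> z \<in> U \<and> smooth_on \<rho> U \<and>
        (\<forall>x\<in>U. frechet_derivative \<rho> (at x) \<noteq> (\<lambda>v. 0)) \<and>
        D \<inter> U = {x\<in>U. \<rho> x < 0})"

definition smooth_bounded_domain :: "'a::euclidean_space set \<Rightarrow> bool" where
  "smooth_bounded_domain D \<longleftrightarrow>
     D \<noteq> {} \<and> open D \<and> connected D \<and> bounded D \<and> smooth_boundary D"

section \<open>Vector fields\<close>

text \<open>The pointwise real vector space structure on functions, so that \<^const>\<open>subspace\<close>,
  \<^const>\<open>span\<close> and \<^const>\<open>dim\<close> apply to spaces of vector fields.\<close>

instantiation "fun" :: (type, real_vector) real_vector
begin

definition scaleR_fun :: "real \<Rightarrow> ('a \<Rightarrow> 'b) \<Rightarrow> 'a \<Rightarrow> 'b" where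
  "scaleR_fun c f = (\<lambda>x. c *\<^sub>R f x)"

instance
  by standard (simp_all add: scaleR_fun_def fun_eq_iff scaleR_add_right scaleR_add_left)

end

text \<open>A vector field is given by its coefficients; the associated first order differential operator
  sends \<open>f\<close> to the derivative of \<open>f\<close> in direction \<open>X\<close>, and the bracket below corresponds to the
  commutator \<open>XY - YX\<close> of operators.\<close>

type_synonym 'a vfield = "'a \<Rightarrow> 'a"

definition lie_bracket :: "'a::real_normed_vector vfield \<Rightarrow> 'a vfield \<Rightarrow> 'a vfield" where
  "lie_bracket X Y = (\<lambda>x. frechet_derivative Y (at x) (X x) - frechet_derivative X (at x) (Y x))"

definition bracket_space ::
    "'a::real_normed_vector vfield set \<Rightarrow> 'a vfield set \<Rightarrow> 'a vfield set" where
  "bracket_space V W = span {lie_bracket X Y | X Y. X \<in> V \<and> Y \<in> W}"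

definition left_invariant_fields ::
    "('a::euclidean_space \<Rightarrow> 'a \<Rightarrow> 'a) \<Rightarrow> 'a vfield set" where
  "left_invariant_fields mul =
     {X. smooth_on X UNIV \<and>
         (\<forall>a x. frechet_derivative (mul a) (at x) (X x) = X (mul a x))}"

section \<open>Homogeneous groups and Carnot groups\<close>

text \<open>The splitting of \<open>\<real>\<^sup>n\<close> into layers is encoded by a degree for every coordinate: coordinate \<open>i\<close>
  belongs to the layer \<open>\<xi>\<^sup>(\<^sup>k\<^sup>)\<close> with \<open>k = deg i\<close>. The index type is not ordered, so this is the block
  form up to the naming of coordinates.\<close>

definition layer_dim :: "('n::finite \<Rightarrow> nat) \<Rightarrow> nat \<Rightarrow> nat" where
  "layer_dim deg k = card {i. deg i = k}"

definition hom_dim :: "('n::finite \<Rightarrow> nat) \<Rightarrow> nat \<Rightarrow> nat" where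
  "hom_dim deg r = (\<Sum>k=1..r. k * layer_dim deg k)"

definition dilation :: "('n::finite \<Rightarrow> nat) \<Rightarrow> real \<Rightarrow> real^'n \<Rightarrow> real^'n" where
  "dilation deg \<eta> \<xi> = (\<chi> i. \<eta> ^ deg i * \<xi> $ i)"

locale homogeneous_group = group mul e inv
  for mul :: "real^'n::finite \<Rightarrow> real^'n \<Rightarrow> real^'n"
    and e :: "real^'n" and inv :: "real^'n \<Rightarrow> real^'n" +
  fixes deg :: "'n \<Rightarrow> nat" and r :: nat
  assumes smooth_mul: "smooth_on (\<lambda>(x, y). mul x y) UNIV"
    and smooth_inv: "smooth_on inv UNIV"
    and deg_range: "\<And>i. deg i \<in> {1..r}"
    and dilation_hom:
      "\<And>\<eta> x y. \<eta> > 0 \<Longrightarrow> dilation deg \<eta> (mul x y) = mul (dilation deg \<eta> x) (dilation deg \<eta> y)"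

text \<open>In \<open>direct_sum\<close>, the sum map is a bijection from the families \<open>(Y\<^sub>1, \<dots>, Y\<^sub>r)\<close> with
  \<open>Y\<^sub>k \<in> V\<^sub>k\<close> onto the Lie algebra.\<close>

locale carnot_group = homogeneous_group mul e inv deg r
  for mul :: "real^'n::finite \<Rightarrow> real^'n \<Rightarrow> real^'n"
    and e inv deg r +
  fixes V :: "nat \<Rightarrow> (real^'n) vfield set"
  assumes subspace_layer: "\<And>k. k \<in> {1..r} \<Longrightarrow> subspace (V k)"
    and direct_sum:
      "bij_betw (\<lambda>Y. \<Sum>k=1..r. Y k) (PiE {1..r} V) (left_invariant_fields mul)"
    and dim_layer: "\<And>k. k \<in> {1..r} \<Longrightarrow> dim (V k) = layer_dim deg k"
    and bracket_layer: "\<And>k. k \<in> {1..<r} \<Longrightarrow> bracket_space (V 1) (V k) = V (k + 1)"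
    and bracket_last: "bracket_space (V 1) (V r) = {0}"

section \<open>The Folland-Stein space\<close>

text \<open>The horizontal frame \<open>X\<close> is indexed by a finite type \<open>'m\<close>, of cardinality \<open>dim V\<^sub>1\<close> once \<open>X\<close> is
  a basis of \<open>V\<^sub>1\<close>, so that horizontal gradients take values in \<open>real^'m\<close>.\<close>

definition hgrad ::
    "('m::finite \<Rightarrow> 'a::real_normed_vector vfield) \<Rightarrow> ('a \<Rightarrow> real) \<Rightarrow> 'a \<Rightarrow> real^'m" where
  "hgrad X f x = (\<chi> j. frechet_derivative f (at x) (X j x))"

definition test_functions :: "'a::euclidean_space set \<Rightarrow> ('a \<Rightarrow> real) set" where
  "test_functions D =
     {f. smooth_on f UNIV \<and> compact (closure {x. f x \<noteq> 0}) \<and> closure {x. f x \<noteq> 0} \<subseteq> D}"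

definition fs_norm ::
    "('m::finite \<Rightarrow> 'a::euclidean_space vfield) \<Rightarrow> 'a set \<Rightarrow> ('a \<Rightarrow> real) \<Rightarrow> real" where
  "fs_norm X D f = sqrt (\<integral>x. (norm (hgrad X f x))\<^sup>2 \<partial>lebesgue_on D)"

text \<open>Convergence in \<open>L\<^sup>q(D)\<close>. The nonnegative integral is used so that a difference that is not
  \<open>q\<close>-integrable has infinite norm instead of the default value 0.\<close>

definition Lq_tendsto ::
    "real \<Rightarrow> 'a::euclidean_space set \<Rightarrow> (nat \<Rightarrow> 'a \<Rightarrow> 'b::euclidean_space) \<Rightarrow> ('a \<Rightarrow> 'b) \<Rightarrow> bool" where
  "Lq_tendsto q D \<phi> u \<longleftrightarrow>
     u \<in> borel_measurable (lebesgue_on D) \<and>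
     (\<lambda>k. \<integral>\<^sup>+x. ennreal (norm (\<phi> k x - u x) powr q) \<partial>lebesgue_on D) \<longlonglongrightarrow> 0"

text \<open>The completion of the test functions is realized as a space of functions by means of its
  embedding into \<open>L\<^sup>q(D)\<close>, where \<open>q\<close> is the critical exponent: the class of a Cauchy sequence of test
  functions is identified with the limit of that sequence in \<open>L\<^sup>q(D)\<close>. Functions that agree almost
  everywhere in \<open>D\<close> represent the same element; values outside \<open>D\<close> are irrelevant.\<close>

definition fs_represents ::
    "('m::finite \<Rightarrow> 'a::euclidean_space vfield) \<Rightarrow> real \<Rightarrow> 'a set \<Rightarrow>
     (nat \<Rightarrow> 'a \<Rightarrow> real) \<Rightarrow> ('a \<Rightarrow> real) \<Rightarrow> bool" where
  "fs_represents X q D \<phi> u \<longleftrightarrow>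
     (\<forall>k. \<phi> k \<in> test_functions D) \<and>
     (\<forall>\<epsilon>>0. \<exists>N. \<forall>k\<ge>N. \<forall>l\<ge>N. fs_norm X D (\<phi> k - \<phi> l) < \<epsilon>) \<and>
     Lq_tendsto q D \<phi> u"

definition folland_stein ::
    "('m::finite \<Rightarrow> 'a::euclidean_space vfield) \<Rightarrow> real \<Rightarrow> 'a set \<Rightarrow> ('a \<Rightarrow> real) set" where
  "folland_stein X q D = {u. \<exists>\<phi>. fs_represents X q D \<phi> u}"

text \<open>The gradient extends to the completion as the \<open>L\<^sup>2\<close> limit of the gradients of a representing
  sequence; it is determined by \<open>u\<close> up to a null set.\<close>

definition fs_grad ::
    "('m::finite \<Rightarrow> 'a::euclidean_space vfield) \<Rightarrow> real \<Rightarrow> 'a set \<Rightarrow> ('a \<Rightarrow> real) \<Rightarrow> 'a \<Rightarrow> real^'m" where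
  "fs_grad X q D u =
     (SOME U. \<exists>\<phi>. fs_represents X q D \<phi> u \<and> Lq_tendsto 2 D (\<lambda>k. hgrad X (\<phi> k)) U)"

section \<open>The critical problem\<close>

definition crit_exp :: "nat \<Rightarrow> real" where
  "crit_exp Q = 2 * real Q / (real Q - 2)"

text \<open>The convention \<open>\<bar>0\<bar>\<^sup>0 = 1\<close>, in contrast to \<^const>\<open>powr\<close>.\<close>

definition abs_pow :: "real \<Rightarrow> real \<Rightarrow> real" where
  "abs_pow t s = (if s = 0 then 1 else \<bar>t\<bar> powr s)"

text \<open>Integrability is part of the definition because the Bochner integral of a non-integrable
  function is 0.\<close>

definition weak_solution ::
    "('m::finite \<Rightarrow> 'a::euclidean_space vfield) \<Rightarrow> real \<Rightarrow> 'a set \<Rightarrow> (real \<Rightarrow> real) \<Rightarrow>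
     real \<Rightarrow> real \<Rightarrow> ('a \<Rightarrow> real) \<Rightarrow> bool" where
  "weak_solution X q D g \<mu> lam u \<longleftrightarrow>
     u \<in> folland_stein X q D \<and>
     (\<forall>\<phi>\<in>folland_stein X q D.
        integrable (lebesgue_on D) (\<lambda>x. fs_grad X q D u x \<bullet> fs_grad X q D \<phi> x) \<and>
        integrable (lebesgue_on D) (\<lambda>x. abs_pow (u x) (q - 2) * u x * \<phi> x) \<and>
        integrable (lebesgue_on D) (\<lambda>x. g (u x) * \<phi> x) \<and>
        (\<integral>x. fs_grad X q D u x \<bullet> fs_grad X q D \<phi> x \<partial>lebesgue_on D)
          - \<mu> * (\<integral>x. abs_pow (u x) (q - 2) * u x * \<phi> x \<partial>lebesgue_on D)
        = lam * (\<integral>x. g (u x) * \<phi> x \<partial>lebesgue_on D))"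

end

theory Submission
  imports Defs "HOL-Computational_Algebra.Polynomial"
begin

text \<open>Neither the Sobolev inequality nor a compact embedding is needed. By homogeneity, the
  component of lowest degree of a horizontal left invariant field is constant, so
  \<open>w = L (C - exp (\<kappa> x\<^sub>i))\<close> satisfies \<open>- \<Delta> w \<ge> 1\<close> on the bounded set \<open>D\<close> for suitable constants.
  Since \<open>2* > 2\<close>, for small \<open>s\<close> and then small \<open>\<lambda>\<close> the right hand side \<open>f\<close> is bounded by \<open>s\<close> on
  the range of \<open>s w\<close>, so that \<open>\<plusminus> s w\<close> are a super- and a subsolution. If \<open>t \<mapsto> f t + K t\<close> is
  nondecreasing, the iteration \<open>(- \<Delta> + K) u\<^sub>n\<^sub>+\<^sub>1 = f u\<^sub>n + K u\<^sub>n\<close> increases to a solution; in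
  general \<open>f\<close> is the increasing limit of its inf-convolutions, each of which has this property,
  and their solutions can be chosen increasing. A bounded monotone sequence converges in \<open>L\<^sup>2\<close> by
  dominated convergence, and testing the difference of two equations with the difference of their
  solutions shows that the gradients are Cauchy as well. Bounded elements of the \<open>L\<^sup>2\<close> energy
  closure are approximated by uniformly bounded test functions, hence also in \<open>L\<^sup>q\<close>.\<close>

section \<open>Smooth functions and cutoffs\<close>

text \<open>The work is done in L^2, where projection and weak limits of equations are elementary,
  while the Folland-Stein space is defined by convergence in L^q; the two closures are compared only
  at the end. The obstacle is comparison: the positive part of u - w is not smooth, and the barrier
  w does not vanish on the boundary of D. It is replaced by \<eta> (\<phi>_k - w), where the test
  functions \<phi>_k tend to u and \<eta> = \<open>flat 1\<close> is smooth, nondecreasing, zero for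
  t \<le> 0 and positive for t > 0. This is a test function as soon as w \<ge> 0, which is why
  barriers are smooth and nonnegative on the whole space. The term K u with K > 0 does two jobs: it
  turns the linear problem into a projection in L^2, and it lets the comparison argument end with a
  sign for u - w itself. The scale s is chosen so that the critical term takes up s / 2 of the bound
  s; the range of \<lambda> is what keeps \<lambda> g within the other half.\<close>

abbreviation fderiv :: "('a::real_normed_vector \<Rightarrow> 'b::real_normed_vector) \<Rightarrow> 'a \<Rightarrow> 'a \<Rightarrow> 'b"
  where "fderiv f x \<equiv> frechet_derivative f (at x)"

lemma fderiv_eqI: "(f has_derivative f') (at x) \<Longrightarrow> fderiv f x = f'"
  using frechet_derivative_at by metis

lemma continuous_bounded_on_compact:
  assumes "compact S" "continuous_on UNIV f"
  shows "\<exists>C. \<forall>x\<in>S. norm (f x) \<le> C"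
  using compact_imp_bounded[OF compact_continuous_image[OF continuous_on_subset[OF assms(2) subset_UNIV] assms(1)]]
  by (auto simp: bounded_iff)

section \<open>Calculus of \<open>Ck_on\<close> on the whole space\<close>

lemma Ck_on_Suc_imp: "Ck_on (Suc k) f UNIV \<Longrightarrow> Ck_on k f UNIV"
proof (induction k arbitrary: f)
  case 0
  then show ?case
    by (auto intro!: differentiable_imp_continuous_on differentiable_at_imp_differentiable_on)
next
  case (Suc k)
  then have "f differentiable (at x)" "b \<in> Basis \<Longrightarrow> Ck_on (Suc k) (\<lambda>x. fderiv f x b) UNIV" for x b
    unfolding Ck_on.simps(2)[of "Suc k"] by simp_all
  with Suc.IH show ?case by simp
qed

lemma Ck_on_all_continuous: "(\<And>k. Ck_on k f UNIV) \<Longrightarrow> continuous_on UNIV f"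
  by (metis Ck_on.simps(1))

lemma Ck_on_const: "Ck_on k (\<lambda>x::'a::euclidean_space. c::'b::real_normed_vector) UNIV"
  by (induction k arbitrary: c) auto

lemma Ck_on_add:
  fixes f g :: "'a::euclidean_space \<Rightarrow> 'b::real_normed_vector"
  assumes "Ck_on k f UNIV" "Ck_on k g UNIV"
  shows "Ck_on k (\<lambda>x. f x + g x) UNIV"
  using assms
proof (induction k arbitrary: f g)
  case 0 then show ?case by (auto intro: continuous_intros)
next
  case (Suc k)
  then have "fderiv (\<lambda>x. f x + g x) x = (\<lambda>v. fderiv f x v + fderiv g x v)" for x
    by (intro fderiv_eqI has_derivative_add) (auto simp: frechet_derivative_works)
  with Suc show ?case by (auto intro: differentiable_add)
qed

lemma Ck_on_scaleR:
  fixes f :: "'a::euclidean_space \<Rightarrow> real" and g :: "'a \<Rightarrow> 'b::real_normed_vector"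
  assumes "Ck_on k f UNIV" "Ck_on k g UNIV"
  shows "Ck_on k (\<lambda>x. f x *\<^sub>R g x) UNIV"
  using assms
proof (induction k arbitrary: f g)
  case 0 then show ?case by (auto intro: continuous_intros)
next
  case (Suc k)
  then have "fderiv (\<lambda>x. f x *\<^sub>R g x) x = (\<lambda>v. f x *\<^sub>R fderiv g x v + fderiv f x v *\<^sub>R g x)" for x
    by (intro fderiv_eqI has_derivative_scaleR) (auto simp: frechet_derivative_works)
  moreover have "Ck_on k f UNIV" "Ck_on k g UNIV"
    using Suc.prems by (blast intro: Ck_on_Suc_imp)+
  ultimately show ?case using Suc
    by (auto intro!: differentiable_scaleR Ck_on_add)
qed

lemma Ck_on_mult:
  fixes f g :: "'a::euclidean_space \<Rightarrow> real"
  assumes "Ck_on k f UNIV" "Ck_on k g UNIV"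
  shows "Ck_on k (\<lambda>x. f x * g x) UNIV"
  using Ck_on_scaleR[OF assms] by simp

lemma Ck_on_linear:
  fixes f :: "'a::euclidean_space \<Rightarrow> 'b::real_normed_vector"
  assumes "Ck_on k f UNIV" "bounded_linear L"
  shows "Ck_on k (\<lambda>x. L (f x)) UNIV"
  using assms(1)
proof (induction k arbitrary: f)
  case 0 then show ?case
    using bounded_linear.continuous_on[OF assms(2)] by auto
next
  case (Suc k)
  have d: "((\<lambda>x. L (f x)) has_derivative (\<lambda>v. L (fderiv f x v))) (at x)" for x
    using Suc.prems frechet_derivative_works
    by (intro bounded_linear.has_derivative[OF assms(2)]) auto
  show ?case using Suc by (auto simp: fderiv_eqI[OF d] intro: differentiableI[OF d])
qed

lemma Ck_on_ident: "Ck_on k (\<lambda>x::'a::euclidean_space. x) UNIV"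
  by (cases k) (auto simp: Ck_on_const)

lemma Ck_on_sum:
  fixes f :: "'i \<Rightarrow> 'a::euclidean_space \<Rightarrow> 'b::real_normed_vector"
  assumes "\<And>i. i \<in> I \<Longrightarrow> Ck_on k (f i) UNIV"
  shows "Ck_on k (\<lambda>x. \<Sum>i\<in>I. f i x) UNIV"
  using assms
proof (induction I rule: infinite_finite_induct)
  case (insert i I)
  then have "Ck_on k (f i) UNIV" "Ck_on k (\<lambda>x. \<Sum>i\<in>I. f i x) UNIV" by blast+
  from Ck_on_add[OF this] insert.hyps show ?case by simp
qed (simp_all add: Ck_on_const)

lemma has_derivative_fderiv_compose:
  fixes f :: "'a::real_normed_vector \<Rightarrow> real" and \<psi> :: "real \<Rightarrow> real"
  assumes "f differentiable (at x)" "\<psi> differentiable (at (f x))"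
  shows "((\<lambda>x. \<psi> (f x)) has_derivative (\<lambda>v. fderiv \<psi> (f x) 1 * fderiv f x v)) (at x)"
proof -
  let ?c = "fderiv \<psi> (f x)"
  have "linear ?c" using assms(2) by (rule linear_frechet_derivative)
  then have "?c (t *\<^sub>R 1) = t *\<^sub>R ?c 1" for t by (rule linear_scale)
  then have "?c t = ?c 1 * t" for t unfolding real_scaleR_def mult_1_right by (rule trans) (rule mult.commute)
  then have eq: "(\<lambda>v. ?c (fderiv f x v)) = (\<lambda>v. ?c 1 * fderiv f x v)" by (intro ext)
  show ?thesis
    using has_derivative_compose[OF assms[THEN frechet_derivative_works[THEN iffD1]]]
    unfolding eq .
qed

lemma Ck_on_compose:
  fixes f :: "'a::euclidean_space \<Rightarrow> real" and \<psi> :: "real \<Rightarrow> real"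
  assumes "Ck_on k f UNIV" "Ck_on k \<psi> UNIV"
  shows "Ck_on k (\<lambda>x. \<psi> (f x)) UNIV"
  using assms
proof (induction k arbitrary: f \<psi>)
  case 0 then show ?case by (auto intro: continuous_on_compose2)
next
  case (Suc k)
  have d: "((\<lambda>x. \<psi> (f x)) has_derivative (\<lambda>v. fderiv \<psi> (f x) 1 * fderiv f x v)) (at x)" for x
    using Suc.prems by (intro has_derivative_fderiv_compose) auto
  have "Ck_on k (\<lambda>x. fderiv \<psi> x 1) UNIV" using Suc.prems by auto
  with Suc have "Ck_on k (\<lambda>x. fderiv \<psi> (f x) 1) UNIV"
    by (intro Suc.IH[of f "\<lambda>x. fderiv \<psi> x 1"]) (auto intro: Ck_on_Suc_imp)
  with Suc.prems show ?case by (auto simp: fderiv_eqI[OF d] intro!: Ck_on_mult intro: differentiableI[OF d])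
qed

lemma fderiv_real:
  assumes "(\<psi> has_real_derivative d) (at t)"
  shows "fderiv \<psi> t 1 = d"
  using fderiv_eqI[OF assms[unfolded has_field_derivative_def]] by simp

lemma Ck_on_real_Suc:
  fixes \<psi> d :: "real \<Rightarrow> real"
  assumes "\<And>t. (\<psi> has_real_derivative d t) (at t)" "Ck_on k d UNIV"
  shows "Ck_on (Suc k) \<psi> UNIV"
proof -
  have "(\<lambda>t. fderiv \<psi> t 1) = d" using fderiv_real assms(1) by blast
  with assms show ?thesis
    by (auto simp: has_field_derivative_def intro: differentiableI)
qed

lemma Ck_on_real_I:
  fixes \<psi> d :: "real \<Rightarrow> real"
  assumes "\<And>t. (\<psi> has_real_derivative d t) (at t)" "\<And>k. Ck_on k d UNIV"
  shows "Ck_on k \<psi> UNIV"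
  using Ck_on_real_Suc[OF assms] Ck_on_Suc_imp by blast

lemma Ck_on_exp: "Ck_on k (exp :: real \<Rightarrow> real) UNIV"
proof (induction k)
  case 0 then show ?case by (auto intro: continuous_intros)
next
  case (Suc k) then show ?case using Ck_on_real_Suc[OF DERIV_exp] by blast
qed

text \<open>\<open>flat 1\<close> is the classical smooth function exp (-1/t) continued by 0. The
  polynomial in 1/t makes the family closed under differentiation, so that one induction gives all
  orders.\<close>

definition flat :: "real poly \<Rightarrow> real \<Rightarrow> real" where
  "flat p t = (if t \<le> 0 then 0 else poly p (1 / t) * exp (- (1 / t)))"

text \<open>The free power \<open>n\<close> absorbs the factor y that \<open>pCons\<close> puts in
  front of the remaining polynomial, so the induction closes.\<close>

lemma power_poly_exp_tendsto_0:
  fixes p :: "real poly"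
  shows "((\<lambda>y. y ^ n * poly p y * exp (- y)) \<longlongrightarrow> 0) at_top"
proof (induction p arbitrary: n)
  case 0 then show ?case by simp
next
  case (pCons a p)
  have "((\<lambda>y. a * (y ^ n / exp y) + y ^ Suc n * poly p y * exp (- y)) \<longlongrightarrow> a * 0 + 0) at_top"
    by (intro tendsto_intros tendsto_power_div_exp_0 pCons.IH)
  then show ?case by (simp add: algebra_simps exp_minus divide_inverse)
qed

lemma flat_tendsto_0: "(flat p \<longlongrightarrow> 0) (at 0)"
proof -
  have "((\<lambda>t. poly p (inverse t) * exp (- inverse t)) \<longlongrightarrow> 0) (at_right (0::real))"
    using filterlim_compose[OF power_poly_exp_tendsto_0[of 0 p] filterlim_inverse_at_top_right] by simp
  then have "(flat p \<longlongrightarrow> 0) (at_right 0)"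
    by (rule Lim_transform_eventually)
       (auto simp: flat_def eventually_at_right_field inverse_eq_divide intro: exI[of _ 1])
  moreover have "(flat p \<longlongrightarrow> 0) (at_left 0)"
    by (rule Lim_transform_eventually[OF tendsto_const])
       (auto simp: flat_def eventually_at_left_field intro: exI[of _ "-1"])
  ultimately show ?thesis by (simp add: filterlim_split_at)
qed

text \<open>With y = 1/t the inner derivative is -y^2, so differentiation turns p into y^2 (p - p');
  \<open>monom 1 2\<close> is the factor y^2.\<close>

lemma flat_deriv:
  "(flat p has_real_derivative flat (monom 1 2 * (p - pderiv p)) t) (at t)"
proof (cases "t = 0")
  case True
  \<comment> \<open>Dividing by h multiplies the polynomial by 1/h: the difference quotient of
    \<open>flat p\<close> at 0 is again a flat function, whose limit is known.\<close>
  have "flat (pCons 0 p) = (\<lambda>h. flat p h / h)"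
    by (auto simp: flat_def)
  then have "((\<lambda>h. (flat p (0 + h) - flat p 0) / h) \<longlongrightarrow> 0) (at 0)"
    using flat_tendsto_0[of "pCons 0 p"] by (simp add: flat_def[of p 0])
  then show ?thesis using True by (simp add: DERIV_def flat_def[of _ 0])
next
  case False
  show ?thesis
  proof (cases "t < 0")
    case True
    have "(flat p has_real_derivative 0) (at t)"
      by (rule has_field_derivative_transform_within_open[OF DERIV_const, of "{..<0}"])
         (use True in \<open>auto simp: flat_def\<close>)
    then show ?thesis using True by (simp add: flat_def)
  next
    case f: False
    then have t: "t > 0" using False by simp
    have "((\<lambda>t. poly p (1 / t) * exp (- (1 / t))) has_real_derivative flat (monom 1 2 * (p - pderiv p)) t) (at t)"
    proof -
      have i: "((\<lambda>t. 1 / t) has_real_derivative - (1 / t\<^sup>2)) (at t)"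
        using t by (auto intro!: derivative_eq_intros simp: power2_eq_square)
      have "((\<lambda>t. poly p (1 / t) * exp (- (1 / t))) has_real_derivative
          (poly (pderiv p) (1 / t) * - (1 / t\<^sup>2)) * exp (- (1 / t)) +
          (exp (- (1 / t)) * - (- (1 / t\<^sup>2))) * poly p (1 / t)) (at t)"
        by (intro DERIV_mult DERIV_chain2[OF poly_DERIV i] DERIV_chain2[OF DERIV_exp DERIV_minus[OF i]])
      then show ?thesis
        by (rule DERIV_cong) (use t in \<open>simp add: flat_def poly_monom power_one_over algebra_simps\<close>)
    qed
    then show ?thesis
      by (rule has_field_derivative_transform_within_open[of _ _ _ "{0<..}"])
         (use t in \<open>auto simp: flat_def\<close>)
  qed
qed

lemma Ck_on_flat: "Ck_on k (flat p) UNIV"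
proof (induction k arbitrary: p)
  case 0 then show ?case using flat_deriv by (auto intro!: DERIV_continuous_on[of UNIV] )
next
  case (Suc k) then show ?case using Ck_on_real_Suc[OF flat_deriv] by blast
qed

lemma Ck_on_affine: "Ck_on k (\<lambda>t::real. a + b * t) UNIV"
  by (intro Ck_on_add Ck_on_const Ck_on_mult Ck_on_ident)

text \<open>The normalised primitive of a smooth bump supported in [0, 1].\<close>

lemma exists_smooth_step:
  "\<exists>\<sigma>::real\<Rightarrow>real. (\<forall>k. Ck_on k \<sigma> UNIV) \<and> (\<forall>t\<le>0. \<sigma> t = 0) \<and> (\<forall>t\<ge>1. \<sigma> t = 1)"
proof -
  define b where "b t = flat 1 t * flat 1 (1 - t)" for t
  have Ckb: "Ck_on k b UNIV" for k
    unfolding b_def using Ck_on_compose[OF Ck_on_affine[of k 1 "-1"] Ck_on_flat[of k 1]]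
    by (intro Ck_on_mult Ck_on_flat) simp
  have contb: "continuous_on S b" for S
    using Ckb[of 0] continuous_on_subset by auto
  have b0: "b t \<ge> 0" for t by (simp add: b_def flat_def)
  have bz: "b t = 0" if "t \<le> 0 \<or> t \<ge> 1" for t using that by (auto simp: b_def flat_def)
  \<comment> \<open>Starting at -1, left of the support of \<open>b\<close>, puts every t \<ge> 0
    into the interior of {-1..t+1}, so that the fundamental theorem gives a two-sided derivative
    there.\<close>
  define I where "I t = integral {-1..t} b" for t
  have I_split: "I t = I s + integral {s..t} b" if "-1 \<le> s" "s \<le> t" for s t
    unfolding I_def
    using Henstock_Kurzweil_Integration.integral_combine[OF that integrable_continuous_real[OF contb]] by simp
  have I0: "I t = 0" if "t \<le> 0" for t
    unfolding I_def using that bz by (subst integral_cong[where g="\<lambda>_. 0"]) auto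
  have I1: "I t = I 1" if "t \<ge> 1" for t
  proof -
    have "integral {1..t} b = integral {1..t} (\<lambda>_. 0)"
      by (rule integral_cong) (use bz in simp)
    then show ?thesis using I_split[of 1 t] that by simp
  qed
  have d: "(I has_real_derivative b t) (at t)" for t
  proof (cases "t < 0")
    case True
    have "(I has_real_derivative 0) (at t)"
      by (rule has_field_derivative_transform_within_open[OF DERIV_const, of "{..<0}"])
         (use True I0 in auto)
    then show ?thesis using bz True by simp
  next
    case False
    have "(I has_real_derivative b t) (at t within {-1..t+1})"
      unfolding I_def using False by (intro integral_has_real_derivative contb) auto
    then show ?thesis using False at_within_Icc_at[of "-1" t "t+1"] by auto
  qed
  have "0 < I 1"
  proof -
    have "I 1 \<noteq> 0"
    proof
      assume "I 1 = 0"
      then have "integral {0..1} b = 0" using I_split[of 0 1] I0[of 0] by simp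
      then have "\<forall>x\<in>{0..1}. b x = 0"
        using integral_eq_0_iff[OF contb] b0 by auto
      then have "b (1/2) = 0" by simp
      then show False by (simp add: b_def flat_def)
    qed
    moreover have "I 1 \<ge> 0" unfolding I_def using b0 by (intro integral_nonneg integrable_continuous_real contb) auto
    ultimately show ?thesis by simp
  qed
  moreover have "Ck_on k (\<lambda>t. inverse (I 1) * I t) UNIV" for k
    by (rule Ck_on_mult[OF Ck_on_const Ck_on_real_I[OF d Ckb]])
  moreover have "inverse (I 1) * I t = 1" if "t \<ge> 1" for t
    using I1[OF that] \<open>0 < I 1\<close> by simp
  ultimately show ?thesis
    using I0 by (intro exI[of _ "\<lambda>t. inverse (I 1) * I t"]) simp
qed

lemma bounded_continuous_compact_support:
  assumes "continuous_on UNIV f" "compact K" "\<And>x. x \<notin> K \<Longrightarrow> f x = 0"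
  shows "\<exists>B. \<forall>x. norm (f x) \<le> B"
proof -
  obtain B where B: "\<forall>x\<in>K. norm (f x) \<le> B"
    using continuous_bounded_on_compact[OF assms(2,1)] by blast
  have "norm (f x) \<le> max B 0" for x
    using B assms(3)[of x] by (cases "x \<in> K") (auto simp: le_max_iff_disj)
  then show ?thesis by blast
qed

lemma exists_smooth_truncation:
  assumes "M \<ge> 0"
  shows "\<exists>(T::real\<Rightarrow>real) T' C. (\<forall>k. Ck_on k T UNIV) \<and> (\<forall>t. (T has_real_derivative T' t) (at t)) \<and>
     continuous_on UNIV T' \<and> (\<forall>t. \<bar>T t\<bar> \<le> C) \<and> (\<forall>t. \<bar>T' t\<bar> \<le> C) \<and>
     (\<forall>t. \<bar>t\<bar> \<le> M \<longrightarrow> T t = t \<and> T' t = 1)"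
proof -
  obtain \<sigma> :: "real \<Rightarrow> real" where \<sigma>: "\<And>k. Ck_on k \<sigma> UNIV" "\<And>t. t \<le> 0 \<Longrightarrow> \<sigma> t = 0" "\<And>t. t \<ge> 1 \<Longrightarrow> \<sigma> t = 1"
    using exists_smooth_step by blast
  \<comment> \<open>The product of the two steps is 1 for |t| \<le> M + 1 and 0 for |t| \<ge> M + 2.
    The margin beyond M makes T the identity near every point of [-M, M], so that T' = 1 there
    including the end points; compact support bounds T and T'.\<close>
  define T where "T t = t * (\<sigma> ((M + 2) + 1 * t) * \<sigma> ((M + 2) + (-1) * t))" for t
  have Ck: "Ck_on k T UNIV" for k
    unfolding T_def by (intro Ck_on_mult Ck_on_ident Ck_on_compose[OF Ck_on_affine \<sigma>(1)])
  define T' where "T' t = fderiv T t 1" for t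
  have d: "(T has_real_derivative T' t) (at t)" for t
  proof -
    have "T differentiable (at t)" using Ck[of 1] by simp
    then obtain y where "(T has_real_derivative y) (at t)" using real_differentiable_def by blast
    then show ?thesis using fderiv_real T'_def by metis
  qed
  have T0: "T t = 0" if "\<bar>t\<bar> \<ge> M + 2" for t using that \<sigma>(2) by (auto simp: T_def abs_if split: if_splits)
  have Tid: "T t = t" if "\<bar>t\<bar> \<le> M + 1" for t using that \<sigma>(3) by (auto simp: T_def)
  have cT': "continuous_on UNIV T'" using Ck[of 1] unfolding T'_def by simp
  have T'0: "T' t = 0" if "\<bar>t\<bar> \<ge> M + 3" for t
  proof -
    have "(T has_real_derivative 0) (at t)"
      by (rule has_field_derivative_transform_within_open[OF DERIV_const, of "- {-(M+2)..M+2}"])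
         (use that T0 in auto)
    then show ?thesis using d DERIV_unique by blast
  qed
  have T'1: "T' t = 1" if "\<bar>t\<bar> \<le> M" for t
  proof -
    have "(T has_real_derivative 1) (at t)"
      by (rule has_field_derivative_transform_within_open[OF DERIV_ident, of "{-(M+1)<..<M+1}"])
         (use that Tid in auto)
    then show ?thesis using d DERIV_unique by blast
  qed
  obtain C1 where "\<forall>t. \<bar>T t\<bar> \<le> C1" 
    using bounded_continuous_compact_support[of T "{-(M+2)..M+2}"] Ck_on_all_continuous[OF Ck] T0
    by fastforce
  moreover obtain C2 where "\<forall>t. \<bar>T' t\<bar> \<le> C2" 
    using bounded_continuous_compact_support[of T' "{-(M+3)..M+3}"] cT' T'0 by fastforce
  ultimately show ?thesis
    using Ck d cT' T'1 Tid assms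
    by (intro exI[of _ T] exI[of _ T'] exI[of _ "max C1 C2"]) (auto simp: le_max_iff_disj)
qed

text \<open>\<open>flat 1\<close> serves as a smooth, 2-Lipschitz substitute for the positive part.
  Its derivative is y^2 exp (-y) with y = 1/t, and exp y \<ge> y^2 / 2 bounds it by 2.\<close>

lemma flat_1_bounds:
  shows "0 \<le> flat 1 t" "t > 0 \<Longrightarrow> 0 < flat 1 t" "t \<le> 0 \<Longrightarrow> flat 1 t = 0"
    "0 \<le> flat (monom 1 2 * (1 - pderiv 1)) t" "flat (monom 1 2 * (1 - pderiv 1)) t \<le> 2"
proof -
  have "y\<^sup>2 * exp (- y) \<le> 2" if "y > 0" for y :: real
    using exp_lower_Taylor_quadratic[of y] that
    by (simp add: exp_minus field_simps)
  from this[of "1 / t"] show "0 \<le> flat (monom 1 2 * (1 - pderiv 1)) t" "flat (monom 1 2 * (1 - pderiv 1)) t \<le> 2"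
    by (auto simp: flat_def poly_monom)
qed (auto simp: flat_def)

section \<open>Square integrable functions\<close>

text \<open>Functions rather than classes modulo null sets, with values in any Euclidean space: the
  same lemmas serve functions, gradients and pairs of both.\<close>

definition L2 :: "'a measure \<Rightarrow> ('a \<Rightarrow> 'b::euclidean_space) \<Rightarrow> bool" where
  "L2 M f \<longleftrightarrow> f \<in> borel_measurable M \<and> integrable M (\<lambda>x. (norm (f x))\<^sup>2)"

text \<open>The squared norm avoids square roots; the price is the factor 2 in triangle inequalities
  such as \<open>nsq_triangle\<close>.\<close>

definition nsq :: "'a measure \<Rightarrow> ('a \<Rightarrow> 'b::euclidean_space) \<Rightarrow> real" where
  "nsq M f = (\<integral>x. (norm (f x))\<^sup>2 \<partial>M)"

definition L2lim :: "'a measure \<Rightarrow> (nat \<Rightarrow> 'a \<Rightarrow> 'b::euclidean_space) \<Rightarrow> ('a \<Rightarrow> 'b) \<Rightarrow> bool" where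
  "L2lim M F f \<longleftrightarrow> (\<forall>k. L2 M (F k)) \<and> L2 M f \<and> (\<lambda>k. nsq M (\<lambda>x. F k x - f x)) \<longlonglongrightarrow> 0"

lemma norm_add_sq_le: "(norm (a + b))\<^sup>2 \<le> 2 * (norm a)\<^sup>2 + 2 * (norm (b::'b::real_inner))\<^sup>2"
proof -
  have "(norm (a + b))\<^sup>2 + (norm (a - b))\<^sup>2 = 2 * (norm a)\<^sup>2 + 2 * (norm b)\<^sup>2"
    by (simp add: power2_norm_eq_inner algebra_simps inner_commute)
  then show ?thesis by (metis le_add_same_cancel1 zero_le_power2)
qed

lemma norm_diff_sq_le: "(norm (a - b))\<^sup>2 \<le> 2 * (norm a)\<^sup>2 + 2 * (norm (b::'b::real_inner))\<^sup>2"
  using norm_add_sq_le[of a "- b"] by simp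

lemma L2_measurable: "L2 M f \<Longrightarrow> f \<in> borel_measurable M"
  and L2_integrable: "L2 M f \<Longrightarrow> integrable M (\<lambda>x. (norm (f x))\<^sup>2)"
  by (auto simp: L2_def)

lemma nsq_nonneg [simp]: "0 \<le> nsq M f"
  by (simp add: nsq_def)

lemma L2_dominated:
  assumes "f \<in> borel_measurable M" "integrable M g" "AE x in M. (norm (f x))\<^sup>2 \<le> g x"
  shows "L2 M f"
  unfolding L2_def
proof (intro conjI Bochner_Integration.integrable_bound[OF assms(2)])
  show "AE x in M. norm ((norm (f x))\<^sup>2) \<le> norm (g x)"
    using assms(3) by eventually_elim simp
qed (use assms(1) in measurable)

lemma L2_add: "L2 M f \<Longrightarrow> L2 M g \<Longrightarrow> L2 M (\<lambda>x. f x + g x)"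
  by (rule L2_dominated[where g = "\<lambda>x. 2 * (norm (f x))\<^sup>2 + 2 * (norm (g x))\<^sup>2"])
     (auto simp: L2_def norm_add_sq_le)

lemma L2_scaleR: "L2 M f \<Longrightarrow> L2 M (\<lambda>x. c *\<^sub>R f x)"
  by (auto simp: L2_def power_mult_distrib)

lemma L2_mult: "L2 M f \<Longrightarrow> L2 M (\<lambda>x. c * f x :: real)"
  using L2_scaleR[of M f c] by simp

lemma L2_diff: "L2 M f \<Longrightarrow> L2 M g \<Longrightarrow> L2 M (\<lambda>x. f x - g x)"
  using L2_add[of M f "\<lambda>x. -1 *\<^sub>R g x"] L2_scaleR[of M g "-1"] by simp

lemma norm_scaleR_sq_le: "\<bar>a\<bar> \<le> C \<Longrightarrow> (norm (a *\<^sub>R v))\<^sup>2 \<le> C\<^sup>2 * (norm v)\<^sup>2"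
  using abs_le_square_iff[of a C] by (simp add: power_mult_distrib mult_right_mono)

lemma L2_mult_bounded:
  fixes a :: "'a \<Rightarrow> real"
  assumes "L2 M f" "a \<in> borel_measurable M" "\<And>x. \<bar>a x\<bar> \<le> C"
  shows "L2 M (\<lambda>x. a x *\<^sub>R f x)"
proof (rule L2_dominated)
  show "AE x in M. (norm (a x *\<^sub>R f x))\<^sup>2 \<le> C\<^sup>2 * (norm (f x))\<^sup>2"
    by (intro AE_I2 norm_scaleR_sq_le assms(3))
qed (use assms in \<open>auto simp: L2_def\<close>)

lemma L2_inner: "L2 M f \<Longrightarrow> L2 M g \<Longrightarrow> integrable M (\<lambda>x. f x \<bullet> g x)"
proof -
  assume fg: "L2 M f" "L2 M g"
  show ?thesis
  proof (rule Bochner_Integration.integrable_bound)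
    show "integrable M (\<lambda>x. (norm (f x))\<^sup>2 + (norm (g x))\<^sup>2)"
      using fg by (auto simp: L2_def)
    have "\<bar>f x \<bullet> g x\<bar> \<le> (norm (f x))\<^sup>2 + (norm (g x))\<^sup>2" for x
    proof -
      have "\<bar>f x \<bullet> g x\<bar> \<le> norm (f x) * norm (g x)" by (rule Cauchy_Schwarz_ineq2)
      moreover have "2 * (norm (f x) * norm (g x)) \<le> (norm (f x))\<^sup>2 + (norm (g x))\<^sup>2"
        using sum_squares_bound[of "norm (f x)" "norm (g x)"] by simp
      ultimately show ?thesis by (smt (verit) zero_le_mult_iff norm_ge_zero)
    qed
    then show "AE x in M. norm (f x \<bullet> g x) \<le> norm ((norm (f x))\<^sup>2 + (norm (g x))\<^sup>2)" by simp
  qed (use fg in \<open>auto simp: L2_def\<close>)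
qed

lemma L2_mult_integrable: "L2 M f \<Longrightarrow> L2 M g \<Longrightarrow> integrable M (\<lambda>x. f x * g x :: real)"
  using L2_inner[of M f g] by simp

lemma nsq_add_le: "L2 M f \<Longrightarrow> L2 M g \<Longrightarrow> nsq M (\<lambda>x. f x + g x) \<le> 2 * nsq M f + 2 * nsq M g"
proof -
  assume fg: "L2 M f" "L2 M g"
  have "nsq M (\<lambda>x. f x + g x) \<le> (\<integral>x. 2 * (norm (f x))\<^sup>2 + 2 * (norm (g x))\<^sup>2 \<partial>M)"
    unfolding nsq_def using fg L2_add[OF fg] by (intro integral_mono) (auto simp: L2_def norm_add_sq_le)
  also have "\<dots> = 2 * nsq M f + 2 * nsq M g" using fg by (simp add: nsq_def L2_def)
  finally show ?thesis .
qed

lemma nsq_triangle: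
  assumes "L2 M f" "L2 M g" "L2 M h"
  shows "nsq M (\<lambda>x. f x - h x) \<le> 2 * nsq M (\<lambda>x. f x - g x) + 2 * nsq M (\<lambda>x. g x - h x)"
  using nsq_add_le[OF L2_diff[OF assms(1,2)] L2_diff[OF assms(2,3)]] by simp

lemma nsq_commute: "nsq M (\<lambda>x. f x - g x) = nsq M (\<lambda>x. g x - f x)"
  by (simp add: nsq_def norm_minus_commute)

lemma nsq_scaleR: "nsq M (\<lambda>x. c *\<^sub>R f x) = c\<^sup>2 * nsq M f"
  by (simp add: nsq_def power_mult_distrib)

lemma nsq_add_scaleR:
  assumes "L2 M f" "L2 M g"
  shows "nsq M (\<lambda>x. f x + t *\<^sub>R g x) = nsq M f + 2 * t * (\<integral>x. f x \<bullet> g x \<partial>M) + t\<^sup>2 * nsq M g"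
proof -
  have "nsq M (\<lambda>x. f x + t *\<^sub>R g x) =
    (\<integral>x. (norm (f x))\<^sup>2 + 2 * t * (f x \<bullet> g x) + t\<^sup>2 * (norm (g x))\<^sup>2 \<partial>M)"
    unfolding nsq_def power2_norm_eq_inner
    by (intro Bochner_Integration.integral_cong)
       (auto simp: algebra_simps inner_commute power2_eq_square)
  also have "\<dots> = nsq M f + 2 * t * (\<integral>x. f x \<bullet> g x \<partial>M) + t\<^sup>2 * nsq M g"
    using assms L2_inner[OF assms] by (simp add: nsq_def L2_def)
  finally show ?thesis .
qed

text \<open>Serves twice: for the Cauchy-Schwarz inequality and for the near orthogonality of a
  minimising sequence in \<open>L2_projection\<close>. For c > 0 the vertex t = -b/c decides; for c
  = 0 a nonconstant affine function would take negative values.\<close>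

lemma discriminant_bound:
  fixes a b c :: real
  assumes "\<And>t. 0 \<le> a + 2 * t * b + t\<^sup>2 * c" "0 \<le> c"
  shows "b\<^sup>2 \<le> a * c"
proof (cases "c = 0")
  case True
  have "b = 0"
  proof (rule ccontr)
    assume "b \<noteq> 0"
    then have "0 \<le> a + - (a + 1)" using assms(1)[of "- (a + 1) / (2 * b)"] True by (simp add: field_simps)
    then show False by simp
  qed
  then show ?thesis using True by simp
next
  case False
  then have c: "c > 0" using assms(2) by simp
  have "0 \<le> c * (a + 2 * (- b / c) * b + (- b / c)\<^sup>2 * c)"
    using assms(1)[of "- b / c"] c by simp
  also have "\<dots> = a * c - b\<^sup>2" using c by (simp add: power2_eq_square algebra_simps)
  finally show ?thesis by simp
qed

lemma L2_Cauchy_Schwarz: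
  assumes "L2 M f" "L2 M g"
  shows "(\<integral>x. f x \<bullet> g x \<partial>M)\<^sup>2 \<le> nsq M f * nsq M g"
  using nsq_add_scaleR[OF assms] by (intro discriminant_bound) (metis nsq_nonneg)+

lemma nsq_tendsto_0:
  assumes "\<And>k. nsq M (F k) \<le> b k" "b \<longlonglongrightarrow> 0"
  shows "(\<lambda>k. nsq M (F k)) \<longlonglongrightarrow> 0"
  by (rule Lim_null_comparison[OF always_eventually assms(2)]) (use assms(1) in simp)

lemma L2lim_L2: "L2lim M F f \<Longrightarrow> L2 M f" and L2lim_L2_seq: "L2lim M F f \<Longrightarrow> L2 M (F k)"
  by (auto simp: L2lim_def)

lemma L2lim_const: "L2 M f \<Longrightarrow> L2lim M (\<lambda>k. f) f"
  by (simp add: L2lim_def nsq_def)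

lemma tendsto_0_of_sq_le:
  fixes a b :: "nat \<Rightarrow> real"
  assumes "\<And>k. (a k)\<^sup>2 \<le> b k" "b \<longlonglongrightarrow> 0"
  shows "a \<longlonglongrightarrow> 0"
proof -
  have "(\<lambda>k. (a k)\<^sup>2) \<longlonglongrightarrow> 0"
    by (rule tendsto_sandwich[OF _ _ tendsto_const assms(2)]) (use assms(1) in auto)
  then have "(\<lambda>k. sqrt ((a k)\<^sup>2)) \<longlonglongrightarrow> sqrt 0" by (rule tendsto_real_sqrt)
  then show ?thesis by (simp add: tendsto_rabs_zero_iff)
qed

lemma L2lim_inner:
  assumes "L2lim M F f" "L2lim M G g"
  shows "(\<lambda>k. \<integral>x. F k x \<bullet> G k x \<partial>M) \<longlonglongrightarrow> (\<integral>x. f x \<bullet> g x \<partial>M)"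
proof -
  have L: "L2 M (F k)" "L2 M f" "L2 M (G k)" "L2 M g" for k
    using assms by (auto simp: L2lim_def)
  note D = L2_diff[OF L(1) L(2)] L2_diff[OF L(3) L(4)]
  have z: "(\<lambda>k. \<integral>x. (F k x - f x) \<bullet> (G k x - g x) \<partial>M) \<longlonglongrightarrow> 0"
  proof (rule tendsto_0_of_sq_le)
    show "(\<lambda>k. nsq M (\<lambda>x. F k x - f x) * nsq M (\<lambda>x. G k x - g x)) \<longlonglongrightarrow> 0"
      using tendsto_mult[of "\<lambda>k. nsq M (\<lambda>x. F k x - f x)" 0 sequentially "\<lambda>k. nsq M (\<lambda>x. G k x - g x)" 0] assms
      by (simp add: L2lim_def)
  qed (rule L2_Cauchy_Schwarz[OF D])
  have z1: "(\<lambda>k. \<integral>x. (F k x - f x) \<bullet> g x \<partial>M) \<longlonglongrightarrow> 0"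
  proof (rule tendsto_0_of_sq_le)
    show "(\<lambda>k. nsq M (\<lambda>x. F k x - f x) * nsq M g) \<longlonglongrightarrow> 0"
      using tendsto_mult_left_zero assms by (auto simp: L2lim_def)
  qed (rule L2_Cauchy_Schwarz[OF D(1) L(4)])
  have z2: "(\<lambda>k. \<integral>x. f x \<bullet> (G k x - g x) \<partial>M) \<longlonglongrightarrow> 0"
  proof (rule tendsto_0_of_sq_le)
    show "(\<lambda>k. nsq M f * nsq M (\<lambda>x. G k x - g x)) \<longlonglongrightarrow> 0"
      using tendsto_mult_right_zero assms by (auto simp: L2lim_def)
  qed (rule L2_Cauchy_Schwarz[OF L(2) D(2)])
  have "(\<integral>x. F k x \<bullet> G k x \<partial>M) = (\<integral>x. (F k x - f x) \<bullet> (G k x - g x) \<partial>M) +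
      (\<integral>x. (F k x - f x) \<bullet> g x \<partial>M) + (\<integral>x. f x \<bullet> (G k x - g x) \<partial>M) + (\<integral>x. f x \<bullet> g x \<partial>M)" for k
  proof -
    have "(\<integral>x. F k x \<bullet> G k x \<partial>M) = (\<integral>x. (F k x - f x) \<bullet> (G k x - g x) +
      (F k x - f x) \<bullet> g x + f x \<bullet> (G k x - g x) + f x \<bullet> g x \<partial>M)"
      by (simp add: algebra_simps)
    also have "\<dots> = (\<integral>x. (F k x - f x) \<bullet> (G k x - g x) \<partial>M) +
      (\<integral>x. (F k x - f x) \<bullet> g x \<partial>M) + (\<integral>x. f x \<bullet> (G k x - g x) \<partial>M) + (\<integral>x. f x \<bullet> g x \<partial>M)"
      using L2_inner[OF D] L2_inner[OF D(1) L(4)] L2_inner[OF L(2) D(2)] L2_inner[OF L(2,4)]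
      by (subst Bochner_Integration.integral_add | simp)+
    finally show ?thesis .
  qed
  then show ?thesis using tendsto_add[OF tendsto_add[OF tendsto_add[OF z z1] z2] tendsto_const] by simp
qed

lemma L2lim_mult:
  fixes F G :: "nat \<Rightarrow> 'a \<Rightarrow> real"
  assumes "L2lim M F f" "L2lim M G g"
  shows "(\<lambda>k. \<integral>x. F k x * G k x \<partial>M) \<longlonglongrightarrow> (\<integral>x. f x * g x \<partial>M)"
  using L2lim_inner[OF assms] by simp

lemma L2lim_subseq: "L2lim M F f \<Longrightarrow> strict_mono r \<Longrightarrow> L2lim M (\<lambda>k. F (r k)) f"
  by (auto simp: L2lim_def dest: LIMSEQ_subseq_LIMSEQ[unfolded comp_def])

lemma L2lim_AE_subseq:
  assumes "L2lim M F f"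
  shows "\<exists>r::nat\<Rightarrow>nat. strict_mono r \<and> (AE x in M. (\<lambda>k. F (r k) x) \<longlonglongrightarrow> f x)"
proof -
  have "\<exists>r. strict_mono r \<and> (AE x in M. (\<lambda>k. (norm (F (r k) x - f x))\<^sup>2) \<longlonglongrightarrow> 0)"
  proof (rule tendsto_L1_AE_subseq)
    show "integrable M (\<lambda>x. (norm (F k x - f x))\<^sup>2)" for k
      using assms L2_diff by (metis L2_def L2lim_def)
    show "(\<lambda>k. LINT x|M. norm ((norm (F k x - f x))\<^sup>2)) \<longlonglongrightarrow> 0"
      using assms by (simp add: L2lim_def nsq_def)
  qed
  then obtain r where r: "strict_mono r" "AE x in M. (\<lambda>k. (norm (F (r k) x - f x))\<^sup>2) \<longlonglongrightarrow> 0" by blast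
  have "AE x in M. (\<lambda>k. F (r k) x) \<longlonglongrightarrow> f x"
    using r(2)
  proof eventually_elim
    case (elim x)
    then have "(\<lambda>k. norm (F (r k) x - f x)) \<longlonglongrightarrow> 0"
      by (rule tendsto_0_of_sq_le[rotated]) simp
    then show ?case using tendsto_norm_zero_iff LIM_zero_iff by blast
  qed
  with r(1) show ?thesis by blast
qed

lemma L2lim_dominated:
  fixes F :: "nat \<Rightarrow> 'a \<Rightarrow> 'b::euclidean_space"
  assumes "\<And>k. F k \<in> borel_measurable M" "f \<in> borel_measurable M" "integrable M g"
    and "AE x in M. (\<lambda>k. F k x) \<longlonglongrightarrow> f x" "\<And>k. AE x in M. (norm (F k x))\<^sup>2 \<le> g x"
  shows "L2lim M F f"
proof -
  have bd: "AE x in M. \<forall>k. (norm (F k x))\<^sup>2 \<le> g x" using assms(5) by (simp add: AE_all_countable)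
  have fb: "AE x in M. (norm (f x))\<^sup>2 \<le> g x"
    using bd assms(4)
  proof eventually_elim
    case (elim x)
    then have "(\<lambda>k. (norm (F k x))\<^sup>2) \<longlonglongrightarrow> (norm (f x))\<^sup>2" by (intro tendsto_intros)
    then show ?case using elim by (intro LIMSEQ_le_const2) auto
  qed
  \<comment> \<open>The limit obeys the same bound g, so the squared difference is at most 2 g + 2
    g.\<close>
  have "(\<lambda>k. \<integral>x. (norm (F k x - f x))\<^sup>2 \<partial>M) \<longlonglongrightarrow> (\<integral>x. 0 \<partial>M)"
  proof (rule integral_dominated_convergence[where w = "\<lambda>x. 4 * g x"])
    show "AE x in M. (\<lambda>k. (norm (F k x - f x))\<^sup>2) \<longlonglongrightarrow> 0"
      using assms(4)
    proof eventually_elim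
      case (elim x)
      then have "(\<lambda>k. (norm (F k x - f x))\<^sup>2) \<longlonglongrightarrow> (norm (f x - f x))\<^sup>2" by (intro tendsto_intros)
      then show ?case by simp
    qed
    show "AE x in M. norm ((norm (F k x - f x))\<^sup>2) \<le> 4 * g x" for k
      using assms(5)[of k] fb
    proof eventually_elim
      case (elim x)
      then show ?case using norm_diff_sq_le[of "F k x" "f x"] by simp
    qed
  qed (use assms(1-3) in auto)
  then show ?thesis
    using L2_dominated[OF assms(1,3,5)] L2_dominated[OF assms(2,3) fb] by (simp add: L2lim_def nsq_def)
qed

section \<open>Completeness, projection and closure in L^2\<close>

lemma nsq_fatou:
  fixes F :: "nat \<Rightarrow> 'a \<Rightarrow> 'b::euclidean_space"
  assumes "\<And>k. L2 M (F k)" "f \<in> borel_measurable M" "AE x in M. (\<lambda>k. F k x) \<longlonglongrightarrow> f x"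
    and "\<And>k. nsq M (F k) \<le> C"
  shows "L2 M f \<and> nsq M f \<le> C"
proof -
  have C: "0 \<le> C" using assms(4)[of 0] nsq_nonneg[of M "F 0"] by linarith
  have "(\<integral>\<^sup>+x. ennreal ((norm (f x))\<^sup>2) \<partial>M) = (\<integral>\<^sup>+x. liminf (\<lambda>k. ennreal ((norm (F k x))\<^sup>2)) \<partial>M)"
  proof (rule nn_integral_cong_AE)
    show "AE x in M. ennreal ((norm (f x))\<^sup>2) = liminf (\<lambda>k. ennreal ((norm (F k x))\<^sup>2))"
      using assms(3)
    proof eventually_elim
      case (elim x)
      then have "(\<lambda>k. ennreal ((norm (F k x))\<^sup>2)) \<longlonglongrightarrow> ennreal ((norm (f x))\<^sup>2)" by (intro tendsto_intros) auto
      then show ?case by (rule lim_imp_Liminf[OF trivial_limit_sequentially, symmetric])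
    qed
  qed
  also have "\<dots> \<le> liminf (\<lambda>k. \<integral>\<^sup>+x. ennreal ((norm (F k x))\<^sup>2) \<partial>M)"
    using assms(1) by (intro nn_integral_liminf) (auto simp: L2_def)
  also have "(\<lambda>k. \<integral>\<^sup>+x. ennreal ((norm (F k x))\<^sup>2) \<partial>M) = (\<lambda>k. ennreal (nsq M (F k)))"
    using assms(1) by (intro ext) (auto simp: nsq_def L2_def nn_integral_eq_integral)
  also have "liminf (\<lambda>k. ennreal (nsq M (F k))) \<le> ennreal C"
    using assms(4) by (intro Liminf_le) (auto intro!: always_eventually ennreal_leI)
  finally have le: "(\<integral>\<^sup>+x. ennreal ((norm (f x))\<^sup>2) \<partial>M) \<le> ennreal C" .
  then have i: "integrable M (\<lambda>x. (norm (f x))\<^sup>2)"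
    using assms(2) by (intro integrableI_bounded) (auto intro: le_less_trans)
  then have "ennreal (nsq M f) \<le> ennreal C" using le by (simp add: nsq_def nn_integral_eq_integral)
  then show ?thesis using i assms(2) C by (simp add: L2_def)
qed

lemma ennreal_finite_cases: "y \<noteq> (\<infinity>::ennreal) \<Longrightarrow> \<exists>c\<ge>0. y = ennreal c"
  by (cases y) auto

text \<open>The Riesz-Fischer argument: along a subsequence the squared gaps have integrals below
  4^(-j), so that their sum with the weights 2^j is still finite almost everywhere. The weights give
  the gaps geometric decay and hence pointwise convergence; Fatou's lemma then estimates the
  distance to the limit.\<close>

lemma L2_complete:
  fixes F :: "nat \<Rightarrow> 'a \<Rightarrow> 'b::euclidean_space"
  assumes L: "\<And>k. L2 M (F k)"
    and Cauchy: "\<And>\<epsilon>. \<epsilon> > 0 \<Longrightarrow> \<exists>N. \<forall>k\<ge>N. \<forall>l\<ge>N. nsq M (\<lambda>x. F k x - F l x) < \<epsilon>"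
  shows "\<exists>f. L2lim M F f"
proof -
  note [measurable] = L2_measurable[OF L]
  obtain N where N: "\<And>j k l. k \<ge> N j \<Longrightarrow> l \<ge> N j \<Longrightarrow> nsq M (\<lambda>x. F k x - F l x) < (1/4) ^ j"
    using Cauchy[of "(1/4) ^ _"] by (metis zero_less_power zero_less_divide_1_iff zero_less_numeral)
  \<comment> \<open>Summing the thresholds gives R j \<ge> N i for all i \<le> j, so that
    consecutive indices R j and R (j + 1) both lie beyond N j.\<close>
  define R where "R j = (\<Sum>i\<le>j. N i) + j" for j
  have RN: "R j \<ge> N i" if "i \<le> j" for i j
    using member_le_sum[of i "{..j}" N] that by (simp add: R_def)
  define d where "d j x = norm (F (R (Suc j)) x - F (R j) x)" for j x
  have dint: "(\<integral>\<^sup>+x. ennreal (2 ^ j * (d j x)\<^sup>2) \<partial>M) \<le> ennreal ((1/2) ^ j)" for j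
  proof -
    have "integrable M (\<lambda>x. (d j x)\<^sup>2)" unfolding d_def using L2_integrable[OF L2_diff[OF L L]] by simp
    then have "(\<integral>\<^sup>+x. ennreal (2 ^ j * (d j x)\<^sup>2) \<partial>M) = ennreal (2 ^ j * nsq M (\<lambda>x. F (R (Suc j)) x - F (R j) x))"
      by (subst nn_integral_eq_integral) (auto simp: nsq_def d_def)
    also have "\<dots> \<le> ennreal (2 ^ j * (1/4) ^ j)"
      using N[of j "R (Suc j)" "R j"] RN by (intro ennreal_leI mult_left_mono less_imp_le) auto
    finally show ?thesis by (simp add: power_mult_distrib[symmetric])
  qed
  have "(\<integral>\<^sup>+x. (\<Sum>j. ennreal (2 ^ j * (d j x)\<^sup>2)) \<partial>M) = (\<Sum>j. \<integral>\<^sup>+x. ennreal (2 ^ j * (d j x)\<^sup>2) \<partial>M)"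
    by (intro nn_integral_suminf) (auto simp: d_def)
  also have "\<dots> \<le> (\<Sum>j. ennreal ((1/2) ^ j))"
    by (intro suminf_le dint) auto
  also have "\<dots> = ennreal (\<Sum>j. (1/2) ^ j)"
    by (intro suminf_ennreal_eq summable_sums summable_geometric) auto
  also have "\<dots> < \<infinity>" by simp
  finally have "AE x in M. (\<Sum>j. ennreal (2 ^ j * (d j x)\<^sup>2)) \<noteq> \<infinity>"
    by (intro nn_integral_noteq_infinite) (auto simp: d_def)
  then have "AE x in M. convergent (\<lambda>j. F (R j) x)"
  proof eventually_elim
    case (elim x)
    then obtain c where c: "(\<Sum>j. ennreal (2 ^ j * (d j x)\<^sup>2)) = ennreal c" "c \<ge> 0"
      using ennreal_finite_cases by blast
    have b: "2 ^ j * (d j x)\<^sup>2 \<le> c" for j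
    proof -
      have "(\<Sum>j\<in>{j}. ennreal (2 ^ j * (d j x)\<^sup>2)) \<le> (\<Sum>j. ennreal (2 ^ j * (d j x)\<^sup>2))"
        by (rule sum_le_suminf) auto
      then show ?thesis using c by simp
    qed
    have le: "norm (F (R (Suc j)) x - F (R j) x) \<le> sqrt c * (sqrt (1/2)) ^ j" for j
    proof -
      have "(d j x)\<^sup>2 \<le> c * (1/2) ^ j" using b[of j] by (simp add: power_one_over field_simps)
      then have "d j x \<le> sqrt (c * (1/2) ^ j)" by (rule real_le_rsqrt)
      then show ?thesis by (simp only: d_def real_sqrt_mult real_sqrt_power)
    qed
    have "summable (\<lambda>j. sqrt c * (sqrt (1/2)) ^ j)"
      by (intro summable_mult summable_geometric) simp
    then have "summable (\<lambda>j. F (R (Suc j)) x - F (R j) x)"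
      by (rule summable_comparison_test') (rule le)
    then have "convergent (\<lambda>n. F (R n) x - F (R 0) x)"
      by (simp only: summable_iff_convergent sum_lessThan_telescope[of "\<lambda>n. F (R n) x"])
    then have "convergent (\<lambda>n. (F (R n) x - F (R 0) x) + F (R 0) x)"
      by (intro convergent_add convergent_const)
    then show ?case by simp
  qed
  then have ae: "AE x in M. (\<lambda>j. F (R j) x) \<longlonglongrightarrow> lim (\<lambda>j. F (R j) x)"
    by eventually_elim (simp add: convergent_LIMSEQ_iff)
  define f where "f x = lim (\<lambda>j. F (R j) x)" for x
  have fm[measurable]: "f \<in> borel_measurable M"
    unfolding f_def by (intro borel_measurable_lim_metric) measurable
  have key: "L2 M (\<lambda>x. F k x - f x) \<and> nsq M (\<lambda>x. F k x - f x) \<le> (1/4) ^ j" if k: "k \<ge> N j" for k j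
  proof (rule nsq_fatou)
    show "L2 M (\<lambda>x. F k x - F (R (i + j)) x)" for i by (intro L2_diff L)
    show "(\<lambda>x. F k x - f x) \<in> borel_measurable M" by measurable
    show "AE x in M. (\<lambda>i. F k x - F (R (i + j)) x) \<longlonglongrightarrow> F k x - f x"
      using ae unfolding f_def by eventually_elim (intro tendsto_intros LIMSEQ_ignore_initial_segment)
    show "nsq M (\<lambda>x. F k x - F (R (i + j)) x) \<le> (1/4) ^ j" for i
      using N[OF k, of "R (i + j)"] RN[of j "i + j"] by simp
  qed
  have "L2 M f"
    using L2_diff[OF L[of "N 0"] key[of 0 "N 0", THEN conjunct1]] by simp
  moreover have "(\<lambda>k. nsq M (\<lambda>x. F k x - f x)) \<longlonglongrightarrow> 0"
  proof (rule LIMSEQ_I)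
    fix e :: real assume "e > 0"
    then obtain j where j: "(1/4) ^ j < e" using real_arch_pow_inv[of e "1/4"] by auto
    show "\<exists>no. \<forall>n\<ge>no. norm (nsq M (\<lambda>x. F n x - f x) - 0) < e"
      using key[of j] j by (intro exI[of _ "N j"]) (auto intro: le_less_trans)
  qed
  ultimately show ?thesis using L unfolding L2lim_def by blast
qed

text \<open>A minimising sequence for the distance from h to S is Cauchy by the parallelogram law,
  because its midpoints stay in S. The projection w is a limit of elements of S and may lie outside
  S; the sequence is part of the conclusion because it supplies the approximating test functions in
  \<open>linear_solvable\<close>.\<close>

lemma L2_projection:
  fixes h :: "'a \<Rightarrow> 'b::euclidean_space"
  assumes S: "\<And>s. s \<in> S \<Longrightarrow> L2 M s" and h: "L2 M h" and ne: "S \<noteq> {}"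
    and comb: "\<And>s t c. s \<in> S \<Longrightarrow> t \<in> S \<Longrightarrow> (\<lambda>x. s x + c *\<^sub>R t x) \<in> S"
    and avg: "\<And>s t. s \<in> S \<Longrightarrow> t \<in> S \<Longrightarrow> (\<lambda>x. (1/2) *\<^sub>R (s x + t x)) \<in> S"
  shows "\<exists>F w. (\<forall>k. F k \<in> S) \<and> L2lim M F w \<and> (\<forall>s\<in>S. (\<integral>x. (w x - h x) \<bullet> s x \<partial>M) = 0)"
proof -
  define J where "J s = nsq M (\<lambda>x. s x - h x)" for s
  define d where "d = Inf (J ` S)"
  have dle: "d \<le> J s" if "s \<in> S" for s
    unfolding d_def J_def by (rule cInf_lower) (use that in \<open>auto intro!: bdd_belowI[of _ 0]\<close>)
  have "\<exists>s\<in>S. J s < d + 1 / real (Suc k)" for k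
  proof -
    have "Inf (J ` S) < d + 1 / real (Suc k)" unfolding d_def by simp
    from cInf_lessD[OF _ this] show ?thesis using ne by auto
  qed
  then obtain F where F: "\<And>k. F k \<in> S" "\<And>k. J (F k) < d + 1 / real (Suc k)" by metis
  note LF = S[OF F(1)]
  have par: "nsq M (\<lambda>x. F k x - F l x) \<le> 2 / real (Suc k) + 2 / real (Suc l)" for k l
  proof -
    let ?m = "\<lambda>x. (1/2) *\<^sub>R (F k x + F l x)"
    have m: "?m \<in> S" by (rule avg[OF F(1) F(1)])
    have eq: "(norm (F k x - F l x))\<^sup>2 = 2 * (norm (F k x - h x))\<^sup>2 + 2 * (norm (F l x - h x))\<^sup>2
       - 4 * (norm (?m x - h x))\<^sup>2" for x
      unfolding power2_norm_eq_inner by (simp add: algebra_simps inner_commute)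
    have "nsq M (\<lambda>x. F k x - F l x) = 2 * J (F k) + 2 * J (F l) - 4 * J ?m"
      unfolding nsq_def J_def eq
      using L2_integrable[OF L2_diff[OF LF h]] L2_integrable[OF L2_diff[OF S[OF m] h]]
      by (subst Bochner_Integration.integral_diff Bochner_Integration.integral_add | simp)+
    then show ?thesis using F(2)[of k] F(2)[of l] dle[OF m] by simp
  qed
  have "\<exists>f. L2lim M F f"
  proof (rule L2_complete[OF LF])
    fix e :: real assume "e > 0"
    then obtain N where N: "1 / real (Suc N) < e / 4"
      using nat_approx_posE[of "e/4"] by auto
    have "nsq M (\<lambda>x. F k x - F l x) < e" if "k \<ge> N" "l \<ge> N" for k l
    proof -
      have "1 / real (Suc k) \<le> 1 / real (Suc N)" "1 / real (Suc l) \<le> 1 / real (Suc N)"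
        using that by (auto intro!: divide_left_mono)
      then show ?thesis using par[of k l] N by linarith
    qed
    then show "\<exists>N. \<forall>k\<ge>N. \<forall>l\<ge>N. nsq M (\<lambda>x. F k x - F l x) < e" by blast
  qed
  then obtain w where w: "L2lim M F w" by blast
  have "(\<integral>x. (w x - h x) \<bullet> s x \<partial>M) = 0" if s: "s \<in> S" for s
  proof -
    have wh: "L2lim M (\<lambda>k x. F k x - h x) (\<lambda>x. w x - h x)"
      using w L2_diff[OF _ h] by (auto simp: L2lim_def)
    have "(\<lambda>k. \<integral>x. (F k x - h x) \<bullet> s x \<partial>M) \<longlonglongrightarrow> (\<integral>x. (w x - h x) \<bullet> s x \<partial>M)"
      by (rule L2lim_inner[OF wh L2lim_const[OF S[OF s]]])
    moreover have "(\<lambda>k. \<integral>x. (F k x - h x) \<bullet> s x \<partial>M) \<longlonglongrightarrow> 0"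
    proof (rule tendsto_0_of_sq_le)
      fix k
      show "(\<integral>x. (F k x - h x) \<bullet> s x \<partial>M)\<^sup>2 \<le> 1 / real (Suc k) * nsq M s"
      proof (rule discriminant_bound)
        fix t :: real
        \<comment> \<open>F k misses the infimum by less than 1 / (k + 1), so moving it along s
          cannot lower the functional by more than that; this is the nonnegative quadratic in
          t.\<close>
        have "d \<le> J (\<lambda>x. F k x + t *\<^sub>R s x)" by (rule dle[OF comb[OF F(1) s]])
        also have "\<dots> = nsq M (\<lambda>x. (F k x - h x) + t *\<^sub>R s x)"
          unfolding J_def by (simp add: algebra_simps)
        also have "\<dots> = J (F k) + 2 * t * (\<integral>x. (F k x - h x) \<bullet> s x \<partial>M) + t\<^sup>2 * nsq M s"
          unfolding J_def by (rule nsq_add_scaleR[OF L2_diff[OF LF h] S[OF s]])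
        finally show "0 \<le> 1 / real (Suc k) + 2 * t * (\<integral>x. (F k x - h x) \<bullet> s x \<partial>M) + t\<^sup>2 * nsq M s"
          using F(2)[of k] by linarith
      qed simp
      show "(\<lambda>k. 1 / real (Suc k) * nsq M s) \<longlonglongrightarrow> 0"
        using tendsto_mult_left_zero[OF LIMSEQ_inverse_real_of_nat] by (simp add: inverse_eq_divide)
    qed
    ultimately show ?thesis by (rule LIMSEQ_unique)
  qed
  with w F(1) show ?thesis by blast
qed

text \<open>Stated with \<epsilon>-approximations instead of sequences, so that closedness follows
  from the triangle inequality without a diagonal sequence.\<close>

definition L2cl :: "'a measure \<Rightarrow> ('a \<Rightarrow> 'b::euclidean_space) set \<Rightarrow> ('a \<Rightarrow> 'b) set" where
  "L2cl M S = {f. L2 M f \<and> (\<forall>\<epsilon>>0. \<exists>s\<in>S. nsq M (\<lambda>x. s x - f x) < \<epsilon>)}"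

lemma L2cl_L2lim:
  assumes "\<And>s. s \<in> S \<Longrightarrow> L2 M s"
  shows "f \<in> L2cl M S \<longleftrightarrow> (\<exists>F. (\<forall>k. F k \<in> S) \<and> L2lim M F f)"
proof
  assume f: "f \<in> L2cl M S"
  then have "\<exists>s\<in>S. nsq M (\<lambda>x. s x - f x) < 1 / real (Suc k)" for k by (simp add: L2cl_def)
  then obtain F where F: "\<And>k. F k \<in> S" "\<And>k. nsq M (\<lambda>x. F k x - f x) < 1 / real (Suc k)" by metis
  have "(\<lambda>k. nsq M (\<lambda>x. F k x - f x)) \<longlonglongrightarrow> 0"
    by (rule tendsto_sandwich[OF _ _ tendsto_const LIMSEQ_inverse_real_of_nat])
       (use F(2) in \<open>auto simp: inverse_eq_divide intro!: always_eventually less_imp_le\<close>)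
  then show "\<exists>F. (\<forall>k. F k \<in> S) \<and> L2lim M F f"
    using F(1) f assms unfolding L2lim_def L2cl_def by blast
next
  assume "\<exists>F. (\<forall>k. F k \<in> S) \<and> L2lim M F f"
  then obtain F where F: "\<And>k. F k \<in> S" "L2lim M F f" by blast
  have "\<exists>s\<in>S. nsq M (\<lambda>x. s x - f x) < e" if "e > 0" for e
  proof -
    have "\<forall>\<^sub>F k in sequentially. nsq M (\<lambda>x. F k x - f x) < e"
      using F(2) that by (intro order_tendstoD(2)[of _ 0]) (auto simp: L2lim_def)
    then show ?thesis using F(1) eventually_happens' trivial_limit_sequentially by blast
  qed
  then show "f \<in> L2cl M S" using F(2) by (simp add: L2cl_def L2lim_def)
qed

lemma L2cl_closed:
  assumes "\<And>s. s \<in> S \<Longrightarrow> L2 M s" "\<And>k. F k \<in> L2cl M S" "L2lim M F f"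
  shows "f \<in> L2cl M S"
  unfolding L2cl_def
proof (intro CollectI conjI allI impI)
  show f: "L2 M f" using assms(3) by (simp add: L2lim_def)
  fix e :: real assume e: "e > 0"
  have "\<forall>\<^sub>F k in sequentially. nsq M (\<lambda>x. F k x - f x) < e / 4"
    using assms(3) e by (intro order_tendstoD(2)[of _ 0]) (auto simp: L2lim_def)
  then obtain k where k: "nsq M (\<lambda>x. F k x - f x) < e / 4"
    using eventually_happens' trivial_limit_sequentially by blast
  have Fk: "L2 M (F k)" "\<forall>\<epsilon>>0. \<exists>s\<in>S. nsq M (\<lambda>x. s x - F k x) < \<epsilon>"
    using assms(2)[of k] by (auto simp: L2cl_def)
  then obtain s where s: "s \<in> S" "nsq M (\<lambda>x. s x - F k x) < e / 4" using e by (meson divide_pos_pos zero_less_numeral)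
  have "nsq M (\<lambda>x. s x - f x) < e"
    using nsq_triangle[OF assms(1)[OF s(1)] Fk(1) f] s(2) k by linarith
  with s(1) show "\<exists>s\<in>S. nsq M (\<lambda>x. s x - f x) < e" by blast
qed

lemma L2cl_comb:
  assumes "\<And>s. s \<in> S \<Longrightarrow> L2 M s" "f \<in> L2cl M S" "g \<in> L2cl M S"
    and comb: "\<And>s t. s \<in> S \<Longrightarrow> t \<in> S \<Longrightarrow> (\<lambda>x. s x + c *\<^sub>R t x) \<in> S"
  shows "(\<lambda>x. f x + c *\<^sub>R g x) \<in> L2cl M S"
proof -
  obtain F where F: "\<And>k. F k \<in> S" "L2lim M F f" using assms(2) L2cl_L2lim[of S M f] assms(1) by blast
  obtain G where G: "\<And>k. G k \<in> S" "L2lim M G g" using assms(3) L2cl_L2lim[of S M g] assms(1) by blast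
  have L: "L2 M f" "L2 M g" "L2 M (F k)" "L2 M (G k)" for k using F(2) G(2) by (auto simp: L2lim_def)
  have le: "nsq M (\<lambda>x. (F k x + c *\<^sub>R G k x) - (f x + c *\<^sub>R g x))
      \<le> 2 * nsq M (\<lambda>x. F k x - f x) + 2 * (c\<^sup>2 * nsq M (\<lambda>x. G k x - g x))" for k
  proof -
    have "(\<lambda>x. (F k x + c *\<^sub>R G k x) - (f x + c *\<^sub>R g x)) = (\<lambda>x. (F k x - f x) + c *\<^sub>R (G k x - g x))"
      by (simp add: algebra_simps)
    then show ?thesis
      using nsq_add_le[OF L2_diff[OF L(3)[of k] L(1)] L2_scaleR[OF L2_diff[OF L(4)[of k] L(2)], of c]]
      by (simp only: nsq_scaleR)
  qed
  let ?b = "\<lambda>k. 2 * nsq M (\<lambda>x. F k x - f x) + 2 * (c\<^sup>2 * nsq M (\<lambda>x. G k x - g x))"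
  have "?b \<longlonglongrightarrow> 2 * 0 + 2 * (c\<^sup>2 * 0)"
    using F(2) G(2) by (intro tendsto_intros) (auto simp: L2lim_def)
  then have b0: "?b \<longlonglongrightarrow> 0" by (simp only: mult_zero_right add_0_left)
  have "(\<lambda>k. nsq M (\<lambda>x. (F k x + c *\<^sub>R G k x) - (f x + c *\<^sub>R g x))) \<longlonglongrightarrow> 0"
    by (rule nsq_tendsto_0[OF le b0])
  then have lim: "L2lim M (\<lambda>k x. F k x + c *\<^sub>R G k x) (\<lambda>x. f x + c *\<^sub>R g x)"
    using L by (simp add: L2lim_def L2_add L2_scaleR)
  have "\<forall>k. (\<lambda>x. F k x + c *\<^sub>R G k x) \<in> S"
    by (intro allI comb F(1) G(1))
  then have "\<exists>H. (\<forall>k. H k \<in> S) \<and> L2lim M H (\<lambda>x. f x + c *\<^sub>R g x)"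
    using lim by (intro exI[of _ "\<lambda>k x. F k x + c *\<^sub>R G k x"]) (rule conjI)
  then show ?thesis using L2cl_L2lim[of S M, OF assms(1)] by blast
qed

section \<open>Integration by parts\<close>

lemma fderiv_eq_0_outside:
  fixes f :: "'a::real_normed_vector \<Rightarrow> 'b::real_normed_vector"
  assumes "closed K" "\<And>x. x \<notin> K \<Longrightarrow> f x = 0" "x \<notin> K"
  shows "fderiv f x = (\<lambda>v. 0)"
proof (rule fderiv_eqI)
  show "(f has_derivative (\<lambda>v. 0)) (at x)"
    by (rule has_derivative_transform_within_open[where f = "\<lambda>x. 0" and s = "- K"])
       (use assms in auto)
qed

lemma integrable_continuous_compact_support:
  fixes f :: "'a::euclidean_space \<Rightarrow> 'b::euclidean_space"
  assumes "continuous_on UNIV f" "compact K" "\<And>x. x \<notin> K \<Longrightarrow> f x = 0"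
  shows "integrable lborel f"
proof -
  have "(\<lambda>x. indicator K x *\<^sub>R f x) = f" using assms(3) by (auto simp: indicator_def)
  then show ?thesis
    using borel_integrable_compact[OF assms(2) continuous_on_subset[OF assms(1) subset_UNIV]] by simp
qed

lemma integral_translation:
  fixes f :: "'a::euclidean_space \<Rightarrow> real"
  assumes "integrable lborel f" "f \<in> borel_measurable borel"
  shows "integrable lborel (\<lambda>x. f (c + x))" "(\<integral>x. f (c + x) \<partial>lborel) = (\<integral>x. f x \<partial>lborel)"
proof -
  have m: "((+) c) \<in> measurable lborel borel" by simp
  show "integrable lborel (\<lambda>x. f (c + x))"
    using integrable_distr_eq[OF m assms(2)] assms(1) by (simp add: lborel_distr_plus)
  show "(\<integral>x. f (c + x) \<partial>lborel) = (\<integral>x. f x \<partial>lborel)"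
    using integral_distr[OF m assms(2)] by (simp add: lborel_distr_plus)
qed

text \<open>By translation invariance of Lebesgue measure every difference quotient has integral 0.
  The quotients are bounded by the mean value theorem and vanish outside a fixed ball, so dominated
  convergence carries this over to the derivative.\<close>

lemma integral_partial_derivative_eq_0:
  fixes F :: "'a::euclidean_space \<Rightarrow> real"
  assumes diff: "\<And>x. F differentiable (at x)" and cont: "continuous_on UNIV (\<lambda>x. fderiv F x b)"
    and K: "compact K" "\<And>x. x \<notin> K \<Longrightarrow> F x = 0"
  shows "(\<integral>x. fderiv F x b \<partial>lborel) = 0"
proof -
  have cF: "continuous_on UNIV F"
    using diff by (intro differentiable_imp_continuous_on) (simp add: differentiable_on_def)
  then have mF: "F \<in> borel_measurable borel" by (rule borel_measurable_continuous_onI)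
  have iF: "integrable lborel F" by (rule integrable_continuous_compact_support[OF cF K])
  have z: "fderiv F x b = 0" if "x \<notin> K" for x
    using fderiv_eq_0_outside[OF compact_imp_closed[OF K(1)] K(2) that] by simp
  obtain B where B: "\<And>x. \<bar>fderiv F x b\<bar> \<le> B"
    using bounded_continuous_compact_support[OF cont K(1) z] by auto
  obtain R where R: "\<And>x. x \<in> K \<Longrightarrow> norm x \<le> R"
    using compact_imp_bounded[OF K(1)] bounded_iff by blast
  define h where "h n = inverse (real (Suc n))" for n
  have h: "0 < h n" "h n \<le> 1" for n by (auto simp: h_def field_simps)
  define q where "q n x = inverse (h n) * (F (h n *\<^sub>R b + x) - F x)" for n x
  have dF: "((\<lambda>t. F (t *\<^sub>R b + x)) has_real_derivative fderiv F (t *\<^sub>R b + x) b) (at t)" for t x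
  proof -
    have "((\<lambda>t. t *\<^sub>R b + x) has_derivative (\<lambda>s. s *\<^sub>R b)) (at t)"
      by (auto intro!: derivative_eq_intros)
    from has_derivative_compose[OF this frechet_derivative_works[THEN iffD1, OF diff]]
    have "((\<lambda>t. F (t *\<^sub>R b + x)) has_derivative (\<lambda>s. fderiv F (t *\<^sub>R b + x) (s *\<^sub>R b))) (at t)" .
    moreover have "(\<lambda>s. fderiv F (t *\<^sub>R b + x) (s *\<^sub>R b)) = (*) (fderiv F (t *\<^sub>R b + x) b)"
      using linear_scale[OF linear_frechet_derivative[OF diff]] by (intro ext) simp
    ultimately show ?thesis unfolding has_field_derivative_def by simp
  qed
  have qB: "\<bar>q n x\<bar> \<le> B" for n x
  proof -
    have "\<exists>z. 0 < z \<and> z < h n \<and> F (h n *\<^sub>R b + x) - F (0 *\<^sub>R b + x) = (h n - 0) * fderiv F (z *\<^sub>R b + x) b"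
      by (rule MVT2[OF h(1)]) (rule dF)
    then obtain z where "F (h n *\<^sub>R b + x) - F x = h n * fderiv F (z *\<^sub>R b + x) b" by auto
    then have "q n x = fderiv F (z *\<^sub>R b + x) b" using h(1)[of n] by (simp add: q_def)
    then show ?thesis using B by simp
  qed
  have q0: "q n x = 0" if "x \<notin> cball 0 (R + norm b)" for n x
  proof -
    have x: "norm x > R + norm b" using that by simp
    then have "x \<notin> K" using R[of x] norm_ge_zero[of b] by linarith
    moreover have "h n *\<^sub>R b + x \<notin> K"
    proof
      assume "h n *\<^sub>R b + x \<in> K"
      then have "norm (h n *\<^sub>R b + x) \<le> R" by (rule R)
      moreover have "norm x \<le> norm (h n *\<^sub>R b + x) + norm (h n *\<^sub>R b)"
        using norm_triangle_ineq4[of "h n *\<^sub>R b + x" "h n *\<^sub>R b"] by simp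
      moreover have "norm (h n *\<^sub>R b) \<le> norm b"
        using h[of n] mult_right_mono[of "h n" 1 "norm b"] by simp
      ultimately show False using x by simp
    qed
    ultimately show ?thesis using K(2) by (simp add: q_def)
  qed
  have "(\<lambda>n. \<integral>x. q n x \<partial>lborel) \<longlonglongrightarrow> (\<integral>x. fderiv F x b \<partial>lborel)"
  proof (rule integral_dominated_convergence[where w = "\<lambda>x. B * indicator (cball 0 (R + norm b)) x"])
    show "(\<lambda>x. fderiv F x b) \<in> borel_measurable lborel"
      using borel_measurable_continuous_onI[OF cont] by simp
    show "q n \<in> borel_measurable lborel" for n
      unfolding q_def using mF by measurable
    show "integrable lborel (\<lambda>x. B * indicator (cball 0 (R + norm b)) x)"
      by (intro integrable_mult_right integrable_real_indicator emeasure_bounded_finite bounded_cball) simp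
    show "AE x in lborel. norm (q n x) \<le> B * indicator (cball 0 (R + norm b)) x" for n
      using qB[of n] q0[of _ n] by (intro AE_I2) (auto simp: indicator_def simp del: mem_cball mem_cball_0)
    show "AE x in lborel. (\<lambda>n. q n x) \<longlonglongrightarrow> fderiv F x b"
    proof (intro AE_I2)
      fix x
      have "((\<lambda>k. (F ((0 + k) *\<^sub>R b + x) - F (0 *\<^sub>R b + x)) / k) \<longlongrightarrow> fderiv F (0 *\<^sub>R b + x) b) (at 0)"
        using dF[of x 0] unfolding DERIV_def .
      moreover have "filterlim h (at 0) sequentially"
        unfolding filterlim_at using h LIMSEQ_inverse_real_of_nat by (auto simp: h_def[abs_def] intro!: always_eventually)
      ultimately have "(\<lambda>n. (F ((0 + h n) *\<^sub>R b + x) - F (0 *\<^sub>R b + x)) / h n) \<longlonglongrightarrow> fderiv F (0 *\<^sub>R b + x) b"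
        by (rule filterlim_compose)
      then show "(\<lambda>n. q n x) \<longlonglongrightarrow> fderiv F x b"
        by (simp add: q_def divide_inverse mult.commute)
    qed
  qed
  moreover have "(\<integral>x. q n x \<partial>lborel) = 0" for n
    unfolding q_def using integral_translation[OF iF mF, of "h n *\<^sub>R b"] iF by simp
  ultimately show ?thesis by (simp only: LIMSEQ_const_iff)
qed

definition divergence :: "('a::euclidean_space \<Rightarrow> 'a) \<Rightarrow> 'a \<Rightarrow> real" where
  "divergence Y x = (\<Sum>b\<in>Basis. fderiv Y x b \<bullet> b)"

lemma fderiv_expand:
  fixes f :: "'a::euclidean_space \<Rightarrow> 'b::real_normed_vector"
  assumes "f differentiable (at x)"
  shows "fderiv f x v = (\<Sum>b\<in>Basis. (v \<bullet> b) *\<^sub>R fderiv f x b)"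
proof -
  note l = linear_frechet_derivative[OF assms]
  have "fderiv f x v = fderiv f x (\<Sum>b\<in>Basis. (v \<bullet> b) *\<^sub>R b)" by (simp add: euclidean_representation)
  also have "\<dots> = (\<Sum>b\<in>Basis. (v \<bullet> b) *\<^sub>R fderiv f x b)"
    by (simp only: linear_sum[OF l] linear_scale[OF l])
  finally show ?thesis .
qed

lemma continuous_on_fderiv:
  fixes f :: "'a::euclidean_space \<Rightarrow> 'b::real_normed_vector"
  assumes "Ck_on 1 f UNIV" "continuous_on UNIV Y"
  shows "continuous_on UNIV (\<lambda>x. fderiv f x (Y x))"
proof -
  have eq: "(\<lambda>x. fderiv f x (Y x)) = (\<lambda>x. \<Sum>b\<in>Basis. (Y x \<bullet> b) *\<^sub>R fderiv f x b)"
    by (intro ext fderiv_expand) (use assms(1) in simp)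
  have "continuous_on UNIV (\<lambda>x. \<Sum>b\<in>Basis. (Y x \<bullet> b) *\<^sub>R fderiv f x b)"
    using assms by (intro continuous_intros) auto
  then show ?thesis unfolding eq .
qed

lemma continuous_on_divergence:
  assumes "Ck_on 1 Y UNIV" shows "continuous_on UNIV (divergence Y)"
  unfolding divergence_def[abs_def] using assms by (intro continuous_intros) auto

text \<open>Sums over the coordinates b the vanishing integral of the b-derivative of \<zeta> (Y
  \<bullet> b). A general C^1 field with its divergence is allowed because Y will be
  \<open>X j\<close> times a test function, or the field that carries the barrier.\<close>

lemma integration_by_parts:
  fixes \<zeta> :: "'a::euclidean_space \<Rightarrow> real" and Y :: "'a \<Rightarrow> 'a"
  assumes \<zeta>: "Ck_on 1 \<zeta> UNIV" and Y: "Ck_on 1 Y UNIV"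
    and K: "compact K" "\<And>x. x \<notin> K \<Longrightarrow> \<zeta> x = 0"
  shows "(\<integral>x. fderiv \<zeta> x (Y x) \<partial>lborel) = - (\<integral>x. \<zeta> x * divergence Y x \<partial>lborel)"
proof -
  have d\<zeta>: "\<zeta> differentiable (at x)" and dY: "Y differentiable (at x)" for x using \<zeta> Y by auto
  have c: "continuous_on UNIV \<zeta>" "continuous_on UNIV Y"
    using Ck_on_Suc_imp[of 0] \<zeta> Y by auto
  have D: "((\<lambda>x. \<zeta> x * (Y x \<bullet> b)) has_derivative
     (\<lambda>v. \<zeta> x * (fderiv Y x v \<bullet> b) + fderiv \<zeta> x v * (Y x \<bullet> b))) (at x)" for b x
    by (intro has_derivative_mult has_derivative_inner_left frechet_derivative_works[THEN iffD1] d\<zeta> dY)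
  note DF = fderiv_eqI[OF D]
  have c1: "continuous_on UNIV (\<lambda>x. \<zeta> x * (fderiv Y x b \<bullet> b))"
    and c2: "continuous_on UNIV (\<lambda>x. fderiv \<zeta> x b * (Y x \<bullet> b))" if "b \<in> Basis" for b
    using \<zeta> Y c that by (auto intro!: continuous_intros)
  have z: "fderiv \<zeta> x v = 0" if "x \<notin> K" for x v
    using fderiv_eq_0_outside[OF compact_imp_closed[OF K(1)] K(2) that] by simp
  have i1: "integrable lborel (\<lambda>x. \<zeta> x * (fderiv Y x b \<bullet> b))"
    and i2: "integrable lborel (\<lambda>x. fderiv \<zeta> x b * (Y x \<bullet> b))" if "b \<in> Basis" for b
    using K(2) z
    by (auto intro!: integrable_continuous_compact_support[OF c1[OF that] K(1)]
      integrable_continuous_compact_support[OF c2[OF that] K(1)])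
  have "(\<integral>x. \<zeta> x * (fderiv Y x b \<bullet> b) \<partial>lborel) = - (\<integral>x. fderiv \<zeta> x b * (Y x \<bullet> b) \<partial>lborel)"
    if b: "b \<in> Basis" for b
  proof -
    have "(\<integral>x. fderiv (\<lambda>x. \<zeta> x * (Y x \<bullet> b)) x b \<partial>lborel) = 0"
    proof (rule integral_partial_derivative_eq_0[OF _ _ K(1)])
      show "(\<lambda>x. \<zeta> x * (Y x \<bullet> b)) differentiable (at x)" for x by (rule differentiableI[OF D])
      show "continuous_on UNIV (\<lambda>x. fderiv (\<lambda>x. \<zeta> x * (Y x \<bullet> b)) x b)"
        unfolding DF using c1[OF b] c2[OF b] by (rule continuous_on_add)
    qed (use K(2) in simp)
    then show ?thesis unfolding DF using i1[OF b] i2[OF b] by simp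
  qed
  then have "(\<Sum>b\<in>Basis. \<integral>x. \<zeta> x * (fderiv Y x b \<bullet> b) \<partial>lborel) = - (\<Sum>b\<in>Basis. \<integral>x. fderiv \<zeta> x b * (Y x \<bullet> b) \<partial>lborel)"
    by (simp add: sum_negf)
  moreover have "(\<integral>x. \<zeta> x * divergence Y x \<partial>lborel) = (\<Sum>b\<in>Basis. \<integral>x. \<zeta> x * (fderiv Y x b \<bullet> b) \<partial>lborel)"
    unfolding divergence_def sum_distrib_left using i1 by (rule Bochner_Integration.integral_sum)
  moreover have "(\<integral>x. fderiv \<zeta> x (Y x) \<partial>lborel) = (\<Sum>b\<in>Basis. \<integral>x. fderiv \<zeta> x b * (Y x \<bullet> b) \<partial>lborel)"
  proof -
    have eq: "fderiv \<zeta> x (Y x) = (\<Sum>b\<in>Basis. fderiv \<zeta> x b * (Y x \<bullet> b))" for x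
      unfolding fderiv_expand[OF d\<zeta>, of x "Y x"] by (simp add: mult.commute)
    show ?thesis unfolding eq using i2 by (rule Bochner_Integration.integral_sum)
  qed
  ultimately show ?thesis by simp
qed

lemma integral_lebesgue_on_eq:
  fixes f :: "'a::euclidean_space \<Rightarrow> 'b::euclidean_space"
  assumes "D \<in> sets lebesgue" "f \<in> borel_measurable borel" "\<And>x. x \<notin> D \<Longrightarrow> f x = 0"
  shows "(\<integral>x. f x \<partial>lebesgue_on D) = (\<integral>x. f x \<partial>lborel)"
proof -
  have "(\<lambda>x. indicator D x *\<^sub>R f x) = f" using assms(3) by (auto simp: indicator_def)
  then show ?thesis
    using assms integral_restrict_space[of D lebesgue f] integral_completion[of f lborel] by simp
qed

section \<open>Functions orthogonal to the test functions\<close>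

lemma Ck_on_prod:
  fixes f :: "'i \<Rightarrow> 'a::euclidean_space \<Rightarrow> real"
  assumes "\<And>i. i \<in> I \<Longrightarrow> Ck_on k (f i) UNIV"
  shows "Ck_on k (\<lambda>x. \<Prod>i\<in>I. f i x) UNIV"
  using assms
proof (induction I rule: infinite_finite_induct)
  case (insert i I)
  then have "Ck_on k (f i) UNIV" "Ck_on k (\<lambda>x. \<Prod>i\<in>I. f i x) UNIV" by blast+
  from Ck_on_mult[OF this] insert.hyps show ?case by simp
qed (simp_all add: Ck_on_const)

definition bump :: "'a::euclidean_space \<Rightarrow> 'a \<Rightarrow> 'a \<Rightarrow> real" where
  "bump a b x = (\<Prod>i\<in>Basis. flat 1 ((x - a) \<bullet> i) * flat 1 ((b - x) \<bullet> i))"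

lemma Ck_on_bump: "Ck_on k (bump a b) UNIV"
proof -
  have "Ck_on k (\<lambda>x::'a. (-(a \<bullet> i)) + x \<bullet> i) UNIV" "Ck_on k (\<lambda>x::'a. (b \<bullet> i) + -1 * (x \<bullet> i)) UNIV" for i
    by (intro Ck_on_add Ck_on_const Ck_on_mult Ck_on_linear[OF Ck_on_ident bounded_linear_inner_left])+
  then have "Ck_on k (\<lambda>x. (x - a) \<bullet> i) UNIV" "Ck_on k (\<lambda>x. (b - x) \<bullet> i) UNIV" for i
    by (simp_all add: inner_diff_left)
  note this[THEN Ck_on_compose, OF Ck_on_flat]
  then show ?thesis unfolding bump_def[abs_def] by (intro Ck_on_prod Ck_on_mult)
qed

lemma bump_pos: "x \<in> box a b \<Longrightarrow> 0 < bump a b x"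
  by (auto simp: bump_def box_def inner_diff_left intro!: prod_pos mult_pos_pos flat_1_bounds(2))

lemma bump_eq_0: "x \<notin> box a b \<Longrightarrow> bump a b x = 0"
proof -
  assume "x \<notin> box a b"
  then obtain i where i: "i \<in> Basis" "(x - a) \<bullet> i \<le> 0 \<or> (b - x) \<bullet> i \<le> 0"
    by (auto simp: box_def inner_diff_left not_less)
  then have "flat 1 ((x - a) \<bullet> i) * flat 1 ((b - x) \<bullet> i) = 0"
    using flat_1_bounds(3) by auto
  then show ?thesis unfolding bump_def using i(1) by (intro prod_zero) auto
qed

lemma bump_nonneg: "0 \<le> bump a b x"
  using bump_pos[of x a b] bump_eq_0[of x a b] by (cases "x \<in> box a b") auto

lemma test_functionsI:
  assumes "\<And>k. Ck_on k f UNIV" "compact K" "K \<subseteq> D" "\<And>x. x \<notin> K \<Longrightarrow> f x = 0"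
  shows "f \<in> test_functions D"
proof -
  have "{x. f x \<noteq> 0} \<subseteq> K" using assms(4) by blast
  then have c: "closure {x. f x \<noteq> 0} \<subseteq> K" using closure_minimal compact_imp_closed[OF assms(2)] by blast
  then have "compact (closure {x. f x \<noteq> 0})" using compact_Int_closed[OF assms(2) closed_closure] by (metis inf.absorb2)
  with c assms show ?thesis by (auto simp: test_functions_def smooth_on_def)
qed

lemma test_functionsD:
  assumes "f \<in> test_functions D"
  shows "Ck_on k f UNIV" "\<exists>K. compact K \<and> K \<subseteq> D \<and> (\<forall>x. x \<notin> K \<longrightarrow> f x = 0)"
proof -
  show "Ck_on k f UNIV" using assms by (simp add: test_functions_def smooth_on_def)
  show "\<exists>K. compact K \<and> K \<subseteq> D \<and> (\<forall>x. x \<notin> K \<longrightarrow> f x = 0)"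
    using assms closure_subset[of "{x. f x \<noteq> 0}"]
    by (intro exI[of _ "closure {x. f x \<noteq> 0}"]) (auto simp: test_functions_def)
qed

text \<open>Truncations and smooth positive parts of a test function vanish wherever it does, so
  they inherit its compact support.\<close>

lemma test_functions_dominated:
  assumes "\<phi> \<in> test_functions D" "\<And>k. Ck_on k f UNIV" "\<And>x. \<phi> x = 0 \<Longrightarrow> f x = 0"
  shows "f \<in> test_functions D"
  using test_functionsD(2)[OF assms(1)] test_functionsI[of f _ D] assms(2,3) by blast

text \<open>The indicator of an open W is a bounded pointwise limit of test functions: W is a
  countable union of boxes, and k times the sum of the first k bumps tends to infinity on W and
  vanishes off W.\<close>

lemma integral_open_eq_0:
  fixes Z :: "'a::euclidean_space \<Rightarrow> real"
  assumes D: "open D" "bounded D" and Z: "integrable (lebesgue_on D) Z"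
    and orth: "\<And>\<psi>. \<psi> \<in> test_functions D \<Longrightarrow> (\<integral>x. Z x * \<psi> x \<partial>lebesgue_on D) = 0"
    and W: "open W" "W \<subseteq> D"
  shows "(\<integral>x. Z x * indicator W x \<partial>lebesgue_on D) = 0"
proof (cases "W = {}")
  case False
  let ?M = "lebesgue_on D"
  obtain \<D> where \<D>: "countable \<D>" "\<D> \<subseteq> Pow W" "\<And>S. S \<in> \<D> \<Longrightarrow> \<exists>a b. S = box a b" "\<Union>\<D> = W"
    using open_countable_Union_open_box[OF W(1)] by metis
  have "\<D> \<noteq> {}" using False \<D>(4) by blast
  define B where "B = from_nat_into \<D>"
  have rB: "range B = \<D>" unfolding B_def using \<open>\<D> \<noteq> {}\<close> \<D>(1) by (rule range_from_nat_into)
  then have "\<exists>a b. B n = box a b" for n using \<D>(3) by blast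
  then obtain a b where ab: "\<And>n. B n = box (a n) (b n)" by metis
  obtain \<sigma> :: "real \<Rightarrow> real" where \<sigma>: "\<And>k. Ck_on k \<sigma> UNIV" "\<And>t. t \<le> 0 \<Longrightarrow> \<sigma> t = 0" "\<And>t. t \<ge> 1 \<Longrightarrow> \<sigma> t = 1"
    using exists_smooth_step by blast
  obtain C where C: "\<forall>t\<in>{0..1}. norm (\<sigma> t) \<le> C"
    using continuous_bounded_on_compact[OF compact_Icc Ck_on_all_continuous[OF \<sigma>(1)]] by blast
  \<comment> \<open>Nothing is known about the values of \<sigma> between 0 and 1; since \<sigma> is
    constant on either side, its bound on [0, 1] is a global one.\<close>
  have \<sigma>C: "\<bar>\<sigma> t\<bar> \<le> C" for t
  proof -
    have "\<sigma> t = \<sigma> (max 0 (min 1 t))" using \<sigma>(2)[of t] \<sigma>(3)[of t] \<sigma>(2)[of 0] \<sigma>(3)[of 1] by (auto simp: max_def min_def)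
    moreover have "max 0 (min 1 t) \<in> {0..1}" by simp
    ultimately show ?thesis using C by (metis real_norm_def)
  qed
  define s where "s k x = (\<Sum>i<k. bump (a i) (b i) x)" for k x
  \<comment> \<open>The shift by -1 makes \<open>\<psi> k\<close> vanish outside the closed set
    where k s \<ge> 1, which lies inside W. Without it the support could reach the boundary of
    W.\<close>
  define \<psi> where "\<psi> k x = \<sigma> (-1 + real k * s k x)" for k x
  have Cks: "Ck_on n (\<lambda>x. -1 + real k * s k x) UNIV" for n k
    unfolding s_def by (intro Ck_on_add Ck_on_const Ck_on_mult Ck_on_sum Ck_on_bump)
  have Ck\<psi>: "Ck_on n (\<psi> k) UNIV" for n k
    unfolding \<psi>_def[abs_def] by (rule Ck_on_compose[OF Cks \<sigma>(1)])
  have s_notW: "s k x = 0" if "x \<notin> W" for k x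
    unfolding s_def using that rB ab \<D>(4) by (intro sum.neutral ballI bump_eq_0) blast
  have \<psi>_test: "\<psi> k \<in> test_functions D" for k
  proof (rule test_functionsI[OF Ck\<psi>])
    let ?K = "{x. 0 \<le> -1 + real k * s k x}"
    have sub: "?K \<subseteq> W" using s_notW by fastforce
    have "closed ?K" by (intro closed_Collect_le continuous_on_const Ck_on_all_continuous[OF Cks])
    moreover have "bounded ?K" using sub W(2) D(2) bounded_subset by blast
    ultimately show "compact ?K" by (simp add: compact_eq_bounded_closed)
    show "?K \<subseteq> D" using sub W(2) by blast
    show "\<psi> k x = 0" if "x \<notin> ?K" for x using that \<sigma>(2) by (simp add: \<psi>_def)
  qed
  have lim: "(\<lambda>k. \<psi> k x) \<longlonglongrightarrow> indicator W x" for x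
  proof (cases "x \<in> W")
    case True
    then obtain n where n: "x \<in> box (a n) (b n)" using rB ab \<D>(4) by blast
    define c where "c = bump (a n) (b n) x"
    have c: "c > 0" unfolding c_def using n by (rule bump_pos)
    obtain m where m: "2 / c < real m" using reals_Archimedean2 by blast
    have "\<psi> k x = 1" if k: "k \<ge> max (Suc n) m" for k
    proof -
      have "c \<le> s k x" unfolding s_def c_def using k by (intro member_le_sum bump_nonneg) auto
      moreover have "2 / c < real k" using m k by linarith
      then have "2 < real k * c" using c by (simp add: field_simps)
      ultimately have "1 \<le> -1 + real k * s k x" using mult_left_mono[of c "s k x" "real k"] by linarith
      then show ?thesis using \<sigma>(3) by (simp add: \<psi>_def)
    qed
    then show ?thesis using True
      by (intro tendsto_eventually eventually_sequentiallyI[of "max (Suc n) m"]) simp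
  next
    case False
    then show ?thesis using s_notW[OF False] \<sigma>(2) by (simp add: \<psi>_def)
  qed
  have "(\<lambda>k. \<integral>x. Z x * \<psi> k x \<partial>?M) \<longlonglongrightarrow> (\<integral>x. Z x * indicator W x \<partial>?M)"
  proof (rule integral_dominated_convergence[where w = "\<lambda>x. C * \<bar>Z x\<bar>"])
    have Zm[measurable]: "Z \<in> borel_measurable ?M" using Z by simp
    have "indicat_real W \<in> borel_measurable lebesgue"
      using W(1) by (intro borel_measurable_indicator) simp
    then have [measurable]: "indicat_real W \<in> borel_measurable ?M" by (rule measurable_restrict_space1)
    show "(\<lambda>x. Z x * indicator W x) \<in> borel_measurable ?M" by measurable
    have "\<psi> k \<in> borel_measurable ?M" for k
      by (intro measurable_restrict_space1 measurable_completion) (use borel_measurable_continuous_onI[OF Ck_on_all_continuous[OF Ck\<psi>]] in simp)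
    then show "(\<lambda>x. Z x * \<psi> k x) \<in> borel_measurable ?M" for k by measurable
    show "integrable ?M (\<lambda>x. C * \<bar>Z x\<bar>)" using Z by simp
    show "AE x in ?M. (\<lambda>k. Z x * \<psi> k x) \<longlonglongrightarrow> Z x * indicator W x"
      by (intro AE_I2 tendsto_mult tendsto_const lim)
    show "AE x in ?M. norm (Z x * \<psi> k x) \<le> C * \<bar>Z x\<bar>" for k
    proof (intro AE_I2)
      fix x
      have "\<bar>\<psi> k x\<bar> * \<bar>Z x\<bar> \<le> C * \<bar>Z x\<bar>"
        unfolding \<psi>_def by (intro mult_right_mono \<sigma>C abs_ge_zero)
      then show "norm (Z x * \<psi> k x) \<le> C * \<bar>Z x\<bar>" by (simp add: abs_mult mult.commute)
    qed
  qed
  then show ?thesis unfolding orth[OF \<psi>_test] by (simp only: LIMSEQ_const_iff)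
qed simp

text \<open>Orthogonality is available for indicators of open sets, while the positivity set A is
  merely measurable. So A is approximated from inside by a closed T: the integral of Z over T is the
  difference of those over the open sets D and D - T, hence 0, and Z > 0 on T makes T null.\<close>

lemma AE_nonpos_of_orthogonal:
  fixes Z :: "'a::euclidean_space \<Rightarrow> real"
  assumes D: "open D" "bounded D" and Z: "integrable (lebesgue_on D) Z"
    and orth: "\<And>\<psi>. \<psi> \<in> test_functions D \<Longrightarrow> (\<integral>x. Z x * \<psi> x \<partial>lebesgue_on D) = 0"
  shows "AE x in lebesgue_on D. Z x \<le> 0"
proof -
  let ?M = "lebesgue_on D"
  note z = integral_open_eq_0[OF D Z orth]
  have Dl: "D \<in> sets lebesgue" using D(1) by simp
  define A where "A = {x \<in> D. Z x > 0}"
  have "A = {x \<in> space ?M. Z x > 0}" by (simp add: A_def space_restrict_space)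
  also have "\<dots> \<in> sets ?M" using Z by measurable
  finally have A: "A \<in> sets lebesgue" using Dl by (simp add: sets_restrict_space_iff)
  have "emeasure lebesgue A \<le> 0 + ennreal e" if e: "e > 0" for e
  proof -
    obtain T where T: "closed T" "T \<subseteq> A" "A - T \<in> lmeasurable" "emeasure lebesgue (A - T) < ennreal e"
      using sets_lebesgue_inner_closed[OF A e] by blast
    have Tl: "T \<in> sets lebesgue" using T(1) by simp
    have "indicat_real S \<in> borel_measurable lebesgue" if "S \<in> sets lebesgue" for S using that by simp
    then have im: "indicat_real S \<in> borel_measurable ?M" if "S \<in> sets lebesgue" for S
      using that measurable_restrict_space1 by blast
    have int: "integrable ?M (\<lambda>x. Z x * indicator S x)" if "S \<in> sets lebesgue" for S
      by (rule Bochner_Integration.integrable_bound[OF Z])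
         (use borel_measurable_times[OF borel_measurable_integrable[OF Z] im[OF that]]
           in \<open>auto simp: indicator_def intro!: AE_I2\<close>)
    have "(\<integral>x. Z x * indicator T x \<partial>?M) =
      (\<integral>x. Z x * indicator D x - Z x * indicator (D - T) x \<partial>?M)"
      using T(2) by (intro Bochner_Integration.integral_cong) (auto simp: indicator_def A_def space_restrict_space)
    also have "\<dots> = 0"
      using z[of D] z[of "D - T"] D(1) T(1) int[OF Dl] int[of "D - T"] Dl Tl by (simp add: open_Diff)
    finally have "AE x in ?M. Z x * indicator T x = 0"
      using T(2) int[OF Tl]
      by (subst (asm) integral_nonneg_eq_0_iff_AE) (auto simp: indicator_def A_def intro!: AE_I2)
    then have "AE x in lebesgue. x \<in> D \<longrightarrow> Z x * indicator T x = 0"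
      using Dl by (subst (asm) AE_restrict_space_iff) auto
    then have "AE x in lebesgue. x \<notin> T"
      by eventually_elim (use T(2) in \<open>auto simp: A_def indicator_def\<close>)
    then have "T \<in> null_sets lebesgue" using Tl AE_iff_null_sets by blast
    then have "emeasure lebesgue T = 0" by auto
    moreover have "emeasure lebesgue A \<le> emeasure lebesgue T + emeasure lebesgue (A - T)"
    proof -
      have "emeasure lebesgue (T \<union> (A - T)) \<le> emeasure lebesgue T + emeasure lebesgue (A - T)"
        using Tl A by (intro emeasure_subadditive) auto
      moreover have "T \<union> (A - T) = A" using T(2) by blast
      ultimately show ?thesis by simp
    qed
    ultimately show ?thesis using T(4) by simp
  qed
  then have "emeasure lebesgue A \<le> 0" by (rule ennreal_le_epsilon)
  then have "A \<in> null_sets lebesgue" using A by (simp add: null_setsI)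
  then have "AE x in lebesgue. x \<notin> A" by (rule AE_not_in)
  then have "AE x in lebesgue. x \<in> D \<longrightarrow> Z x \<le> 0" by eventually_elim (auto simp: A_def)
  then show ?thesis using Dl by (subst AE_restrict_space_iff) auto
qed

lemma AE_eq_0_of_orthogonal:
  fixes Z :: "'a::euclidean_space \<Rightarrow> real"
  assumes D: "open D" "bounded D" and Z: "integrable (lebesgue_on D) Z"
    and orth: "\<And>\<psi>. \<psi> \<in> test_functions D \<Longrightarrow> (\<integral>x. Z x * \<psi> x \<partial>lebesgue_on D) = 0"
  shows "AE x in lebesgue_on D. Z x = 0"
proof -
  have "AE x in lebesgue_on D. - Z x \<le> 0"
    by (rule AE_nonpos_of_orthogonal[OF D]) (use Z orth in auto)
  moreover have "AE x in lebesgue_on D. Z x \<le> 0"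
    by (rule AE_nonpos_of_orthogonal[OF D Z]) (rule orth)
  ultimately show ?thesis by eventually_elim simp
qed

section \<open>The energy closure of the test functions\<close>

text \<open>Pairs let a function and its gradient be treated as a single L^2 function, to which
  closure and projection apply.\<close>

lemma L2_Pair_iff: "L2 M (\<lambda>x. (f x, g x)) \<longleftrightarrow> L2 M f \<and> L2 M g"
proof -
  have sq: "(norm (f x, g x))\<^sup>2 = (norm (f x))\<^sup>2 + (norm (g x))\<^sup>2" for x by (simp add: norm_Pair)
  have m: "(\<lambda>x. (f x, g x)) \<in> borel_measurable M \<longleftrightarrow> f \<in> borel_measurable M \<and> g \<in> borel_measurable M"
  proof
    assume p: "(\<lambda>x. (f x, g x)) \<in> borel_measurable M"
    have "(\<lambda>x. fst (f x, g x)) \<in> borel_measurable M"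
      by (rule borel_measurable_continuous_on[OF continuous_on_fst[OF continuous_on_id] p])
    moreover have "(\<lambda>x. snd (f x, g x)) \<in> borel_measurable M"
      by (rule borel_measurable_continuous_on[OF continuous_on_snd[OF continuous_on_id] p])
    ultimately show "f \<in> borel_measurable M \<and> g \<in> borel_measurable M" by simp
  qed (blast intro: borel_measurable_Pair)
  show ?thesis
  proof
    assume L: "L2 M (\<lambda>x. (f x, g x))"
    then have i: "integrable M (\<lambda>x. (norm (f x))\<^sup>2 + (norm (g x))\<^sup>2)" and fg: "f \<in> borel_measurable M" "g \<in> borel_measurable M"
      using m unfolding L2_def sq by auto
    show "L2 M f \<and> L2 M g"
      using L2_dominated[OF fg(1) i] L2_dominated[OF fg(2) i] by simp
  next
    assume "L2 M f \<and> L2 M g"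
    then show "L2 M (\<lambda>x. (f x, g x))" unfolding L2_def sq using m by simp
  qed
qed

lemma nsq_Pair: "L2 M f \<Longrightarrow> L2 M g \<Longrightarrow> nsq M (\<lambda>x. (f x, g x)) = nsq M f + nsq M g"
  by (simp add: nsq_def norm_Pair L2_def)

lemma L2lim_Pair_iff:
  "L2lim M (\<lambda>k x. (F k x, G k x)) (\<lambda>x. (f x, g x)) \<longleftrightarrow> L2lim M F f \<and> L2lim M G g"
proof (cases "(\<forall>k. L2 M (F k) \<and> L2 M (G k)) \<and> L2 M f \<and> L2 M g")
  case True
  then have eq: "nsq M (\<lambda>x. (F k x, G k x) - (f x, g x)) = nsq M (\<lambda>x. F k x - f x) + nsq M (\<lambda>x. G k x - g x)" for k
    using nsq_Pair[OF L2_diff L2_diff, of M "F k" f "G k" g] by simp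
  have "(\<lambda>k. nsq M (\<lambda>x. F k x - f x) + nsq M (\<lambda>x. G k x - g x)) \<longlonglongrightarrow> 0 \<longleftrightarrow>
    (\<lambda>k. nsq M (\<lambda>x. F k x - f x)) \<longlonglongrightarrow> 0 \<and> (\<lambda>k. nsq M (\<lambda>x. G k x - g x)) \<longlonglongrightarrow> 0" (is "?l \<longleftrightarrow> ?r1 \<and> ?r2")
  proof
    assume l: ?l
    have ?r1 by (rule Lim_null_comparison[OF always_eventually l]) simp
    moreover have ?r2 by (rule Lim_null_comparison[OF always_eventually l]) simp
    ultimately show "?r1 \<and> ?r2" by blast
  next
    assume "?r1 \<and> ?r2"
    then show ?l using tendsto_add[of _ 0 sequentially _ 0] by fastforce
  qed
  with True show ?thesis unfolding L2lim_def eq L2_Pair_iff by blast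
next
  case False
  then show ?thesis unfolding L2lim_def L2_Pair_iff by blast
qed

text \<open>The analytic setting: C^1 fields and a bounded open set. The group structure enters
  through the constant component of one field that \<open>barrier_exists\<close> assumes.\<close>

locale horizontal_frame =
  fixes X :: "'m::finite \<Rightarrow> 'a::euclidean_space vfield" and D :: "'a set"
  assumes C1_X: "\<And>j. Ck_on 1 (X j) UNIV" and open_D: "open D" and bounded_D: "bounded D"
begin

abbreviation "M \<equiv> lebesgue_on D"
abbreviation "\<T> \<equiv> test_functions D"
abbreviation "grad \<equiv> hgrad X"

lemma sets_D: "D \<in> sets lebesgue" using open_D by simp

lemma integrable_const: "integrable M (\<lambda>x. c::real)"
  by (intro finite_measure.integrable_const finite_measure_lebesgue_on
      bounded_set_imp_lmeasurable bounded_D sets_D)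

lemma measurable_continuous: "continuous_on UNIV f \<Longrightarrow> (f :: 'a \<Rightarrow> 'b::euclidean_space) \<in> borel_measurable M"
  by (intro measurable_restrict_space1 measurable_completion) (simp add: borel_measurable_continuous_onI)

lemma L2_bounded:
  fixes f :: "'a \<Rightarrow> 'b::euclidean_space"
  assumes "f \<in> borel_measurable M" "AE x in M. norm (f x) \<le> C"
  shows "L2 M f"
proof (rule L2_dominated[OF assms(1) integrable_const[of "C\<^sup>2"]])
  show "AE x in M. (norm (f x))\<^sup>2 \<le> C\<^sup>2"
    using assms(2) by eventually_elim (simp add: power_mono)
qed

lemma L2_continuous:
  fixes f :: "'a \<Rightarrow> 'b::euclidean_space"
  assumes "continuous_on UNIV f" shows "L2 M f"
proof -
  obtain C where C: "\<forall>x\<in>closure D. norm (f x) \<le> C"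
    using continuous_bounded_on_compact[OF _ assms, of "closure D"] bounded_D by auto
  show ?thesis
  proof (rule L2_bounded[OF measurable_continuous[OF assms]])
    show "AE x in M. norm (f x) \<le> C"
      using C closure_subset[of D] by (intro AE_I2) (auto simp: space_restrict_space)
  qed
qed

lemma continuous_X: "continuous_on UNIV (X j)"
  using Ck_on_Suc_imp[of 0 "X j"] C1_X by simp

lemma grad_nth: "grad f x $ j = fderiv f x (X j x)"
  by (simp add: hgrad_def)

lemma continuous_grad: "Ck_on 1 f UNIV \<Longrightarrow> continuous_on UNIV (grad f)"
  unfolding hgrad_def[abs_def] by (intro continuous_on_vec_lambda continuous_on_fderiv continuous_X)

lemma grad_compose:
  fixes f :: "'a \<Rightarrow> real"
  assumes "f differentiable (at x)" "(\<psi> has_real_derivative d) (at (f x))"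
  shows "grad (\<lambda>x. \<psi> (f x)) x = d *\<^sub>R grad f x"
proof -
  have "\<psi> differentiable (at (f x))" using assms(2) by (auto simp: has_field_derivative_def intro: differentiableI)
  from fderiv_eqI[OF has_derivative_fderiv_compose[OF assms(1) this]]
  show ?thesis unfolding fderiv_real[OF assms(2)] by (simp add: vec_eq_iff grad_nth)
qed

lemma grad_comb:
  fixes f g :: "'a \<Rightarrow> real"
  assumes "f differentiable (at x)" "g differentiable (at x)"
  shows "grad (\<lambda>x. f x + c * g x) x = grad f x + c *\<^sub>R grad g x"
proof -
  have "((\<lambda>x. f x + c * g x) has_derivative (\<lambda>v. fderiv f x v + c * fderiv g x v)) (at x)"
    by (intro has_derivative_add has_derivative_mult_right frechet_derivative_works[THEN iffD1] assms)
  from fderiv_eqI[OF this] show ?thesis by (simp add: vec_eq_iff grad_nth)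
qed

lemma test_Ck: "\<phi> \<in> \<T> \<Longrightarrow> Ck_on k \<phi> UNIV" by (rule test_functionsD)
lemma test_diff: "\<phi> \<in> \<T> \<Longrightarrow> \<phi> differentiable (at x)" using test_Ck[of \<phi> 1] by simp

lemma test_comb: "\<phi> \<in> \<T> \<Longrightarrow> \<psi> \<in> \<T> \<Longrightarrow> (\<lambda>x. \<phi> x + c * \<psi> x) \<in> \<T>"
proof -
  assume t: "\<phi> \<in> \<T>" "\<psi> \<in> \<T>"
  obtain K L where KL: "compact K" "K \<subseteq> D" "\<And>x. x \<notin> K \<Longrightarrow> \<phi> x = 0" "compact L" "L \<subseteq> D" "\<And>x. x \<notin> L \<Longrightarrow> \<psi> x = 0"
    using test_functionsD(2)[OF t(1)] test_functionsD(2)[OF t(2)] by blast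
  show ?thesis
  proof (rule test_functionsI)
    show "Ck_on k (\<lambda>x. \<phi> x + c * \<psi> x) UNIV" for k
      by (intro Ck_on_add Ck_on_mult Ck_on_const test_Ck t)
    show "compact (K \<union> L)" using KL by (rule_tac compact_Un) auto
  qed (use KL in auto)
qed

lemma zero_test: "(\<lambda>x. 0) \<in> \<T>"
  by (rule test_functionsI[of _ "{}"]) (auto simp: Ck_on_const)

lemma L2_test: "\<phi> \<in> \<T> \<Longrightarrow> L2 M \<phi>"
  by (intro L2_continuous Ck_on_all_continuous test_Ck)

lemma L2_grad: "Ck_on 1 f UNIV \<Longrightarrow> L2 M (grad f)"
  by (intro L2_continuous continuous_grad)

lemma L2_grad_test: "\<phi> \<in> \<T> \<Longrightarrow> L2 M (grad \<phi>)"
  by (intro L2_grad test_Ck)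

lemma test_integral_by_parts:
  assumes "\<phi> \<in> \<T>" "Ck_on 1 Y UNIV"
  shows "(\<integral>x. fderiv \<phi> x (Y x) \<partial>M) = - (\<integral>x. \<phi> x * divergence Y x \<partial>M)"
proof -
  obtain K where K: "compact K" "K \<subseteq> D" "\<And>x. x \<notin> K \<Longrightarrow> \<phi> x = 0"
    using test_functionsD(2)[OF assms(1)] by blast
  have c: "continuous_on UNIV (\<lambda>x. fderiv \<phi> x (Y x))"
    using assms Ck_on_Suc_imp[of 0 Y] by (intro continuous_on_fderiv test_Ck) auto
  have c2: "continuous_on UNIV (\<lambda>x. \<phi> x * divergence Y x)"
    using assms by (intro continuous_on_mult Ck_on_all_continuous test_Ck continuous_on_divergence)
  have z: "fderiv \<phi> x (Y x) = 0" if "x \<notin> D" for x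
  proof -
    have "x \<notin> K" using K(2) that by blast
    then show ?thesis using fderiv_eq_0_outside[OF compact_imp_closed[OF K(1)] K(3)] by simp
  qed
  have z2: "\<phi> x * divergence Y x = 0" if "x \<notin> D" for x using K(2,3) that by auto
  show ?thesis
    using integration_by_parts[OF test_Ck[OF assms(1)] assms(2) K(1,3)]
      integral_lebesgue_on_eq[OF sets_D borel_measurable_continuous_onI[OF c] z]
      integral_lebesgue_on_eq[OF sets_D borel_measurable_continuous_onI[OF c2] z2] by simp
qed

text \<open>The closure with respect to \<open>L\<^sup>2\<close> plus energy, instead of \<open>L\<^sup>q\<close> plus energy as in the
  Folland-Stein space; both have the same bounded elements.\<close>

definition FS :: "('a \<Rightarrow> real) \<Rightarrow> ('a \<Rightarrow> real^'m) \<Rightarrow> bool" where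
  "FS u U \<longleftrightarrow> (\<exists>\<phi>. (\<forall>k. \<phi> k \<in> \<T>) \<and> L2lim M \<phi> u \<and> L2lim M (\<lambda>k. grad (\<phi> k)) U)"

text \<open>Turns \<open>FS\<close> into a closure inside one L^2 space, so that linearity and
  closedness are inherited from \<open>L2cl\<close>.\<close>

definition jets :: "('a \<Rightarrow> real \<times> (real^'m)) set" where
  "jets = {\<lambda>x. (\<phi> x, grad \<phi> x) | \<phi>. \<phi> \<in> \<T>}"

lemma jets_L2: "s \<in> jets \<Longrightarrow> L2 M s"
  by (auto simp: jets_def L2_Pair_iff L2_test L2_grad_test)

lemma jets_comb: "s \<in> jets \<Longrightarrow> t \<in> jets \<Longrightarrow> (\<lambda>x. s x + c *\<^sub>R t x) \<in> jets"
proof -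
  assume "s \<in> jets" "t \<in> jets"
  then obtain \<phi> \<psi> where *: "\<phi> \<in> \<T>" "\<psi> \<in> \<T>" "s = (\<lambda>x. (\<phi> x, grad \<phi> x))" "t = (\<lambda>x. (\<psi> x, grad \<psi> x))"
    unfolding jets_def by blast
  have "(\<lambda>x. s x + c *\<^sub>R t x) = (\<lambda>x. (\<phi> x + c * \<psi> x, grad (\<lambda>x. \<phi> x + c * \<psi> x) x))"
    unfolding *(3,4) grad_comb[OF test_diff[OF *(1)] test_diff[OF *(2)]] by simp
  then show ?thesis
    unfolding jets_def mem_Collect_eq
    by (intro exI[of _ "\<lambda>x. \<phi> x + c * \<psi> x"] conjI test_comb[OF *(1,2)])
qed

lemma FS_iff: "FS u U \<longleftrightarrow> (\<lambda>x. (u x, U x)) \<in> L2cl M jets"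
proof -
  have "FS u U \<longleftrightarrow> (\<exists>F. (\<forall>k. F k \<in> jets) \<and> L2lim M F (\<lambda>x. (u x, U x)))"
  proof
    assume "FS u U"
    then obtain \<phi> where "\<And>k. \<phi> k \<in> \<T>" "L2lim M \<phi> u" "L2lim M (\<lambda>k. grad (\<phi> k)) U"
      unfolding FS_def by blast
    then show "\<exists>F. (\<forall>k. F k \<in> jets) \<and> L2lim M F (\<lambda>x. (u x, U x))"
      by (intro exI[of _ "\<lambda>k x. (\<phi> k x, grad (\<phi> k) x)"]) (auto simp: jets_def L2lim_Pair_iff)
  next
    assume "\<exists>F. (\<forall>k. F k \<in> jets) \<and> L2lim M F (\<lambda>x. (u x, U x))"
    then obtain F where F: "\<And>k. F k \<in> jets" "L2lim M F (\<lambda>x. (u x, U x))" by blast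
    from F(1) have "\<forall>k. \<exists>\<phi>\<in>\<T>. F k = (\<lambda>x. (\<phi> x, grad \<phi> x))" by (auto simp: jets_def)
    then obtain \<phi> where \<phi>: "\<And>k. \<phi> k \<in> \<T>" "\<And>k. F k = (\<lambda>x. (\<phi> k x, grad (\<phi> k) x))" by metis
    have "F = (\<lambda>k x. (\<phi> k x, grad (\<phi> k) x))" using \<phi>(2) by blast
    then show "FS u U" using \<phi>(1) F(2) unfolding FS_def by (auto simp: L2lim_Pair_iff)
  qed
  then show ?thesis using L2cl_L2lim[of jets M, OF jets_L2] by blast
qed

lemma FS_L2: "FS u U \<Longrightarrow> L2 M u" "FS u U \<Longrightarrow> L2 M U"
  by (auto simp: FS_def L2lim_def)

lemma FS_comb: "FS u U \<Longrightarrow> FS v V \<Longrightarrow> FS (\<lambda>x. u x + c * v x) (\<lambda>x. U x + c *\<^sub>R V x)"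
proof -
  assume "FS u U" "FS v V"
  then have uv: "(\<lambda>x. (u x, U x)) \<in> L2cl M jets" "(\<lambda>x. (v x, V x)) \<in> L2cl M jets"
    by (simp_all only: FS_iff)
  have "(\<lambda>x. (u x, U x) + c *\<^sub>R (v x, V x)) \<in> L2cl M jets"
    by (rule L2cl_comb[OF jets_L2 uv jets_comb])
  then show ?thesis by (simp add: FS_iff)
qed

lemma FS_closed:
  assumes "\<And>k. FS (u k) (U k)" "L2lim M u v" "L2lim M U V"
  shows "FS v V"
  unfolding FS_iff
proof (rule L2cl_closed[OF jets_L2])
  show "(\<lambda>x. (u k x, U k x)) \<in> L2cl M jets" for k using assms(1) by (simp add: FS_iff)
  show "L2lim M (\<lambda>k x. (u k x, U k x)) (\<lambda>x. (v x, V x))" using assms by (simp add: L2lim_Pair_iff)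
qed

text \<open>The horizontal gradient is closable: against a test function \<psi>, the j-th component
  of \<open>grad (\<phi> k)\<close> integrates to minus the integral of \<open>\<phi> k\<close>
  times the divergence of \<psi> \<open>X j\<close>, which tends to 0. So every component of Z is
  orthogonal to all test functions.\<close>

lemma FS_0_imp_grad_0:
  assumes "FS (\<lambda>x. 0) Z"
  shows "AE x in M. Z x = 0"
proof -
  obtain \<phi> where \<phi>: "\<And>k. \<phi> k \<in> \<T>" "L2lim M \<phi> (\<lambda>x. 0)" "L2lim M (\<lambda>k. grad (\<phi> k)) Z"
    using assms unfolding FS_def by blast
  note ZL = FS_L2(2)[OF assms]
  have comp: "AE x in M. Z x $ j = 0" for j
  proof (rule AE_eq_0_of_orthogonal[OF open_D bounded_D])
    have axisL: "L2 M (\<lambda>x. axis j (1::real))" by (rule L2_continuous) simp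
    show "integrable M (\<lambda>x. Z x $ j)"
      using L2_inner[OF ZL axisL] by (simp add: inner_axis)
    fix \<psi> assume \<psi>: "\<psi> \<in> \<T>"
    have "continuous_on UNIV (\<lambda>x. axis j (\<psi> x))"
    proof -
      have eq: "(\<lambda>x. axis j (\<psi> x)) = (\<lambda>x. \<psi> x *\<^sub>R axis j 1)" by (auto simp: axis_def vec_eq_iff)
      show ?thesis unfolding eq
        by (intro continuous_on_scaleR continuous_on_const Ck_on_all_continuous test_Ck \<psi>)
    qed
    then have aL: "L2 M (\<lambda>x. axis j (\<psi> x))" by (rule L2_continuous)
    have lim: "(\<lambda>k. \<integral>x. grad (\<phi> k) x $ j * \<psi> x \<partial>M) \<longlonglongrightarrow> (\<integral>x. Z x $ j * \<psi> x \<partial>M)"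
      using L2lim_inner[OF \<phi>(3) L2lim_const[OF aL]] by (simp add: inner_axis)
    let ?Y = "\<lambda>x. \<psi> x *\<^sub>R X j x"
    have Y: "Ck_on 1 ?Y UNIV" by (intro Ck_on_scaleR test_Ck \<psi> C1_X)
    have dL: "L2 M (divergence ?Y)" by (intro L2_continuous continuous_on_divergence Y)
    have "(\<integral>x. grad (\<phi> k) x $ j * \<psi> x \<partial>M) = - (\<integral>x. \<phi> k x * divergence ?Y x \<partial>M)" for k
    proof -
      have "grad (\<phi> k) x $ j * \<psi> x = fderiv (\<phi> k) x (?Y x)" for x
        using linear_scale[OF linear_frechet_derivative[OF test_diff[OF \<phi>(1)]]] by (simp add: grad_nth)
      then show ?thesis using test_integral_by_parts[OF \<phi>(1) Y] by simp
    qed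
    moreover have "(\<lambda>k. - (\<integral>x. \<phi> k x * divergence ?Y x \<partial>M)) \<longlonglongrightarrow> - (\<integral>x. 0 * divergence ?Y x \<partial>M)"
      by (intro tendsto_minus L2lim_mult \<phi>(2) L2lim_const dL)
    ultimately show "(\<integral>x. Z x $ j * \<psi> x \<partial>M) = 0"
      using LIMSEQ_unique[OF lim] by simp
  qed
  have "AE x in M. \<forall>j\<in>UNIV. Z x $ j = 0" using comp by (intro AE_finite_allI) auto
  then show ?thesis by eventually_elim (simp add: vec_eq_iff)
qed

lemma FS_unique:
  assumes "FS u U" "FS u V"
  shows "AE x in M. U x = V x"
proof -
  have "FS (\<lambda>x. 0) (\<lambda>x. U x - V x)" using FS_comb[OF assms, of "-1"] by simp
  from FS_0_imp_grad_0[OF this] show ?thesis by simp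
qed

end

section \<open>Linear weak equations\<close>

lemma nsq_mult_bounded_le:
  fixes a :: "'a \<Rightarrow> real"
  assumes "L2 M f" "a \<in> borel_measurable M" "\<And>x. \<bar>a x\<bar> \<le> C"
  shows "nsq M (\<lambda>x. a x *\<^sub>R f x) \<le> C\<^sup>2 * nsq M f"
proof -
  have "nsq M (\<lambda>x. a x *\<^sub>R f x) \<le> (\<integral>x. C\<^sup>2 * (norm (f x))\<^sup>2 \<partial>M)"
    unfolding nsq_def
    by (rule integral_mono[OF L2_integrable[OF L2_mult_bounded[OF assms]] _ norm_scaleR_sq_le[OF assms(3)]])
       (use L2_integrable[OF assms(1)] in simp)
  then show ?thesis by (simp add: nsq_def)
qed

lemma mult_le_norm_sq: "a * b \<le> (norm a)\<^sup>2 + (norm (b::real))\<^sup>2"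
proof -
  have "2 * a * b \<le> a\<^sup>2 + b\<^sup>2" by (rule sum_squares_bound)
  moreover have "0 \<le> a\<^sup>2 + b\<^sup>2" by simp
  ultimately have "a * b \<le> a\<^sup>2 + b\<^sup>2" by linarith
  then show ?thesis by simp
qed

lemma L2lim_cong_AE:
  assumes "L2lim M F f" "AE x in M. f x = g x" "g \<in> borel_measurable M"
  shows "L2lim M F g"
proof -
  have f: "L2 M f" "\<And>k. L2 M (F k)" using assms(1) by (auto simp: L2lim_def)
  have "L2 M g"
    by (rule L2_dominated[OF assms(3) L2_integrable[OF f(1)]]) (use assms(2) in eventually_elim, simp)
  moreover have "nsq M (\<lambda>x. F k x - g x) = nsq M (\<lambda>x. F k x - f x)" for k
    unfolding nsq_def
  proof (rule integral_cong_AE)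
    show "AE x in M. (norm (F k x - g x))\<^sup>2 = (norm (F k x - f x))\<^sup>2"
      using assms(2) by eventually_elim simp
  qed (use L2_measurable[OF f(1)] L2_measurable[OF f(2)] assms(3) in measurable)
  ultimately show ?thesis using assms(1) by (simp add: L2lim_def)
qed

text \<open>The difference splits into a_k (F_k - f), small because the a_k are uniformly bounded,
  and (a_k - a') f, small by domination. It is the limit in the chain rule for truncated test
  functions.\<close>

lemma L2lim_mult_bounded:
  fixes a :: "nat \<Rightarrow> 'a \<Rightarrow> real"
  assumes F: "L2lim M F f" and a: "\<And>k. a k \<in> borel_measurable M" "\<And>k x. \<bar>a k x\<bar> \<le> C"
    and lim: "AE x in M. (\<lambda>k. a k x) \<longlonglongrightarrow> a' x" "a' \<in> borel_measurable M"
  shows "L2lim M (\<lambda>k x. a k x *\<^sub>R F k x) (\<lambda>x. a' x *\<^sub>R f x)"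
proof -
  have L: "L2 M (F k)" "L2 M f" for k using F by (auto simp: L2lim_def)
  note d = L2_diff[OF L(1) L(2)]
  have af: "L2lim M (\<lambda>k x. a k x *\<^sub>R f x) (\<lambda>x. a' x *\<^sub>R f x)"
  proof (rule L2lim_dominated)
    show "integrable M (\<lambda>x. C\<^sup>2 * (norm (f x))\<^sup>2)" using L2_integrable[OF L(2)] by simp
    show "AE x in M. (\<lambda>k. a k x *\<^sub>R f x) \<longlonglongrightarrow> a' x *\<^sub>R f x"
      using lim(1) by eventually_elim (intro tendsto_intros)
    show "AE x in M. (norm (a k x *\<^sub>R f x))\<^sup>2 \<le> C\<^sup>2 * (norm (f x))\<^sup>2" for k
      by (intro AE_I2 norm_scaleR_sq_le a(2))
  qed (use a(1) lim(2) L2_measurable[OF L(2)] in measurable)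
  have le: "nsq M (\<lambda>x. a k x *\<^sub>R F k x - a' x *\<^sub>R f x)
    \<le> 2 * (C\<^sup>2 * nsq M (\<lambda>x. F k x - f x)) + 2 * nsq M (\<lambda>x. a k x *\<^sub>R f x - a' x *\<^sub>R f x)" for k
  proof -
    have "nsq M (\<lambda>x. a k x *\<^sub>R F k x - a' x *\<^sub>R f x) \<le> 2 * nsq M (\<lambda>x. a k x *\<^sub>R F k x - a k x *\<^sub>R f x)
      + 2 * nsq M (\<lambda>x. a k x *\<^sub>R f x - a' x *\<^sub>R f x)"
      by (rule nsq_triangle[OF L2_mult_bounded[OF L(1) a] L2lim_L2_seq[OF af] L2lim_L2[OF af]])
    moreover have "nsq M (\<lambda>x. a k x *\<^sub>R F k x - a k x *\<^sub>R f x) \<le> C\<^sup>2 * nsq M (\<lambda>x. F k x - f x)"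
      using nsq_mult_bounded_le[OF d a] by (simp add: scaleR_diff_right)
    ultimately show ?thesis by linarith
  qed
  let ?b = "\<lambda>k. 2 * (C\<^sup>2 * nsq M (\<lambda>x. F k x - f x)) + 2 * nsq M (\<lambda>x. a k x *\<^sub>R f x - a' x *\<^sub>R f x)"
  have "?b \<longlonglongrightarrow> 2 * (C\<^sup>2 * 0) + 2 * 0"
    using F af by (intro tendsto_intros) (auto simp: L2lim_def)
  then have b0: "?b \<longlonglongrightarrow> 0" by (simp only: mult_zero_right add_0_left)
  have "(\<lambda>k. nsq M (\<lambda>x. a k x *\<^sub>R F k x - a' x *\<^sub>R f x)) \<longlonglongrightarrow> 0"
    by (rule nsq_tendsto_0[OF le b0])
  then show ?thesis unfolding L2lim_def using L2_mult_bounded[OF L(1) a] L2lim_L2[OF af] by blast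
qed

lemma divergence_scaleR:
  fixes h :: "'a::euclidean_space \<Rightarrow> real"
  assumes "h differentiable (at x)" "A differentiable (at x)"
  shows "divergence (\<lambda>x. h x *\<^sub>R A x) x = h x * divergence A x + fderiv h x (A x)"
proof -
  have "((\<lambda>x. h x *\<^sub>R A x) has_derivative (\<lambda>v. h x *\<^sub>R fderiv A x v + fderiv h x v *\<^sub>R A x)) (at x)"
    by (intro has_derivative_scaleR frechet_derivative_works[THEN iffD1] assms)
  note d = fderiv_eqI[OF this]
  have "fderiv h x (A x) = (\<Sum>b\<in>Basis. fderiv h x b * (A x \<bullet> b))"
    unfolding fderiv_expand[OF assms(1), of "A x"] by (simp add: mult.commute)
  then show ?thesis
    unfolding divergence_def d
    by (simp add: inner_add_left sum.distrib sum_distrib_left)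
qed

context horizontal_frame
begin

text \<open>The weak form of - \<Delta> u = h, with U as the gradient of u. The right hand side is a
  function of the point, so h may itself contain u, as in f (u x) or h x - K u x.\<close>

definition weak_eq :: "('a \<Rightarrow> real) \<Rightarrow> ('a \<Rightarrow> real^'m) \<Rightarrow> ('a \<Rightarrow> real) \<Rightarrow> bool" where
  "weak_eq u U h \<longleftrightarrow> FS u U \<and> L2 M h \<and> (\<forall>\<phi>\<in>\<T>. (\<integral>x. U x \<bullet> grad \<phi> x \<partial>M) = (\<integral>x. h x * \<phi> x \<partial>M))"

lemma weak_eqD:
  assumes "weak_eq u U h"
  shows "FS u U" "L2 M h" "L2 M u" "L2 M U" "\<phi> \<in> \<T> \<Longrightarrow> (\<integral>x. U x \<bullet> grad \<phi> x \<partial>M) = (\<integral>x. h x * \<phi> x \<partial>M)"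
  using assms FS_L2 unfolding weak_eq_def by blast+

lemma weak_eq_FS:
  assumes "weak_eq u U h" "FS v V"
  shows "(\<integral>x. U x \<bullet> V x \<partial>M) = (\<integral>x. h x * v x \<partial>M)"
proof -
  obtain \<phi> where \<phi>: "\<And>k. \<phi> k \<in> \<T>" "L2lim M \<phi> v" "L2lim M (\<lambda>k. grad (\<phi> k)) V"
    using assms(2) unfolding FS_def by blast
  have "(\<lambda>k. \<integral>x. U x \<bullet> grad (\<phi> k) x \<partial>M) \<longlonglongrightarrow> (\<integral>x. U x \<bullet> V x \<partial>M)"
    by (rule L2lim_inner[OF L2lim_const[OF weak_eqD(4)[OF assms(1)]] \<phi>(3)])
  moreover have "(\<lambda>k. \<integral>x. h x * \<phi> k x \<partial>M) \<longlonglongrightarrow> (\<integral>x. h x * v x \<partial>M)"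
    by (rule L2lim_mult[OF L2lim_const[OF weak_eqD(2)[OF assms(1)]] \<phi>(2)])
  ultimately show ?thesis unfolding weak_eqD(5)[OF assms(1) \<phi>(1)] by (rule LIMSEQ_unique)
qed

lemma weak_eq_comb:
  assumes "weak_eq u U h" "weak_eq v V k"
  shows "weak_eq (\<lambda>x. u x + c * v x) (\<lambda>x. U x + c *\<^sub>R V x) (\<lambda>x. h x + c * k x)"
  unfolding weak_eq_def
proof (intro conjI ballI)
  show "FS (\<lambda>x. u x + c * v x) (\<lambda>x. U x + c *\<^sub>R V x)" using assms by (intro FS_comb weak_eqD)
  show "L2 M (\<lambda>x. h x + c * k x)" using assms by (intro L2_add L2_mult weak_eqD)
  fix \<phi> assume \<phi>: "\<phi> \<in> \<T>"
  note i = L2_inner[OF weak_eqD(4)[OF assms(1)] L2_grad_test[OF \<phi>]] L2_inner[OF weak_eqD(4)[OF assms(2)] L2_grad_test[OF \<phi>]]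
    L2_mult_integrable[OF weak_eqD(2)[OF assms(1)] L2_test[OF \<phi>]] L2_mult_integrable[OF weak_eqD(2)[OF assms(2)] L2_test[OF \<phi>]]
  have "(\<integral>x. (U x + c *\<^sub>R V x) \<bullet> grad \<phi> x \<partial>M) = (\<integral>x. U x \<bullet> grad \<phi> x \<partial>M) + c * (\<integral>x. V x \<bullet> grad \<phi> x \<partial>M)"
    using i by (simp add: inner_add_left)
  also have "\<dots> = (\<integral>x. h x * \<phi> x \<partial>M) + c * (\<integral>x. k x * \<phi> x \<partial>M)"
    using weak_eqD(5)[OF assms(1) \<phi>] weak_eqD(5)[OF assms(2) \<phi>] by simp
  also have "\<dots> = (\<integral>x. (h x + c * k x) * \<phi> x \<partial>M)"
    using i by (simp add: distrib_right mult.assoc)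
  finally show "(\<integral>x. (U x + c *\<^sub>R V x) \<bullet> grad \<phi> x \<partial>M) = (\<integral>x. (h x + c * k x) * \<phi> x \<partial>M)" .
qed

text \<open>Projecting \<open>(h / \<surd>K, 0)\<close> onto the closed span of the pairs \<open>(\<surd>K \<phi>, \<nabla>\<phi>)\<close> in \<open>L\<^sup>2\<close>
  solves \<open>- \<Delta> u + K u = h\<close>.\<close>

lemma linear_solvable:
  assumes K: "K > 0" and h: "L2 M h"
  shows "\<exists>u U. weak_eq u U (\<lambda>x. h x - K * u x)"
proof -
  define S where "S = {\<lambda>x. (sqrt K * \<phi> x, grad \<phi> x) | \<phi>. \<phi> \<in> \<T>}"
  have sK: "sqrt K > 0" "sqrt K * sqrt K = K" using K by auto
  have S_L2: "L2 M s" if "s \<in> S" for s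
    using that by (auto simp: S_def L2_Pair_iff L2_test L2_grad_test L2_mult)
  have S_comb: "(\<lambda>x. s x + c *\<^sub>R t x) \<in> S" if st: "s \<in> S" "t \<in> S" for s t c
  proof -
    obtain \<phi> \<psi> where *: "\<phi> \<in> \<T>" "\<psi> \<in> \<T>" "s = (\<lambda>x. (sqrt K * \<phi> x, grad \<phi> x))" "t = (\<lambda>x. (sqrt K * \<psi> x, grad \<psi> x))"
      using st unfolding S_def by blast
    have "(\<lambda>x. s x + c *\<^sub>R t x) = (\<lambda>x. (sqrt K * (\<phi> x + c * \<psi> x), grad (\<lambda>x. \<phi> x + c * \<psi> x) x))"
      unfolding *(3,4) grad_comb[OF test_diff[OF *(1)] test_diff[OF *(2)]] by (simp add: algebra_simps)
    then show ?thesis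
      unfolding S_def mem_Collect_eq
      by (intro exI[of _ "\<lambda>x. \<phi> x + c * \<psi> x"] conjI test_comb[OF *(1,2)])
  qed
  have zS: "(\<lambda>x. 0) \<in> S"
  proof -
    have "grad (\<lambda>x. 0) x = 0" for x by (simp add: vec_eq_iff grad_nth)
    then show ?thesis unfolding S_def mem_Collect_eq
      by (intro exI[of _ "\<lambda>x. 0"] conjI zero_test) (simp add: zero_prod_def)
  qed
  have S_avg: "(\<lambda>x. (1/2) *\<^sub>R (s x + t x)) \<in> S" if "s \<in> S" "t \<in> S" for s t
    using S_comb[OF zS S_comb[OF that, of 1], of "1/2"] by simp
  have hL: "L2 M (\<lambda>x. (h x / sqrt K, 0 :: real^'m))"
    using L2_mult[OF h, of "1 / sqrt K"] by (simp add: L2_Pair_iff) (simp add: L2_def)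
  obtain F w where F: "\<And>k. F k \<in> S" "L2lim M F w"
    and orth: "\<And>s. s \<in> S \<Longrightarrow> (\<integral>x. (w x - (h x / sqrt K, 0)) \<bullet> s x \<partial>M) = 0"
    using L2_projection[OF S_L2 hL _ S_comb S_avg] zS by blast
  have "\<forall>k. \<exists>\<phi>\<in>\<T>. F k = (\<lambda>x. (sqrt K * \<phi> x, grad \<phi> x))" using F(1) by (auto simp: S_def)
  then obtain \<phi> where \<phi>: "\<And>k. \<phi> k \<in> \<T>" "\<And>k. F k = (\<lambda>x. (sqrt K * \<phi> k x, grad (\<phi> k) x))" by metis
  define u where "u x = fst (w x) / sqrt K" for x
  define U where "U x = snd (w x)" for x
  have Feq: "F = (\<lambda>k x. (sqrt K * \<phi> k x, grad (\<phi> k) x))" using \<phi>(2) by blast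
  have weq: "w = (\<lambda>x. (sqrt K * u x, U x))" using sK by (auto simp: u_def U_def)
  have L: "L2lim M (\<lambda>k x. sqrt K * \<phi> k x) (\<lambda>x. sqrt K * u x)" "L2lim M (\<lambda>k. grad (\<phi> k)) U"
    using F(2) unfolding Feq weq L2lim_Pair_iff by blast+
  have uL: "L2 M u"
    using L2_mult[OF L2lim_L2[OF L(1)], of "1 / sqrt K"] sK by simp
  have "L2lim M \<phi> u"
  proof -
    have "nsq M (\<lambda>x. sqrt K * \<phi> k x - sqrt K * u x) = K * nsq M (\<lambda>x. \<phi> k x - u x)" for k
      using nsq_scaleR[of M "sqrt K" "\<lambda>x. \<phi> k x - u x"] K by (simp add: algebra_simps)
    then have "(\<lambda>k. K * nsq M (\<lambda>x. \<phi> k x - u x)) \<longlonglongrightarrow> 0" using L(1) by (simp add: L2lim_def)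
    then have "(\<lambda>k. nsq M (\<lambda>x. \<phi> k x - u x)) \<longlonglongrightarrow> 0"
      using K tendsto_mult_left_iff[of K "\<lambda>k. nsq M (\<lambda>x. \<phi> k x - u x)" 0] by simp
    then show ?thesis using uL \<phi>(1) L2_test by (simp add: L2lim_def)
  qed
  then have fs: "FS u U" unfolding FS_def using \<phi>(1) L(2) by blast
  have "weak_eq u U (\<lambda>x. h x - K * u x)"
    unfolding weak_eq_def
  proof (intro conjI ballI)
    show "L2 M (\<lambda>x. h x - K * u x)" by (intro L2_diff L2_mult h uL)
    fix \<psi> assume \<psi>: "\<psi> \<in> \<T>"
    have "(\<lambda>x. (sqrt K * \<psi> x, grad \<psi> x)) \<in> S" unfolding S_def using \<psi> by blast
    from orth[OF this] have "0 = (\<integral>x. (sqrt K * u x - h x / sqrt K) * (sqrt K * \<psi> x) + U x \<bullet> grad \<psi> x \<partial>M)"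
      unfolding weq by simp
    also have "\<dots> = (\<integral>x. U x \<bullet> grad \<psi> x - (h x - K * u x) * \<psi> x \<partial>M)"
    proof (rule Bochner_Integration.integral_cong[OF refl])
      fix x
      have "(sqrt K * u x - h x / sqrt K) * (sqrt K * \<psi> x) = (sqrt K * sqrt K) * u x * \<psi> x - h x * \<psi> x"
        using sK(1) by (simp add: field_simps)
      then show "(sqrt K * u x - h x / sqrt K) * (sqrt K * \<psi> x) + U x \<bullet> grad \<psi> x = U x \<bullet> grad \<psi> x - (h x - K * u x) * \<psi> x"
        unfolding sK(2) by (simp add: algebra_simps)
    qed
    also have "\<dots> = (\<integral>x. U x \<bullet> grad \<psi> x \<partial>M) - (\<integral>x. (h x - K * u x) * \<psi> x \<partial>M)"
      by (intro Bochner_Integration.integral_diff L2_inner L2_mult_integrable L2_diff L2_mult h uL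
          FS_L2[OF fs] L2_grad_test L2_test \<psi>)
    finally show "(\<integral>x. U x \<bullet> grad \<psi> x \<partial>M) = (\<integral>x. (h x - K * u x) * \<psi> x \<partial>M)" by simp
  qed (rule fs)
  then show ?thesis by blast
qed

lemma weak_eq_limit:
  assumes eq: "\<And>n. weak_eq (u n) (U n) (h n)"
    and u: "L2lim M u v" and h: "L2lim M h k"
  shows "\<exists>V. weak_eq v V k"
proof -
  have "\<exists>V. L2lim M U V"
  proof (rule L2_complete)
    show "L2 M (U n)" for n by (rule weak_eqD[OF eq])
    fix e :: real assume e: "e > 0"
    \<comment> \<open>Four distances enter the final estimate, each with the factor 2 from
      \<open>nsq_triangle\<close>; hence e / 8.\<close>
    have "\<exists>N. \<forall>n\<ge>N. nsq M (\<lambda>x. u n x - v x) < e / 8 \<and> nsq M (\<lambda>x. h n x - k x) < e / 8"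
      using u h e unfolding L2lim_def
      by (intro eventually_sequentially[THEN iffD1] eventually_conj order_tendstoD(2)[of _ 0]) auto
    then obtain N where N: "\<And>n. n \<ge> N \<Longrightarrow> nsq M (\<lambda>x. u n x - v x) < e / 8" "\<And>n. n \<ge> N \<Longrightarrow> nsq M (\<lambda>x. h n x - k x) < e / 8"
      by blast
    have "nsq M (\<lambda>x. U m x - U n x) < e" if mn: "m \<ge> N" "n \<ge> N" for m n
    proof -
      have d: "weak_eq (\<lambda>x. u m x - u n x) (\<lambda>x. U m x - U n x) (\<lambda>x. h m x - h n x)"
        using weak_eq_comb[OF eq[of m] eq[of n], of "-1"] by simp
      have "nsq M (\<lambda>x. U m x - U n x) = (\<integral>x. (h m x - h n x) * (u m x - u n x) \<partial>M)"
        using weak_eq_FS[OF d weak_eqD(1)[OF d]] by (simp add: nsq_def power2_norm_eq_inner)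
      also have "\<dots> \<le> (\<integral>x. (norm (h m x - h n x))\<^sup>2 + (norm (u m x - u n x))\<^sup>2 \<partial>M)"
      proof (rule integral_mono)
        show "(h m x - h n x) * (u m x - u n x) \<le> (norm (h m x - h n x))\<^sup>2 + (norm (u m x - u n x))\<^sup>2" for x
          by (rule mult_le_norm_sq)
        show "integrable M (\<lambda>x. (h m x - h n x) * (u m x - u n x))"
          by (rule L2_mult_integrable[OF weak_eqD(2,3)[OF d]])
        show "integrable M (\<lambda>x. (norm (h m x - h n x))\<^sup>2 + (norm (u m x - u n x))\<^sup>2)"
          by (intro Bochner_Integration.integrable_add L2_integrable weak_eqD(2,3)[OF d])
      qed
      also have "\<dots> = nsq M (\<lambda>x. h m x - h n x) + nsq M (\<lambda>x. u m x - u n x)"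
        unfolding nsq_def
        by (intro Bochner_Integration.integral_add L2_integrable weak_eqD(2,3)[OF d])
      also have "\<dots> \<le> (2 * nsq M (\<lambda>x. h m x - k x) + 2 * nsq M (\<lambda>x. k x - h n x)) +
          (2 * nsq M (\<lambda>x. u m x - v x) + 2 * nsq M (\<lambda>x. v x - u n x))"
        using u h by (intro add_mono nsq_triangle) (auto simp: L2lim_def)
      also have "\<dots> < e"
        using N[OF mn(1)] N[OF mn(2)] nsq_commute[of M k "h n"] nsq_commute[of M v "u n"] by linarith
      finally show ?thesis .
    qed
    then show "\<exists>N. \<forall>m\<ge>N. \<forall>n\<ge>N. nsq M (\<lambda>x. U m x - U n x) < e" by blast
  qed
  then obtain V where V: "L2lim M U V" by blast
  have "FS v V" by (rule FS_closed[OF weak_eqD(1)[OF eq] u V])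
  moreover have "(\<integral>x. V x \<bullet> grad \<phi> x \<partial>M) = (\<integral>x. k x * \<phi> x \<partial>M)" if \<phi>: "\<phi> \<in> \<T>" for \<phi>
  proof -
    have "(\<lambda>n. \<integral>x. U n x \<bullet> grad \<phi> x \<partial>M) \<longlonglongrightarrow> (\<integral>x. V x \<bullet> grad \<phi> x \<partial>M)"
      by (rule L2lim_inner[OF V L2lim_const[OF L2_grad_test[OF \<phi>]]])
    moreover have "(\<lambda>n. \<integral>x. h n x * \<phi> x \<partial>M) \<longlonglongrightarrow> (\<integral>x. k x * \<phi> x \<partial>M)"
      by (rule L2lim_mult[OF h L2lim_const[OF L2_test[OF \<phi>]]])
    ultimately show ?thesis unfolding weak_eqD(5)[OF eq \<phi>] by (rule LIMSEQ_unique)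
  qed
  ultimately show ?thesis unfolding weak_eq_def using L2lim_L2[OF h] by blast
qed

end

section \<open>Comparison and bounded approximation\<close>

context horizontal_frame
begin

text \<open>The inequality is tested with \<zeta>_k = \<eta> (\<phi>_k - w). In the limit it says
  that K times the integral of (u - w) \<eta> (u - w) is at most 0. This integrand is nonnegative,
  and positive wherever u > w.\<close>

lemma weak_comparison:
  assumes u: "FS u U" and w: "\<And>k. Ck_on k w UNIV" "\<And>x. 0 \<le> w x" and K: "K > 0"
    and sub: "\<And>\<zeta>. \<zeta> \<in> \<T> \<Longrightarrow> (\<And>x. 0 \<le> \<zeta> x) \<Longrightarrow>
      (\<integral>x. (U x - grad w x) \<bullet> grad \<zeta> x \<partial>M) + K * (\<integral>x. (u x - w x) * \<zeta> x \<partial>M) \<le> 0"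
  shows "AE x in M. u x \<le> w x"
proof -
  obtain \<phi> where \<phi>: "\<And>k. \<phi> k \<in> \<T>" "L2lim M \<phi> u" "L2lim M (\<lambda>k. grad (\<phi> k)) U"
    using u unfolding FS_def by blast
  define \<eta> where "\<eta> = flat 1"
  define \<eta>' where "\<eta>' = flat (monom 1 2 * (1 - pderiv 1))"
  have \<eta>: "(\<eta> has_real_derivative \<eta>' t) (at t)" for t unfolding \<eta>_def \<eta>'_def by (rule flat_deriv)
  have \<eta>0: "0 \<le> \<eta> t" "t > 0 \<Longrightarrow> 0 < \<eta> t" "t \<le> 0 \<Longrightarrow> \<eta> t = 0" and \<eta>'0: "0 \<le> \<eta>' t" "\<eta>' t \<le> 2" for t
    unfolding \<eta>_def \<eta>'_def by (rule flat_1_bounds; assumption)+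
  have \<eta>_c: "continuous_on UNIV \<eta>" "continuous_on UNIV \<eta>'"
    unfolding \<eta>_def \<eta>'_def by (intro Ck_on_all_continuous Ck_on_flat)+
  have \<eta>_lip: "\<bar>\<eta> s - \<eta> t\<bar> \<le> 2 * \<bar>s - t\<bar>" for s t
    using field_differentiable_bound[of UNIV \<eta> \<eta>' 2 s t] \<eta> \<eta>'0 by (simp add: has_field_derivative_at_within)
  have Ck_diff: "Ck_on n (\<lambda>x. \<phi> k x + -1 * w x) UNIV" for n k
    by (intro Ck_on_add Ck_on_mult Ck_on_const test_Ck \<phi>(1) w(1))
  define \<zeta> where "\<zeta> k x = \<eta> (\<phi> k x + -1 * w x)" for k x
  have \<zeta>_test: "\<zeta> k \<in> \<T>" for k
  proof (rule test_functions_dominated[OF \<phi>(1)])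
    show "Ck_on n (\<zeta> k) UNIV" for n
      unfolding \<zeta>_def[abs_def] \<eta>_def by (rule Ck_on_compose[OF Ck_diff Ck_on_flat])
    show "\<zeta> k x = 0" if "\<phi> k x = 0" for x
      using that w(2)[of x] \<eta>0(3) by (simp add: \<zeta>_def)
  qed
  \<comment> \<open>Z is the gradient of the limit u - w, and \<open>E k\<close> below is the
    approximation error of \<open>grad (\<phi> k)\<close>. After testing, the term with Z twice is
    nonnegative because \<eta>' \<ge> 0 and is dropped; the term with \<open>E k\<close> tends to 0
    because \<eta>' \<le> 2.\<close>
  define Z where "Z x = U x - grad w x" for x
  define E where "E k x = grad (\<phi> k) x - U x" for k x
  define a where "a k x = \<eta>' (\<phi> k x + -1 * w x)" for k x
  have w1: "Ck_on 1 w UNIV" using w(1) .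
  note UL = FS_L2(2)[OF u] and uL = FS_L2(1)[OF u]
  have wL: "L2 M w" by (intro L2_continuous Ck_on_all_continuous w(1))
  have ZL: "L2 M Z" unfolding Z_def by (intro L2_diff UL L2_grad w1)
  have EL: "L2 M (E k)" for k unfolding E_def by (intro L2_diff UL L2_grad_test \<phi>(1))
  have a_m: "a k \<in> borel_measurable M" for k
    unfolding a_def
    by (intro measurable_continuous continuous_on_compose2[OF \<eta>_c(2)] Ck_on_all_continuous[OF Ck_diff]) simp
  have a_b: "\<bar>a k x\<bar> \<le> 2" for k x using \<eta>'0 by (simp add: a_def)
  have grad_\<zeta>: "grad (\<zeta> k) x = a k x *\<^sub>R (Z x + E k x)" for k x
  proof -
    have "(\<lambda>x. \<phi> k x + -1 * w x) differentiable (at x)" using Ck_diff[of 1 k] by simp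
    from grad_compose[OF this \<eta>]
    have "grad (\<zeta> k) x = a k x *\<^sub>R grad (\<lambda>x. \<phi> k x + -1 * w x) x" by (simp only: \<zeta>_def[abs_def] a_def)
    also have "grad (\<lambda>x. \<phi> k x + -1 * w x) x = grad (\<phi> k) x + -1 *\<^sub>R grad w x"
      by (rule grad_comb[OF test_diff[OF \<phi>(1)]]) (use w1 in simp)
    finally show ?thesis by (simp add: Z_def E_def)
  qed
  have aE: "L2 M (\<lambda>x. a k x *\<^sub>R E k x)" for k by (rule L2_mult_bounded[OF EL a_m a_b])
  have aZ: "L2 M (\<lambda>x. a k x *\<^sub>R Z x)" for k by (rule L2_mult_bounded[OF ZL a_m a_b])
  have le: "K * (\<integral>x. (u x - w x) * \<zeta> k x \<partial>M) \<le> - (\<integral>x. Z x \<bullet> (a k x *\<^sub>R E k x) \<partial>M)" for k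
  proof -
    have "(\<integral>x. Z x \<bullet> grad (\<zeta> k) x \<partial>M) = (\<integral>x. Z x \<bullet> (a k x *\<^sub>R Z x) \<partial>M) + (\<integral>x. Z x \<bullet> (a k x *\<^sub>R E k x) \<partial>M)"
      unfolding grad_\<zeta> scaleR_add_right inner_add_right
      by (rule Bochner_Integration.integral_add[OF L2_inner[OF ZL aZ] L2_inner[OF ZL aE]])
    moreover have "0 \<le> (\<integral>x. Z x \<bullet> (a k x *\<^sub>R Z x) \<partial>M)"
      using \<eta>'0 by (intro Bochner_Integration.integral_nonneg) (simp add: a_def)
    moreover have "(\<integral>x. Z x \<bullet> grad (\<zeta> k) x \<partial>M) + K * (\<integral>x. (u x - w x) * \<zeta> k x \<partial>M) \<le> 0"
      unfolding Z_def using \<eta>0(1) by (intro sub \<zeta>_test) (simp add: \<zeta>_def)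
    ultimately show ?thesis by linarith
  qed
  have err: "(\<lambda>k. \<integral>x. Z x \<bullet> (a k x *\<^sub>R E k x) \<partial>M) \<longlonglongrightarrow> 0"
  proof (rule tendsto_0_of_sq_le)
    fix k
    have "(\<integral>x. Z x \<bullet> (a k x *\<^sub>R E k x) \<partial>M)\<^sup>2 \<le> nsq M Z * nsq M (\<lambda>x. a k x *\<^sub>R E k x)"
      by (rule L2_Cauchy_Schwarz[OF ZL aE])
    also have "\<dots> \<le> nsq M Z * (2\<^sup>2 * nsq M (E k))"
      by (intro mult_left_mono nsq_mult_bounded_le[OF EL a_m a_b] nsq_nonneg)
    finally show "(\<integral>x. Z x \<bullet> (a k x *\<^sub>R E k x) \<partial>M)\<^sup>2 \<le> nsq M Z * (2\<^sup>2 * nsq M (E k))" .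
    have "(\<lambda>k. nsq M Z * (2\<^sup>2 * nsq M (E k))) \<longlonglongrightarrow> nsq M Z * (2\<^sup>2 * 0)"
      using \<phi>(3) unfolding L2lim_def E_def by (intro tendsto_intros) auto
    then show "(\<lambda>k. nsq M Z * (2\<^sup>2 * nsq M (E k))) \<longlonglongrightarrow> 0" by (simp only: mult_zero_right)
  qed
  define \<zeta>' where "\<zeta>' x = \<eta> (u x - w x)" for x
  have \<zeta>'_m: "\<zeta>' \<in> borel_measurable M"
    unfolding \<zeta>'_def using L2_measurable[OF L2_diff[OF uL wL]]
    by (rule borel_measurable_continuous_on[OF \<eta>_c(1)])
  have \<zeta>'L: "L2 M \<zeta>'"
  proof (rule L2_dominated[OF \<zeta>'_m])
    show "integrable M (\<lambda>x. 4 * (norm (u x - w x))\<^sup>2)" using L2_integrable[OF L2_diff[OF uL wL]] by simp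
    have "(\<zeta>' x)\<^sup>2 \<le> 4 * (u x - w x)\<^sup>2" for x
    proof -
      have "\<bar>\<zeta>' x\<bar> \<le> 2 * \<bar>u x - w x\<bar>" using \<eta>_lip[of "u x - w x" 0] \<eta>0(3)[of 0] by (simp add: \<zeta>'_def)
      then have "\<bar>\<zeta>' x\<bar>\<^sup>2 \<le> (2 * \<bar>u x - w x\<bar>)\<^sup>2" by (rule power_mono) simp
      then show ?thesis by (simp add: power_mult_distrib)
    qed
    then show "AE x in M. (norm (\<zeta>' x))\<^sup>2 \<le> 4 * (norm (u x - w x))\<^sup>2" by simp
  qed
  have "L2lim M \<zeta> \<zeta>'"
    unfolding L2lim_def
  proof (intro conjI allI \<zeta>'L L2_test \<zeta>_test)
    have b: "(\<lambda>k. 4 * nsq M (\<lambda>x. \<phi> k x - u x)) \<longlonglongrightarrow> 0"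
      using \<phi>(2) tendsto_mult_right_zero unfolding L2lim_def by blast
    show "(\<lambda>k. nsq M (\<lambda>x. \<zeta> k x - \<zeta>' x)) \<longlonglongrightarrow> 0"
    proof (rule nsq_tendsto_0[OF _ b])
      fix k
      have "(\<zeta> k x - \<zeta>' x)\<^sup>2 \<le> 4 * (\<phi> k x - u x)\<^sup>2" for x
      proof -
        have "\<bar>\<zeta> k x - \<zeta>' x\<bar> \<le> 2 * \<bar>\<phi> k x - u x\<bar>"
          using \<eta>_lip[of "\<phi> k x + -1 * w x" "u x - w x"] by (simp add: \<zeta>_def \<zeta>'_def)
        then have "\<bar>\<zeta> k x - \<zeta>' x\<bar>\<^sup>2 \<le> (2 * \<bar>\<phi> k x - u x\<bar>)\<^sup>2" by (rule power_mono) simp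
        then show ?thesis by (simp add: power_mult_distrib)
      qed
      then have "nsq M (\<lambda>x. \<zeta> k x - \<zeta>' x) \<le> (\<integral>x. 4 * (norm (\<phi> k x - u x))\<^sup>2 \<partial>M)"
        unfolding nsq_def
        by (intro integral_mono L2_integrable L2_diff L2_test \<zeta>_test \<zeta>'L integrable_mult_right \<phi>(1) uL) simp
      then show "nsq M (\<lambda>x. \<zeta> k x - \<zeta>' x) \<le> 4 * nsq M (\<lambda>x. \<phi> k x - u x)"
        by (simp add: nsq_def)
    qed
  qed
  then have "(\<lambda>k. K * (\<integral>x. (u x - w x) * \<zeta> k x \<partial>M)) \<longlonglongrightarrow> K * (\<integral>x. (u x - w x) * \<zeta>' x \<partial>M)"
    by (intro tendsto_mult tendsto_const L2lim_mult L2lim_const L2_diff uL wL)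
  then have "K * (\<integral>x. (u x - w x) * \<zeta>' x \<partial>M) \<le> - 0"
    using tendsto_minus[OF err] le by (intro LIMSEQ_le[of "\<lambda>k. K * (\<integral>x. (u x - w x) * \<zeta> k x \<partial>M)"]) auto
  then have int0: "(\<integral>x. (u x - w x) * \<zeta>' x \<partial>M) \<le> 0" using K by (simp add: mult_le_0_iff)
  have nn: "0 \<le> (u x - w x) * \<zeta>' x" for x
    using \<eta>0(1)[of "u x - w x"] \<eta>0(3)[of "u x - w x"] by (cases "u x \<le> w x") (auto simp: \<zeta>'_def)
  then have "(\<integral>x. (u x - w x) * \<zeta>' x \<partial>M) = 0"
    by (intro antisym int0 Bochner_Integration.integral_nonneg)
  then have "AE x in M. (u x - w x) * \<zeta>' x = 0"
    using integral_nonneg_eq_0_iff_AE[OF L2_mult_integrable[OF L2_diff[OF uL wL] \<zeta>'L]] nn by simp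
  then show ?thesis
  proof eventually_elim
    case (elim x)
    then show ?case using \<eta>0(2)[of "u x - w x"] by (cases "u x \<le> w x") (auto simp: \<zeta>'_def)
  qed
qed

text \<open>The difference u - v belongs to the energy closure, so \<open>weak_comparison\<close>
  applies to it with w = 0.\<close>

lemma comparison_of_solutions:
  assumes u: "weak_eq u U (\<lambda>x. h x - K * u x)" and v: "weak_eq v V (\<lambda>x. k x - K * v x)"
    and K: "K > 0" and h: "L2 M h" "L2 M k" and le: "AE x in M. h x \<le> k x"
  shows "AE x in M. u x \<le> v x"
proof -
  have d: "weak_eq (\<lambda>x. u x - v x) (\<lambda>x. U x - V x) (\<lambda>x. (h x - K * u x) - (k x - K * v x))"
    using weak_eq_comb[OF u v, of "-1"] by (simp only: mult_minus1 scaleR_minus1_left add_uminus_conv_diff)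
  have "AE x in M. u x - v x \<le> 0"
  proof (rule weak_comparison[OF weak_eqD(1)[OF d] _ _ K])
    show "Ck_on n (\<lambda>x::'a. 0::real) UNIV" for n by (rule Ck_on_const)
    fix \<zeta> assume \<zeta>: "\<zeta> \<in> \<T>" "\<And>x. 0 \<le> \<zeta> x"
    have g0: "grad (\<lambda>x. 0) x = 0" for x by (simp add: vec_eq_iff grad_nth)
    have i: "integrable M (\<lambda>x. (h x - k x) * \<zeta> x)" "integrable M (\<lambda>x. (u x - v x) * \<zeta> x)"
      by (intro L2_mult_integrable L2_diff h L2_test \<zeta>(1) weak_eqD(3)[OF u] weak_eqD(3)[OF v])+
    have "(\<integral>x. (U x - V x - grad (\<lambda>x. 0) x) \<bullet> grad \<zeta> x \<partial>M)
        = (\<integral>x. ((h x - K * u x) - (k x - K * v x)) * \<zeta> x \<partial>M)"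
      using weak_eqD(5)[OF d \<zeta>(1)] by (simp add: g0)
    also have "\<dots> = (\<integral>x. (h x - k x) * \<zeta> x - K * ((u x - v x) * \<zeta> x) \<partial>M)"
      by (simp add: algebra_simps)
    also have "\<dots> = (\<integral>x. (h x - k x) * \<zeta> x \<partial>M) - K * (\<integral>x. (u x - v x) * \<zeta> x \<partial>M)"
      using i by simp
    finally have eq: "(\<integral>x. (U x - V x - grad (\<lambda>x. 0) x) \<bullet> grad \<zeta> x \<partial>M) + K * (\<integral>x. (u x - v x - 0) * \<zeta> x \<partial>M)
      = (\<integral>x. (h x - k x) * \<zeta> x \<partial>M)" by simp
    have "(\<integral>x. (h x - k x) * \<zeta> x \<partial>M) \<le> (\<integral>x. 0 \<partial>M)"
      using le by (intro integral_mono_AE i) (auto elim!: eventually_mono intro: mult_nonpos_nonneg \<zeta>(2))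
    then show "(\<integral>x. (U x - V x - grad (\<lambda>x. 0) x) \<bullet> grad \<zeta> x \<partial>M) + K * (\<integral>x. (u x - v x - 0) * \<zeta> x \<partial>M) \<le> 0"
      unfolding eq by simp
  qed simp
  then show ?thesis by eventually_elim simp
qed

text \<open>The weak form of - \<Delta> w \<ge> s against nonnegative test functions. Boundary
  values of w enter only through w \<ge> 0, which is the condition that makes \<eta> (\<phi> - w) a
  test function.\<close>

definition barrier :: "real \<Rightarrow> ('a \<Rightarrow> real) \<Rightarrow> bool" where
  "barrier s w \<longleftrightarrow> (\<forall>k. Ck_on k w UNIV) \<and> (\<forall>x. 0 \<le> w x) \<and>
     (\<forall>\<zeta>\<in>\<T>. (\<forall>x. 0 \<le> \<zeta> x) \<longrightarrow> s * (\<integral>x. \<zeta> x \<partial>M) \<le> (\<integral>x. grad w x \<bullet> grad \<zeta> x \<partial>M))"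

text \<open>The assumption on h says that w is a supersolution of the equation (- \<Delta> + K) u =
  h solved by u.\<close>

lemma comparison_with_barrier:
  assumes u: "weak_eq u U (\<lambda>x. h x - K * u x)" and w: "barrier s w"
    and K: "K > 0" and h: "L2 M h" and le: "AE x in M. h x \<le> s + K * w x"
  shows "AE x in M. u x \<le> w x"
proof (rule weak_comparison[OF weak_eqD(1)[OF u] _ _ K])
  have wC: "Ck_on k w UNIV" and w0: "0 \<le> w x" for k x using w by (auto simp: barrier_def)
  show "Ck_on k w UNIV" "0 \<le> w x" for k x by (rule wC, rule w0)
  fix \<zeta> assume \<zeta>: "\<zeta> \<in> \<T>" "\<And>x. 0 \<le> \<zeta> x"
  note uL = weak_eqD(3)[OF u]
  have wL: "L2 M w" by (intro L2_continuous Ck_on_all_continuous wC)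
  have i: "integrable M (\<lambda>x. h x * \<zeta> x)" "integrable M (\<lambda>x. u x * \<zeta> x)" "integrable M (\<lambda>x. w x * \<zeta> x)"
    by (intro L2_mult_integrable h L2_test \<zeta>(1) uL wL)+
  have oneL: "L2 M (\<lambda>x. 1::real)" by (rule L2_continuous) simp
  have i1: "integrable M \<zeta>" using L2_mult_integrable[OF oneL L2_test[OF \<zeta>(1)]] by simp
  have "(\<integral>x. (U x - grad w x) \<bullet> grad \<zeta> x \<partial>M) = (\<integral>x. U x \<bullet> grad \<zeta> x \<partial>M) - (\<integral>x. grad w x \<bullet> grad \<zeta> x \<partial>M)"
    unfolding inner_diff_left
    by (intro Bochner_Integration.integral_diff L2_inner weak_eqD(4)[OF u] L2_grad_test \<zeta>(1) L2_grad wC)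
  also have "\<dots> \<le> (\<integral>x. (h x - K * u x) * \<zeta> x \<partial>M) - s * (\<integral>x. \<zeta> x \<partial>M)"
    using weak_eqD(5)[OF u \<zeta>(1)] w \<zeta> by (simp add: barrier_def)
  also have "(\<integral>x. (h x - K * u x) * \<zeta> x \<partial>M) = (\<integral>x. h x * \<zeta> x \<partial>M) - K * (\<integral>x. u x * \<zeta> x \<partial>M)"
    using i by (simp add: left_diff_distrib mult.assoc)
  finally have 1: "(\<integral>x. (U x - grad w x) \<bullet> grad \<zeta> x \<partial>M) \<le>
     (\<integral>x. h x * \<zeta> x \<partial>M) - K * (\<integral>x. u x * \<zeta> x \<partial>M) - s * (\<integral>x. \<zeta> x \<partial>M)" .
  have 2: "(\<integral>x. (u x - w x) * \<zeta> x \<partial>M) = (\<integral>x. u x * \<zeta> x \<partial>M) - (\<integral>x. w x * \<zeta> x \<partial>M)"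
    using i by (simp add: left_diff_distrib)
  have "(\<integral>x. h x * \<zeta> x \<partial>M) \<le> (\<integral>x. s * \<zeta> x + K * (w x * \<zeta> x) \<partial>M)"
  proof (rule integral_mono_AE)
    show "AE x in M. h x * \<zeta> x \<le> s * \<zeta> x + K * (w x * \<zeta> x)"
      using le
    proof eventually_elim
      case (elim x)
      have "h x * \<zeta> x \<le> (s + K * w x) * \<zeta> x" by (rule mult_right_mono[OF elim \<zeta>(2)])
      then show ?case by (simp add: algebra_simps)
    qed
  qed (use i i1 in auto)
  also have "\<dots> = s * (\<integral>x. \<zeta> x \<partial>M) + K * (\<integral>x. w x * \<zeta> x \<partial>M)" using i i1 by simp
  finally show "(\<integral>x. (U x - grad w x) \<bullet> grad \<zeta> x \<partial>M) + K * (\<integral>x. (u x - w x) * \<zeta> x \<partial>M) \<le> 0"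
    using 1 unfolding 2 right_diff_distrib by linarith
qed

text \<open>An approximating sequence that converges almost everywhere is composed with a smooth
  truncation T equal to the identity on [-B, B]. The gradients become T'(\<phi>_k)
  \<open>grad (\<phi> k)\<close>, and their limit T'(u) U is U because |u| \<le> B. The uniform
  bound is what later upgrades L^2 to L^q convergence.\<close>

lemma FS_bounded_approximation:
  assumes u: "FS u U" and B: "0 \<le> B" "AE x in M. \<bar>u x\<bar> \<le> B"
  shows "\<exists>\<phi> C. (\<forall>k. \<phi> k \<in> \<T>) \<and> (\<forall>k x. \<bar>\<phi> k x\<bar> \<le> C) \<and> L2lim M \<phi> u \<and> L2lim M (\<lambda>k. grad (\<phi> k)) U"
proof -
  obtain \<phi>0 where \<phi>0: "\<And>k. \<phi>0 k \<in> \<T>" "L2lim M \<phi>0 u" "L2lim M (\<lambda>k. grad (\<phi>0 k)) U"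
    using u unfolding FS_def by blast
  obtain r :: "nat \<Rightarrow> nat" where r: "strict_mono r" "AE x in M. (\<lambda>k. \<phi>0 (r k) x) \<longlonglongrightarrow> u x"
    using L2lim_AE_subseq[OF \<phi>0(2)] by blast
  define \<phi> where "\<phi> k = \<phi>0 (r k)" for k
  have \<phi>: "\<phi> k \<in> \<T>" "L2lim M (\<lambda>k. grad (\<phi> k)) U" "AE x in M. (\<lambda>k. \<phi> k x) \<longlonglongrightarrow> u x" for k
    using \<phi>0(1) r L2lim_subseq[OF \<phi>0(3) r(1)] by (auto simp: \<phi>_def)
  obtain T T' :: "real \<Rightarrow> real" and C where T: "\<And>k. Ck_on k T UNIV" "\<And>t. (T has_real_derivative T' t) (at t)"
     "continuous_on UNIV T'" "\<And>t. \<bar>T t\<bar> \<le> C" "\<And>t. \<bar>T' t\<bar> \<le> C" "\<And>t. \<bar>t\<bar> \<le> B \<Longrightarrow> T t = t" "\<And>t. \<bar>t\<bar> \<le> B \<Longrightarrow> T' t = 1"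
    using exists_smooth_truncation[OF B(1)] by metis
  define \<psi> where "\<psi> k x = T (\<phi> k x)" for k x
  have \<psi>: "\<psi> k \<in> \<T>" for k
  proof (rule test_functions_dominated[OF \<phi>(1)])
    show "Ck_on n (\<psi> k) UNIV" for n
      unfolding \<psi>_def[abs_def] by (rule Ck_on_compose[OF test_Ck[OF \<phi>(1)] T(1)])
    show "\<psi> k x = 0" if "\<phi> k x = 0" for x using that T(6)[of 0] B(1) by (simp add: \<psi>_def)
  qed
  have um: "u \<in> borel_measurable M" by (rule L2_measurable[OF FS_L2(1)[OF u]])
  have Tc: "continuous_on UNIV T" by (rule Ck_on_all_continuous[OF T(1)])
  have l1: "L2lim M \<psi> u"
  proof (rule L2lim_dominated[OF L2_measurable[OF L2_test[OF \<psi>]] um integrable_const[of "C\<^sup>2"]])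
    show "AE x in M. (\<lambda>k. \<psi> k x) \<longlonglongrightarrow> u x"
      using \<phi>(3) B(2)
    proof eventually_elim
      case (elim x)
      have "(\<lambda>k. T (\<phi> k x)) \<longlonglongrightarrow> T (u x)"
        by (rule continuous_on_tendsto_compose[OF Tc elim(1)]) auto
      then show ?case using T(6)[OF elim(2)] by (simp add: \<psi>_def)
    qed
    show "AE x in M. (norm (\<psi> k x))\<^sup>2 \<le> C\<^sup>2" for k
      using power_mono[OF T(4) abs_ge_zero, of _ 2] by (simp add: \<psi>_def)
  qed
  have "L2lim M (\<lambda>k x. T' (\<phi> k x) *\<^sub>R grad (\<phi> k) x) (\<lambda>x. T' (u x) *\<^sub>R U x)"
  proof (rule L2lim_mult_bounded[OF \<phi>(2) _ T(5)])
    show "(\<lambda>x. T' (\<phi> k x)) \<in> borel_measurable M" for k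
      by (rule borel_measurable_continuous_on[OF T(3) L2_measurable[OF L2_test[OF \<phi>(1)]]])
    show "(\<lambda>x. T' (u x)) \<in> borel_measurable M"
      by (rule borel_measurable_continuous_on[OF T(3) um])
    show "AE x in M. (\<lambda>k. T' (\<phi> k x)) \<longlonglongrightarrow> T' (u x)"
      using \<phi>(3) by eventually_elim (rule continuous_on_tendsto_compose[OF T(3)], auto)
  qed
  moreover have "AE x in M. T' (u x) *\<^sub>R U x = U x"
    using B(2) by eventually_elim (simp add: T(7))
  ultimately have "L2lim M (\<lambda>k x. T' (\<phi> k x) *\<^sub>R grad (\<phi> k) x) U"
    using L2lim_cong_AE L2_measurable[OF FS_L2(2)[OF u]] by blast
  moreover have "grad (\<psi> k) = (\<lambda>x. T' (\<phi> k x) *\<^sub>R grad (\<phi> k) x)" for k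
    unfolding \<psi>_def[abs_def] by (intro ext grad_compose test_diff \<phi>(1) T(2))
  ultimately have l2: "L2lim M (\<lambda>k. grad (\<psi> k)) U" by simp
  show ?thesis using \<psi> l1 l2 T(4) by (intro exI[of _ \<psi>] exI[of _ C]) (simp add: \<psi>_def)
qed

end

section \<open>Barriers and monotone iteration\<close>

text \<open>The infimal convolution with (n + 1) |t| is the largest (n + 1)-Lipschitz minorant of f:
  the Lipschitz bound makes F n t + (n + 1) t nondecreasing, and a larger constant gives a larger
  minorant. In the last clause the argument moves with n, because it will be a sequence of solutions
  at a fixed point.\<close>

lemma inf_convolution:
  fixes f :: "real \<Rightarrow> real"
  assumes cont: "continuous_on UNIV f" and bd: "\<And>t. \<bar>f t\<bar> \<le> s"
  shows "\<exists>F :: nat \<Rightarrow> real \<Rightarrow> real. (\<forall>n t. \<bar>F n t\<bar> \<le> s) \<and>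
    (\<forall>n a b. a \<le> b \<longrightarrow> F n a + real (Suc n) * a \<le> F n b + real (Suc n) * b) \<and>
    (\<forall>n. continuous_on UNIV (F n)) \<and> (\<forall>n t. F n t \<le> F (Suc n) t) \<and>
    (\<forall>x t. x \<longlonglongrightarrow> t \<longrightarrow> (\<lambda>n. F n (x n)) \<longlonglongrightarrow> f t)"
proof -
  define F where "F n t = (INF y. f y + real (Suc n) * \<bar>t - y\<bar>)" for n t
  have lb: "- s \<le> f y + real (Suc n) * \<bar>t - y\<bar>" for n t y
    using bd[of y] mult_nonneg_nonneg[of "real (Suc n)" "\<bar>t - y\<bar>"] by linarith
  have bdd: "bdd_below (range (\<lambda>y. f y + real (Suc n) * \<bar>t - y\<bar>))" for n t
    by (rule bdd_belowI2[OF lb])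
  have lower: "F n t \<le> f y + real (Suc n) * \<bar>t - y\<bar>" for n t y
    unfolding F_def by (rule cINF_lower[OF bdd]) simp
  have greatest: "c \<le> F n t" if "\<And>y. c \<le> f y + real (Suc n) * \<bar>t - y\<bar>" for c n t
    unfolding F_def by (rule cINF_greatest) (use that in auto)
  have le_f: "F n t \<le> f t" for n t using lower[of n t t] by simp
  have ge: "- s \<le> F n t" for n t by (rule greatest[OF lb])
  have b: "\<bar>F n t\<bar> \<le> s" for n t using le_f[of n t] ge[of n t] bd[of t] by linarith
  have lip: "F n t \<le> F n t' + real (Suc n) * \<bar>t - t'\<bar>" for n t t'
  proof -
    have "F n t - real (Suc n) * \<bar>t - t'\<bar> \<le> F n t'"
    proof (rule greatest)
      fix y
      have "real (Suc n) * \<bar>t - y\<bar> \<le> real (Suc n) * (\<bar>t - t'\<bar> + \<bar>t' - y\<bar>)"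
        by (intro mult_left_mono) auto
      then show "F n t - real (Suc n) * \<bar>t - t'\<bar> \<le> f y + real (Suc n) * \<bar>t' - y\<bar>"
        using lower[of n t y] unfolding distrib_left by linarith
    qed
    then show ?thesis by simp
  qed
  have mono: "F n a + real (Suc n) * a \<le> F n b + real (Suc n) * b" if "a \<le> b" for n a b
    using lip[of n a b] that by (simp add: algebra_simps)
  have cF: "continuous_on UNIV (F n)" for n
  proof (rule lipschitz_on_continuous_on[of "real (Suc n)"], rule lipschitz_onI)
    show "dist (F n t) (F n t') \<le> real (Suc n) * dist t t'" for t t'
      using lip[of n t t'] lip[of n t' t] unfolding dist_real_def abs_minus_commute[of t' t] by linarith
  qed simp
  have Suc: "F n t \<le> F (Suc n) t" for n t
  proof (rule greatest)
    fix y
    have "real (Suc n) * \<bar>t - y\<bar> \<le> real (Suc (Suc n)) * \<bar>t - y\<bar>" by (intro mult_right_mono) auto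
    then show "F n t \<le> f y + real (Suc (Suc n)) * \<bar>t - y\<bar>" using lower[of n t y] by linarith
  qed
  have lim: "(\<lambda>n. F n (x n)) \<longlonglongrightarrow> f t" if x: "x \<longlonglongrightarrow> t" for x t
  proof (rule LIMSEQ_I)
    fix e :: real assume e: "e > 0"
    have "isCont f t" using cont by (simp add: continuous_on_eq_continuous_at)
    then obtain d where d: "d > 0" "\<And>y. \<bar>y - t\<bar> < d \<Longrightarrow> \<bar>f y - f t\<bar> < e / 2"
      using e unfolding continuous_at_eps_delta dist_real_def by (metis half_gt_zero)
    obtain N1 where N1: "\<And>n. n \<ge> N1 \<Longrightarrow> \<bar>x n - t\<bar> < d / 2"
      using LIMSEQ_D[OF x, of "d / 2"] d(1) by auto
    \<comment> \<open>A point y at distance at least d from t has distance at least d / 2 from x n,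
      so its penalty exceeds 2 s, the largest possible oscillation of f. Only y near t matter for
      the infimum.\<close>
    obtain N2 where N2: "4 * s / d < real N2" using reals_Archimedean2 by blast
    have "\<bar>F n (x n) - f t\<bar> < e" if n: "n \<ge> max N1 N2" for n
    proof -
      have xn: "\<bar>x n - t\<bar> < d / 2" using N1 n by simp
      have "f t - e / 2 \<le> F n (x n)"
      proof (rule greatest)
        fix y
        show "f t - e / 2 \<le> f y + real (Suc n) * \<bar>x n - y\<bar>"
        proof (cases "\<bar>y - t\<bar> < d")
          case True
          then show ?thesis using d(2)[OF True] mult_nonneg_nonneg[of "real (Suc n)" "\<bar>x n - y\<bar>"] by linarith
        next
          case False
          then have "d / 2 \<le> \<bar>x n - y\<bar>" using xn by linarith
          moreover have "4 * s / d < real (Suc n)" using N2 n by simp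
          then have "4 * s < real (Suc n) * d" using d(1) by (simp add: divide_less_eq)
          ultimately have "2 * s \<le> real (Suc n) * \<bar>x n - y\<bar>"
            using mult_left_mono[of "d / 2" "\<bar>x n - y\<bar>" "real (Suc n)"] by (simp add: field_simps)
          then show ?thesis using bd[of t] bd[of y] e by linarith
        qed
      qed
      moreover have "F n (x n) \<le> f (x n)" by (rule le_f)
      moreover have "\<bar>f (x n) - f t\<bar> < e / 2" using xn d by (intro d(2)) linarith
      ultimately show ?thesis using e by linarith
    qed
    then show "\<exists>no. \<forall>n\<ge>no. norm (F n (x n) - f t) < e"
      by (intro exI[of _ "max N1 N2"]) simp
  qed
  show ?thesis using b mono cF Suc lim by blast
qed

context horizontal_frame
begin

lemma barrierD:
  assumes "barrier s w"
  shows "Ck_on k w UNIV" "0 \<le> w x" "L2 M w"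
proof -
  show C: "Ck_on k w UNIV" for k using assms by (simp add: barrier_def)
  show "0 \<le> w x" using assms by (simp add: barrier_def)
  show "L2 M w" by (intro L2_continuous Ck_on_all_continuous C)
qed

lemma barrier_scale:
  assumes w: "barrier s w" and t: "t \<ge> 0"
  shows "barrier (t * s) (\<lambda>x. t * w x)"
  unfolding barrier_def
proof (intro conjI allI ballI impI)
  show "Ck_on k (\<lambda>x. t * w x) UNIV" for k by (intro Ck_on_mult Ck_on_const barrierD[OF w])
  show "0 \<le> t * w x" for x using t barrierD(2)[OF w] by simp
  fix \<zeta> assume \<zeta>: "\<zeta> \<in> \<T>" "\<forall>x. 0 \<le> \<zeta> x"
  have "((\<lambda>y. t * y) has_real_derivative t) (at y)" for y by (auto intro!: derivative_eq_intros)
  from grad_compose[OF _ this] have "grad (\<lambda>x. t * w x) x = t *\<^sub>R grad w x" for x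
    using barrierD(1)[OF w, of 1] by simp
  moreover have "t * (s * (\<integral>x. \<zeta> x \<partial>M)) \<le> t * (\<integral>x. grad w x \<bullet> grad \<zeta> x \<partial>M)"
    using w \<zeta> t unfolding barrier_def by (intro mult_left_mono) auto
  ultimately show "t * s * (\<integral>x. \<zeta> x \<partial>M) \<le> (\<integral>x. grad (\<lambda>x. t * w x) x \<bullet> grad \<zeta> x \<partial>M)" by simp
qed

text \<open>The barrier is \<open>L (C - exp (\<kappa> x\<^sub>b))\<close> near \<open>D\<close>: one field has a constant nonzero
  \<open>b\<close>-component, so the \<open>\<kappa>\<^sup>2\<close> term dominates the divergence of the fields for large \<open>\<kappa>\<close>.
  Truncating the coordinate \<open>x\<^sub>b\<close> outside \<open>D\<close> keeps the barrier nonnegative everywhere.\<close>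

lemma barrier_exists:
  assumes b: "b \<in> Basis" and c: "c \<noteq> 0" "\<And>x. X j0 x \<bullet> b = c"
  shows "\<exists>w C. barrier 1 w \<and> (\<forall>x. w x \<le> C)"
proof -
  obtain R where R: "\<And>x. x \<in> D \<Longrightarrow> norm x \<le> R" using bounded_D bounded_iff by blast
  define R' where "R' = max R 0"
  have R': "\<bar>x \<bullet> b\<bar> \<le> R'" if "x \<in> D" for x
    using R[OF that] Basis_le_norm[OF b, of x] unfolding R'_def by linarith
  obtain T T' :: "real \<Rightarrow> real" and C1 where T: "\<And>k. Ck_on k T UNIV" "\<And>t. (T has_real_derivative T' t) (at t)"
     "\<And>t. \<bar>T t\<bar> \<le> C1" "\<And>t. \<bar>t\<bar> \<le> R' \<Longrightarrow> T' t = 1"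
    using exists_smooth_truncation[of R'] unfolding R'_def by (metis max.cobounded2)
  \<comment> \<open>On D, the pairing of the horizontal gradients of exp (\<kappa> x_b) and \<zeta>
    is the derivative of \<zeta> along \<kappa> exp (\<kappa> x_b) A. Thus a single integration by
    parts, for the field Y below, handles the whole sum of squares.\<close>
  define A where "A x = (\<Sum>j\<in>UNIV. (X j x \<bullet> b) *\<^sub>R X j x)" for x
  have A: "Ck_on 1 A UNIV"
    unfolding A_def[abs_def] by (intro Ck_on_sum Ck_on_scaleR C1_X Ck_on_linear[OF C1_X bounded_linear_inner_left])
  have Ab: "c\<^sup>2 \<le> A x \<bullet> b" for x
  proof -
    have "A x \<bullet> b = (\<Sum>j\<in>UNIV. (X j x \<bullet> b)\<^sup>2)" by (simp add: A_def inner_sum_left power2_eq_square)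
    moreover have "(X j0 x \<bullet> b)\<^sup>2 \<le> (\<Sum>j\<in>UNIV. (X j x \<bullet> b)\<^sup>2)" by (rule member_le_sum) auto
    ultimately show ?thesis using c(2) by simp
  qed
  obtain B where B0: "\<forall>x\<in>closure D. norm (divergence A x) \<le> B"
    using continuous_bounded_on_compact[OF _ continuous_on_divergence[OF A], of "closure D"] bounded_D by auto
  have B: "- B \<le> divergence A x" if "x \<in> D" for x
  proof -
    have "x \<in> closure D" using that closure_subset by blast
    then have "norm (divergence A x) \<le> B" using B0 by blast
    then show ?thesis by (simp add: abs_le_iff)
  qed
  \<comment> \<open>Chosen so that div A + \<kappa> (A \<bullet> b) \<ge> -B + \<kappa> c^2 \<ge> 1
    on D; also \<kappa> \<ge> 1 for the estimates with T.\<close>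
  define \<kappa> where "\<kappa> = max 1 ((B + 1) / c\<^sup>2)"
  have \<kappa>: "\<kappa> \<ge> 1" "\<kappa> * c\<^sup>2 \<ge> B + 1"
  proof -
    show "\<kappa> \<ge> 1" by (simp add: \<kappa>_def)
    have "(B + 1) / c\<^sup>2 \<le> \<kappa>" by (simp add: \<kappa>_def)
    then show "\<kappa> * c\<^sup>2 \<ge> B + 1" using c(1) by (simp add: divide_le_eq)
  qed
  define h where "h x = exp (\<kappa> * T (x \<bullet> b))" for x :: 'a
  \<comment> \<open>As |T| \<le> C1, the exponential h lies between 1 / L and L. The upper bound
    makes w = L (L - h) nonnegative, and L h \<ge> 1 yields the constant 1 of the barrier.\<close>
  define L where "L = exp (\<kappa> * C1)"
  define w where "w x = L * L + (- L) * h x" for x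
  have Ckh: "Ck_on k h UNIV" for k
    unfolding h_def[abs_def]
    by (intro Ck_on_compose[OF _ Ck_on_exp] Ck_on_mult Ck_on_const Ck_on_compose[OF _ T(1)]
        Ck_on_linear[OF Ck_on_ident bounded_linear_inner_left])
  have Ckw: "Ck_on k w UNIV" for k
    unfolding w_def[abs_def] by (intro Ck_on_add Ck_on_mult Ck_on_const Ckh)
  have hL: "h x \<le> L" for x
    using T(3)[of "x \<bullet> b"] \<kappa>(1) unfolding h_def L_def by (simp add: abs_le_iff)
  have hL': "1 \<le> L * h x" for x
  proof -
    have "0 \<le> \<kappa> * (C1 + T (x \<bullet> b))" using T(3)[of "x \<bullet> b"] \<kappa>(1) by (intro mult_nonneg_nonneg) auto
    then have "1 \<le> exp (\<kappa> * C1 + \<kappa> * T (x \<bullet> b))" unfolding distrib_left by simp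
    then show ?thesis by (simp add: L_def h_def exp_add)
  qed
  have L0: "L > 0" and h0: "h x > 0" for x by (auto simp: L_def h_def)
  have w0: "0 \<le> w x" for x using mult_left_mono[OF hL[of x], of L] L0 by (simp add: w_def)
  have wC: "w x \<le> L * L" for x using L0 h0[of x] by (simp add: w_def)
  have dh: "(h has_derivative (\<lambda>v. (h x * (\<kappa> * T' (x \<bullet> b))) * (v \<bullet> b))) (at x)" for x
  proof -
    have "((\<lambda>t. exp (\<kappa> * T t)) has_real_derivative exp (\<kappa> * T t) * (\<kappa> * T' t)) (at t)" for t
      by (intro DERIV_chain2[OF DERIV_exp] DERIV_cmult T(2))
    then have "((\<lambda>t. exp (\<kappa> * T t)) has_derivative (*) (h x * (\<kappa> * T' (x \<bullet> b)))) (at (x \<bullet> b))"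
      unfolding has_field_derivative_def h_def .
    from has_derivative_compose[OF bounded_linear_imp_has_derivative[OF bounded_linear_inner_left] this]
    show ?thesis unfolding h_def[abs_def] .
  qed
  note fh = fderiv_eqI[OF dh]
  have fw: "fderiv w x v = - L * fderiv h x v" for x v
  proof -
    have "(w has_derivative (\<lambda>v. 0 + (- L) * fderiv h x v)) (at x)"
      unfolding w_def[abs_def]
      by (intro has_derivative_add has_derivative_const has_derivative_mult_right frechet_derivative_works[THEN iffD1]
          differentiableI[OF dh])
    from fderiv_eqI[OF this] show ?thesis by simp
  qed
  define Y where "Y x = h x *\<^sub>R A x" for x
  have Y: "Ck_on 1 Y UNIV" unfolding Y_def[abs_def] by (intro Ck_on_scaleR Ckh A)
  have divY: "h x \<le> divergence Y x" if x: "x \<in> D" for x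
  proof -
    have "divergence Y x = h x * divergence A x + fderiv h x (A x)"
      unfolding Y_def[abs_def] using Ckh[of 1] A by (intro divergence_scaleR) auto
    also have "\<dots> = h x * (divergence A x + \<kappa> * (A x \<bullet> b))"
      unfolding fh T(4)[OF R'[OF x]] by (simp add: algebra_simps)
    finally have eq: "divergence Y x = h x * (divergence A x + \<kappa> * (A x \<bullet> b))" .
    have "\<kappa> * c\<^sup>2 \<le> \<kappa> * (A x \<bullet> b)" using \<kappa>(1) by (intro mult_left_mono Ab) auto
    then have "1 \<le> divergence A x + \<kappa> * (A x \<bullet> b)" using B[OF x] \<kappa>(2) by linarith
    then have "h x * 1 \<le> h x * (divergence A x + \<kappa> * (A x \<bullet> b))"
      using h0[of x] by (intro mult_left_mono) auto
    then show ?thesis unfolding eq by simp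
  qed
  have "barrier 1 w"
    unfolding barrier_def
  proof (intro conjI allI ballI impI Ckw w0)
    fix \<zeta> assume \<zeta>: "\<zeta> \<in> \<T>" "\<forall>x. 0 \<le> \<zeta> x"
    have oneL: "L2 M (\<lambda>x. 1::real)" by (rule L2_continuous) simp
    have dL: "L2 M (divergence Y)" by (intro L2_continuous continuous_on_divergence Y)
    have i: "integrable M \<zeta>" "integrable M (\<lambda>x. \<zeta> x * divergence Y x)"
      using L2_mult_integrable[OF oneL L2_test[OF \<zeta>(1)]] L2_mult_integrable[OF L2_test[OF \<zeta>(1)] dL] by auto
    have pt: "grad w x \<bullet> grad \<zeta> x = - (L * \<kappa>) * fderiv \<zeta> x (Y x)" if x: "x \<in> D" for x
    proof -
      note lin = linear_frechet_derivative[OF test_diff[OF \<zeta>(1)], of x]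
      have "fderiv \<zeta> x (Y x) = h x * (\<Sum>j\<in>UNIV. (X j x \<bullet> b) * fderiv \<zeta> x (X j x))"
        unfolding Y_def A_def by (simp add: linear_scale[OF lin] linear_sum[OF lin])
      moreover have "grad w x \<bullet> grad \<zeta> x = (\<Sum>j\<in>UNIV. (- L * (h x * \<kappa> * (X j x \<bullet> b))) * fderiv \<zeta> x (X j x))"
        unfolding inner_vec_def grad_nth fw fh T(4)[OF R'[OF x]] by simp
      ultimately show ?thesis by (simp add: sum_distrib_left mult.assoc mult.left_commute sum_negf)
    qed
    have "(\<integral>x. \<zeta> x \<partial>M) \<le> (\<integral>x. (L * \<kappa>) * (\<zeta> x * divergence Y x) \<partial>M)"
    proof (rule integral_mono[OF i(1)])
      show "integrable M (\<lambda>x. (L * \<kappa>) * (\<zeta> x * divergence Y x))" using i(2) by simp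
      fix x assume "x \<in> space M"
      then have x: "x \<in> D" by (simp add: space_restrict_space)
      have "1 * 1 \<le> \<kappa> * (L * h x)" using \<kappa>(1) hL'[of x] by (intro mult_mono) auto
      also have "\<dots> \<le> \<kappa> * (L * divergence Y x)"
        using \<kappa>(1) L0 divY[OF x] by (intro mult_left_mono) auto
      finally have "\<zeta> x * 1 \<le> \<zeta> x * (\<kappa> * (L * divergence Y x))" using \<zeta>(2) by (intro mult_left_mono) auto
      then show "\<zeta> x \<le> (L * \<kappa>) * (\<zeta> x * divergence Y x)" by (simp add: ac_simps)
    qed
    also have "\<dots> = (L * \<kappa>) * (\<integral>x. \<zeta> x * divergence Y x \<partial>M)" by simp
    also have "\<dots> = - (L * \<kappa>) * (\<integral>x. fderiv \<zeta> x (Y x) \<partial>M)"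
      using test_integral_by_parts[OF \<zeta>(1) Y] by simp
    also have "\<dots> = (\<integral>x. - (L * \<kappa>) * fderiv \<zeta> x (Y x) \<partial>M)" by simp
    also have "\<dots> = (\<integral>x. grad w x \<bullet> grad \<zeta> x \<partial>M)"
      using pt by (intro Bochner_Integration.integral_cong) (auto simp: space_restrict_space)
    finally show "1 * (\<integral>x. \<zeta> x \<partial>M) \<le> (\<integral>x. grad w x \<bullet> grad \<zeta> x \<partial>M)" by simp
  qed
  with wC show ?thesis by blast
qed

lemma weak_eq_minus: "weak_eq u U h \<Longrightarrow> weak_eq (\<lambda>x. - u x) (\<lambda>x. - U x) (\<lambda>x. - h x)"
  using weak_eq_comb[of u U h u U h "-2"]
  by (simp add: scaleR_2 flip: mult_2)

lemma monotone_limit: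
  fixes u :: "nat \<Rightarrow> 'a \<Rightarrow> real"
  assumes u: "\<And>n. u n \<in> borel_measurable M" "\<And>n. AE x in M. \<bar>u n x\<bar> \<le> C"
    and mono: "\<And>n. AE x in M. u n x \<le> u (Suc n) x"
  shows "\<exists>v. L2lim M u v \<and> (AE x in M. (\<lambda>n. u n x) \<longlonglongrightarrow> v x \<and> (\<forall>n. u n x \<le> v x))"
proof -
  define v where "v x = lim (\<lambda>n. u n x)" for x
  have v: "v \<in> borel_measurable M" unfolding v_def by (intro borel_measurable_lim_metric u)
  have all: "AE x in M. \<forall>n. \<bar>u n x\<bar> \<le> C \<and> u n x \<le> u (Suc n) x"
    using u(2) mono by (simp add: AE_all_countable)
  then have lim: "AE x in M. (\<lambda>n. u n x) \<longlonglongrightarrow> v x \<and> (\<forall>n. u n x \<le> v x)"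
  proof eventually_elim
    case (elim x)
    have inc: "incseq (\<lambda>n. u n x)" using elim by (intro incseq_SucI) simp
    obtain l where l: "(\<lambda>n. u n x) \<longlonglongrightarrow> l" "\<forall>i. u i x \<le> l"
      by (rule incseq_convergent[OF inc, of C]) (use elim abs_le_iff in blast)
    then have "v x = l" unfolding v_def by (intro limI)
    with l show ?case by simp
  qed
  have "L2lim M u v"
  proof (rule L2lim_dominated[OF u(1) v integrable_const[of "C\<^sup>2"]])
    show "AE x in M. (\<lambda>n. u n x) \<longlonglongrightarrow> v x" using lim by eventually_elim simp
    show "AE x in M. (norm (u n x))\<^sup>2 \<le> C\<^sup>2" for n
      using u(2)[of n] by eventually_elim (metis abs_ge_zero power_mono real_norm_def)
  qed
  with lim show ?thesis by blast
qed

text \<open>Assumption \<open>sub\<close> encodes that u0 is a subsolution: every solution of the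
  first linear step lies above it. In this form it covers both -w, which need not vanish on the
  boundary, and a solution of a previous problem.\<close>

lemma monotone_iteration:
  fixes f :: "real \<Rightarrow> real"
  assumes f: "continuous_on UNIV f" "\<And>t. \<bar>f t\<bar> \<le> s" and K: "K > 0"
    and mono: "\<And>a b. a \<le> b \<Longrightarrow> f a + K * a \<le> f b + K * b"
    and w: "barrier s w" "\<And>x. w x \<le> C"
    and u0: "u0 \<in> borel_measurable M" "AE x in M. - w x \<le> u0 x \<and> u0 x \<le> w x"
    and sub: "\<And>v V. weak_eq v V (\<lambda>x. (f (u0 x) + K * u0 x) - K * v x) \<Longrightarrow> AE x in M. u0 x \<le> v x"
  shows "\<exists>u U. weak_eq u U (\<lambda>x. f (u x)) \<and> (AE x in M. u0 x \<le> u x \<and> u x \<le> w x)"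
proof -
  have absw: "\<bar>t\<bar> \<le> C" if "- w x \<le> t" "t \<le> w x" for t x using that w(2)[of x] by linarith
  have f_m: "(\<lambda>x. f (v x)) \<in> borel_measurable M" if "v \<in> borel_measurable M" for v
    using that by (rule borel_measurable_continuous_on[OF f(1)])
  have f_L2: "L2 M (\<lambda>x. f (v x))" if "v \<in> borel_measurable M" for v
    by (rule L2_bounded[OF f_m[OF that], where C = s]) (simp add: f(2))
  have g_L2: "L2 M (\<lambda>x. f (v x) + K * v x)" if "L2 M v" for v
    by (intro L2_add L2_mult that f_L2 L2_measurable[OF that])
  have u0_L2: "L2 M u0"
  proof (rule L2_bounded[OF u0(1)])
    show "AE x in M. norm (u0 x) \<le> C"
      using u0(2) unfolding real_norm_def by eventually_elim (blast intro: absw)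
  qed
  define nxt where "nxt v = (SOME u. \<exists>U. weak_eq u U (\<lambda>x. (f (v x) + K * v x) - K * u x))" for v
  have nxt: "\<exists>U. weak_eq (nxt v) U (\<lambda>x. (f (v x) + K * v x) - K * nxt v x)" if "L2 M v" for v
    unfolding nxt_def using someI_ex[OF linear_solvable[OF K g_L2[OF that]]] .
  define u where "u n = (nxt ^^ n) u0" for n
  have u_0: "u 0 = u0" and u_Suc: "u (Suc n) = nxt (u n)" for n by (simp_all add: u_def)
  have uL: "L2 M (u n)" for n
  proof (induction n)
    case 0 then show ?case using u0_L2 u_0 by simp
  next
    case (Suc n) then show ?case using nxt[OF Suc] weak_eqD(3) unfolding u_Suc by blast
  qed
  have "\<forall>n. \<exists>U. weak_eq (u (Suc n)) U (\<lambda>x. (f (u n x) + K * u n x) - K * u (Suc n) x)"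
    unfolding u_Suc by (intro allI nxt uL)
  from choice[OF this] obtain U
    where U: "\<And>n. weak_eq (u (Suc n)) (U n) (\<lambda>x. (f (u n x) + K * u n x) - K * u (Suc n) x)" by blast
  have uw: "AE x in M. u n x \<le> w x" for n
  proof (induction n)
    case 0
    show ?case using u0(2) unfolding u_0 by eventually_elim simp
  next
    case (Suc n)
    show ?case
    proof (rule comparison_with_barrier[OF U w(1) K g_L2[OF uL]])
      show "AE x in M. f (u n x) + K * u n x \<le> s + K * w x"
        using Suc
      proof eventually_elim
        case (elim x)
        have "f (u n x) \<le> s" using f(2)[of "u n x"] by linarith
        moreover have "K * u n x \<le> K * w x" using K elim by (intro mult_left_mono) auto
        ultimately show ?case by (rule add_mono)
      qed
    qed
  qed
  \<comment> \<open>Only the first step uses \<open>sub\<close>; afterwards monotonicity of f t + K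
    t orders the right hand sides.\<close>
  have inc: "AE x in M. u n x \<le> u (Suc n) x" for n
  proof (induction n)
    case 0
    show ?case using sub[OF U[of 0, unfolded u_0]] unfolding u_0 .
  next
    case (Suc n)
    show ?case
    proof (rule comparison_of_solutions[OF U[of n] U[of "Suc n"] K g_L2[OF uL] g_L2[OF uL]])
      show "AE x in M. f (u n x) + K * u n x \<le> f (u (Suc n) x) + K * u (Suc n) x"
        using Suc by eventually_elim (rule mono)
    qed
  qed
  have u0u: "AE x in M. u0 x \<le> u n x" for n
  proof (induction n)
    case (Suc n) show ?case using Suc inc[of n] by eventually_elim simp
  qed (simp add: u_0)
  have bound: "AE x in M. \<bar>u n x\<bar> \<le> C" for n
    using u0u[of n] uw[of n] u0(2)
  proof eventually_elim
    case (elim x) then show ?case by (intro absw[of x]) linarith+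
  qed
  obtain v where v: "L2lim M u v" "AE x in M. (\<lambda>n. u n x) \<longlonglongrightarrow> v x \<and> (\<forall>n. u n x \<le> v x)"
    using monotone_limit[of u C, OF L2_measurable[OF uL] bound inc] by blast
  have vm: "v \<in> borel_measurable M" by (rule L2_measurable[OF L2lim_L2[OF v(1)]])
  \<comment> \<open>The right hand side of the n-th linear problem. Since \<open>u n\<close> and
    \<open>u (Suc n)\<close> have the same limit, the terms with K cancel in the limit.\<close>
  define h where "h n x = (f (u n x) + K * u n x) - K * u (Suc n) x" for n x
  have h: "L2lim M h (\<lambda>x. f (v x))"
  proof (rule L2lim_dominated[OF _ f_m[OF vm] integrable_const[of "(s + 2 * K * C)\<^sup>2"]])
    show "h n \<in> borel_measurable M" for n
      unfolding h_def by (intro L2_measurable L2_diff g_L2 L2_mult uL)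
    show "AE x in M. (\<lambda>n. h n x) \<longlonglongrightarrow> f (v x)"
      using v(2)
    proof eventually_elim
      case (elim x)
      then have l: "(\<lambda>n. u n x) \<longlonglongrightarrow> v x" by simp
      have "(\<lambda>n. (f (u n x) + K * u n x) - K * u (Suc n) x) \<longlonglongrightarrow> (f (v x) + K * v x) - K * v x"
        by (intro tendsto_intros continuous_on_tendsto_compose[OF f(1) l] l LIMSEQ_Suc[OF l]) auto
      then show ?case by (simp add: h_def)
    qed
    show "AE x in M. (norm (h n x))\<^sup>2 \<le> (s + 2 * K * C)\<^sup>2" for n
      using bound[of n] bound[of "Suc n"]
    proof eventually_elim
      case (elim x)
      have "\<bar>K * u n x\<bar> \<le> K * C" "\<bar>K * u (Suc n) x\<bar> \<le> K * C"
        using elim K by (auto simp: abs_mult intro!: mult_left_mono)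
      then have "\<bar>h n x\<bar> \<le> s + 2 * K * C" using f(2)[of "u n x"] unfolding h_def by linarith
      then show ?case unfolding real_norm_def by (intro power_mono) auto
    qed
  qed
  have "L2lim M (\<lambda>n. u (Suc n)) v"
    using L2lim_subseq[OF v(1), of Suc] by (simp add: strict_mono_Suc_iff)
  from weak_eq_limit[OF U[folded h_def] this h]
  obtain V where V: "weak_eq v V (\<lambda>x. f (v x))" by blast
  have "AE x in M. \<forall>n. u n x \<le> w x" using uw by (simp add: AE_all_countable)
  with v(2) have "AE x in M. u0 x \<le> v x \<and> v x \<le> w x"
  proof eventually_elim
    case (elim x)
    have "u0 x \<le> v x" using elim u_0 by metis
    moreover have "v x \<le> w x" using elim by (intro LIMSEQ_le_const2[of "\<lambda>n. u n x"]) auto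
    ultimately show ?case by blast
  qed
  with V show ?thesis by blast
qed

text \<open>Solutions for one F n may be non-unique, so arbitrary solutions for different n need not
  be ordered. Each iteration is therefore started at the solution found before, a subsolution of the
  next problem because F n \<le> F (Suc n); this calls for dependent choice.\<close>

lemma solvable_between_barriers:
  fixes f :: "real \<Rightarrow> real"
  assumes f: "continuous_on UNIV f" "\<And>t. \<bar>f t\<bar> \<le> s"
    and w: "barrier s w" "\<And>x. w x \<le> C"
  shows "\<exists>u U. weak_eq u U (\<lambda>x. f (u x)) \<and> (AE x in M. \<bar>u x\<bar> \<le> C)"
proof -
  obtain F :: "nat \<Rightarrow> real \<Rightarrow> real" where F: "\<And>n t. \<bar>F n t\<bar> \<le> s"
    "\<And>n a b. a \<le> b \<Longrightarrow> F n a + real (Suc n) * a \<le> F n b + real (Suc n) * b"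
    "\<And>n. continuous_on UNIV (F n)" "\<And>n t. F n t \<le> F (Suc n) t"
    "\<And>x t. x \<longlonglongrightarrow> t \<Longrightarrow> (\<lambda>n. F n (x n)) \<longlonglongrightarrow> f t"
    using inf_convolution[OF f] by metis
  have absw: "\<bar>t\<bar> \<le> C" if "- w x \<le> t" "t \<le> w x" for t x using that w(2)[of x] by linarith
  have w_L2: "L2 M w" and w_m: "w \<in> borel_measurable M"
    using barrierD(3)[OF w(1)] L2_measurable by blast+
  have F_m: "(\<lambda>x. F n (v x)) \<in> borel_measurable M" if "v \<in> borel_measurable M" for v n
    using that by (rule borel_measurable_continuous_on[OF F(3)])
  have F_L2: "L2 M (\<lambda>x. F n (v x))" if "v \<in> borel_measurable M" for v n
    by (rule L2_bounded[OF F_m[OF that], where C = s]) (simp add: F(1))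
  define P where "P n u \<longleftrightarrow> (\<exists>U. weak_eq u U (\<lambda>x. F n (u x))) \<and> (AE x in M. - w x \<le> u x \<and> u x \<le> w x)" for n u
  have base: "\<exists>u. P 0 u"
  proof -
    have "\<exists>u U. weak_eq u U (\<lambda>x. F 0 (u x)) \<and> (AE x in M. - w x \<le> u x \<and> u x \<le> w x)"
    proof (rule monotone_iteration[OF F(3) F(1) _ F(2) w])
      show "(\<lambda>x. - w x) \<in> borel_measurable M" using w_m by measurable
      show "AE x in M. - w x \<le> - w x \<and> - w x \<le> w x"
        using barrierD(2)[OF w(1)] by (intro AE_I2) (auto intro: order_trans[of _ 0])
      fix v V assume v: "weak_eq v V (\<lambda>x. (F 0 (- w x) + real (Suc 0) * - w x) - real (Suc 0) * v x)"
      \<comment> \<open>The lower barrier is handled by changing signs: - v solves a linear problem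
        whose right hand side w - F 0 (- w) is at most s + w.\<close>
      have "AE x in M. - v x \<le> w x"
      proof (rule comparison_with_barrier[OF _ w(1) zero_less_one])
        show "weak_eq (\<lambda>x. - v x) (\<lambda>x. - V x) (\<lambda>x. - (F 0 (- w x) + - 1 * w x) - 1 * - v x)"
          using weak_eq_minus[OF v] by (simp add: algebra_simps)
        have "(\<lambda>x. - w x) \<in> borel_measurable M" using w_m by measurable
        from L2_mult[OF L2_add[OF F_L2[OF this] L2_mult[OF w_L2]], of "-1" 0 "-1"]
        show "L2 M (\<lambda>x. - (F 0 (- w x) + - 1 * w x))" by simp
        show "AE x in M. - (F 0 (- w x) + - 1 * w x) \<le> s + 1 * w x"
        proof (intro AE_I2)
          fix x show "- (F 0 (- w x) + - 1 * w x) \<le> s + 1 * w x" using F(1)[of 0 "- w x"] by linarith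
        qed
      qed
      then show "AE x in M. - w x \<le> v x" by eventually_elim linarith
    qed simp
    then show ?thesis unfolding P_def by blast
  qed
  have step: "\<exists>v. P (Suc n) v \<and> (AE x in M. u x \<le> v x)" if "P n u" for n u
  proof -
    obtain U where U: "weak_eq u U (\<lambda>x. F n (u x))" and uw: "AE x in M. - w x \<le> u x \<and> u x \<le> w x"
      using \<open>P n u\<close> unfolding P_def by blast
    note uL = weak_eqD(3)[OF U]
    have um: "u \<in> borel_measurable M" by (rule L2_measurable[OF uL])
    let ?K = "real (Suc (Suc n))"
    have "\<exists>v V. weak_eq v V (\<lambda>x. F (Suc n) (v x)) \<and> (AE x in M. u x \<le> v x \<and> v x \<le> w x)"
    proof (rule monotone_iteration[OF F(3) F(1) _ F(2) w um uw])
      fix v V assume v: "weak_eq v V (\<lambda>x. (F (Suc n) (u x) + ?K * u x) - ?K * v x)"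
      \<comment> \<open>The constant of the next stage is added and subtracted, so that u and v
        solve problems with the same operator.\<close>
      have U': "weak_eq u U (\<lambda>x. (F n (u x) + ?K * u x) - ?K * u x)" using U by simp
      show "AE x in M. u x \<le> v x"
      proof (rule comparison_of_solutions[OF U' v])
        show "L2 M (\<lambda>x. F n (u x) + ?K * u x)" "L2 M (\<lambda>x. F (Suc n) (u x) + ?K * u x)"
          by (intro L2_add F_L2 L2_mult um uL)+
        show "AE x in M. F n (u x) + ?K * u x \<le> F (Suc n) (u x) + ?K * u x"
          using F(4) by (intro AE_I2 add_right_mono)
      qed simp
    qed simp
    then obtain v V where v: "weak_eq v V (\<lambda>x. F (Suc n) (v x))" "AE x in M. u x \<le> v x \<and> v x \<le> w x" by blast
    have "AE x in M. - w x \<le> v x \<and> v x \<le> w x"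
      using v(2) uw by eventually_elim linarith
    moreover have "AE x in M. u x \<le> v x" using v(2) by eventually_elim simp
    ultimately show ?thesis using v(1) unfolding P_def by blast
  qed
  obtain u where u: "\<And>n. P n (u n)" "\<And>n. AE x in M. u n x \<le> u (Suc n) x"
    using dependent_nat_choice[of P "\<lambda>n u v. AE x in M. u x \<le> v x"] base step by blast
  then obtain U where U: "\<And>n. weak_eq (u n) (U n) (\<lambda>x. F n (u n x))" unfolding P_def by metis
  have um: "u n \<in> borel_measurable M" for n by (rule L2_measurable[OF weak_eqD(3)[OF U]])
  have bound: "AE x in M. \<bar>u n x\<bar> \<le> C" for n
    using u(1)[of n] unfolding P_def by (elim conjE eventually_mono) (rule absw, auto)
  obtain v where v: "L2lim M u v" "AE x in M. (\<lambda>n. u n x) \<longlonglongrightarrow> v x \<and> (\<forall>n. u n x \<le> v x)"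
    using monotone_limit[of u C, OF um bound u(2)] by blast
  have vm: "v \<in> borel_measurable M" by (rule L2_measurable[OF L2lim_L2[OF v(1)]])
  have h: "L2lim M (\<lambda>n x. F n (u n x)) (\<lambda>x. f (v x))"
  proof (rule L2lim_dominated[OF F_m[OF um] _ integrable_const[of "s\<^sup>2"]])
    show "(\<lambda>x. f (v x)) \<in> borel_measurable M" by (rule borel_measurable_continuous_on[OF f(1) vm])
    show "AE x in M. (\<lambda>n. F n (u n x)) \<longlonglongrightarrow> f (v x)"
      using v(2) by eventually_elim (simp add: F(5))
    show "AE x in M. (norm (F n (u n x)))\<^sup>2 \<le> s\<^sup>2" for n
      unfolding real_norm_def by (intro AE_I2 power_mono F(1)) simp
  qed
  from weak_eq_limit[OF U v(1) h] obtain V where V: "weak_eq v V (\<lambda>x. f (v x))" by blast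
  have "AE x in M. \<forall>n. \<bar>u n x\<bar> \<le> C" using bound by (simp add: AE_all_countable)
  with v(2) have "AE x in M. \<bar>v x\<bar> \<le> C"
  proof eventually_elim
    case (elim x)
    then show ?case by (intro LIMSEQ_le_const2[of "\<lambda>n. \<bar>u n x\<bar>"] tendsto_rabs) auto
  qed
  with V show ?thesis by blast
qed

end

section \<open>Left invariant fields and the Folland-Stein space\<close>

lemma tendsto_fderiv:
  fixes f :: "'a::euclidean_space \<Rightarrow> 'b::real_normed_vector"
  assumes "Ck_on 1 f UNIV" "z \<longlonglongrightarrow> z0" "w \<longlonglongrightarrow> w0"
  shows "(\<lambda>n::nat. fderiv f (z n) (w n)) \<longlonglongrightarrow> fderiv f z0 w0"
proof -
  have e: "fderiv f x v = (\<Sum>b\<in>Basis. (v \<bullet> b) *\<^sub>R fderiv f x b)" for x v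
    by (rule fderiv_expand) (use assms(1) in simp)
  have "(\<lambda>n. \<Sum>b\<in>Basis. (w n \<bullet> b) *\<^sub>R fderiv f (z n) b) \<longlonglongrightarrow> (\<Sum>b\<in>Basis. (w0 \<bullet> b) *\<^sub>R fderiv f z0 b)"
  proof (intro tendsto_sum tendsto_scaleR tendsto_inner tendsto_const assms(3))
    fix b :: 'a assume "b \<in> Basis"
    then have "continuous_on UNIV (\<lambda>x. fderiv f x b)" using assms(1) by simp
    then show "(\<lambda>n. fderiv f (z n) b) \<longlonglongrightarrow> fderiv f z0 b"
      by (rule continuous_on_tendsto_compose[OF _ assms(2)]) auto
  qed
  then show ?thesis unfolding e[symmetric] .
qed

lemma linear_dilation: "linear (dilation deg \<eta>)"
  by (rule linearI) (simp_all add: dilation_def vec_eq_iff algebra_simps)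

section \<open>Homogeneity of left invariant fields\<close>

context homogeneous_group
begin

lemma right_neutral_mul: "mul a e = a" by simp
lemma left_neutral_mul: "mul e a = a" by simp

lemma dilation_e: "\<eta> > 0 \<Longrightarrow> dilation deg \<eta> e = e"
proof -
  assume "\<eta> > 0"
  then have "dilation deg \<eta> e = mul (dilation deg \<eta> e) (dilation deg \<eta> e)"
    using dilation_hom[of \<eta> e e] by simp
  then show ?thesis by (metis left_cancel right_neutral_mul)
qed

text \<open>Dilation by 2 fixes the identity but multiplies every coordinate by at least 2, since
  degrees are positive.\<close>

lemma e_eq_0: "e = 0"
proof (rule vec_eq_iff[THEN iffD2], rule allI)
  fix i
  have "(2::real) ^ deg i * e $ i = e $ i"
    using dilation_e[of 2] by (simp add: dilation_def vec_eq_iff)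
  moreover have "0 < deg i" using deg_range[of i] by simp
  then have "1 < (2::real) ^ deg i" by (intro one_less_power) auto
  then have "(2::real) ^ deg i \<noteq> 1" by linarith
  ultimately show "e $ i = 0 $ i" by (simp add: mult_cancel_right1)
qed

text \<open>Differentiating the dilation law at the identity, dividing by the lowest power of \<open>\<eta>\<close> and
  letting \<open>\<eta> \<rightarrow> 0\<close> isolates the component of lowest degree.\<close>

lemma left_invariant_constant_component:
  assumes Y: "Y \<in> left_invariant_fields mul" "Y \<noteq> 0"
  shows "\<exists>i c. c \<noteq> 0 \<and> (\<forall>x. Y x $ i = c)"
proof -
  define \<Phi> where "\<Phi> = (\<lambda>(x, y). mul x y)"
  have C1: "Ck_on 1 \<Phi> UNIV" using smooth_mul by (simp only: smooth_on_def \<Phi>_def)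
  \<comment> \<open>The differential at the identity of left translation by x, written through the
    total derivative of the multiplication so that it is jointly continuous in x and v.\<close>
  define G where "G x v = fderiv \<Phi> (x, 0) (0, v)" for x v
  have dmul: "((\<lambda>y. mul x y) has_derivative G x) (at 0)" for x
  proof -
    have "((\<lambda>y. (x, y)) has_derivative (\<lambda>v. (0, v))) (at 0)"
      by (intro has_derivative_Pair has_derivative_const has_derivative_ident)
    moreover have "(\<Phi> has_derivative fderiv \<Phi> (x, 0)) (at (x, 0))"
      using C1 frechet_derivative_works by auto
    ultimately have "((\<lambda>y. \<Phi> (x, y)) has_derivative (\<lambda>v. fderiv \<Phi> (x, 0) (0, v))) (at 0)"
      by (rule has_derivative_compose)
    then show ?thesis unfolding \<Phi>_def G_def[abs_def] by simp
  qed
  have YG: "Y x = G x (Y 0)" for x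
  proof -
    have "fderiv (mul x) 0 (Y 0) = Y (mul x 0)" using Y(1) by (simp add: left_invariant_fields_def)
    then show ?thesis
      using right_neutral_mul[of x] unfolding fderiv_eqI[OF dmul[of x]] e_eq_0 by simp
  qed
  have Glin: "linear (G x)" for x using dmul has_derivative_linear by blast
  have G0: "G 0 v = v" for v
  proof -
    have "mul 0 = (\<lambda>y. y)" using left_neutral_mul unfolding e_eq_0 by blast
    then have "((\<lambda>y. y) has_derivative G 0) (at 0)" using dmul[of 0] by simp
    then have "G 0 = (\<lambda>v. v)" using has_derivative_unique has_derivative_ident by blast
    then show ?thesis by simp
  qed
  let ?\<delta> = "dilation deg"
  have hom: "G (?\<delta> \<eta> x) (?\<delta> \<eta> v) = ?\<delta> \<eta> (G x v)" if \<eta>: "\<eta> > 0" for \<eta> x v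
  proof -
    have bl: "bounded_linear (?\<delta> \<eta>)" using linear_dilation linear_conv_bounded_linear by blast
    have \<delta>0: "?\<delta> \<eta> 0 = 0" by (rule linear_0[OF linear_dilation])
    have "((\<lambda>y. ?\<delta> \<eta> (mul x y)) has_derivative (\<lambda>v. ?\<delta> \<eta> (G x v))) (at 0)"
      by (rule bounded_linear.has_derivative[OF bl dmul])
    moreover have "((\<lambda>y. mul (?\<delta> \<eta> x) (?\<delta> \<eta> y)) has_derivative (\<lambda>v. G (?\<delta> \<eta> x) (?\<delta> \<eta> v))) (at 0)"
      by (rule has_derivative_compose[OF bounded_linear_imp_has_derivative[OF bl]]) (simp only: \<delta>0 dmul)
    ultimately have "(\<lambda>v. ?\<delta> \<eta> (G x v)) = (\<lambda>v. G (?\<delta> \<eta> x) (?\<delta> \<eta> v))"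
      unfolding dilation_hom[OF \<eta>] by (rule has_derivative_unique)
    then show ?thesis by metis
  qed
  define v where "v = Y 0"
  have "v \<noteq> 0"
  proof
    assume "v = 0"
    then have "Y x = 0" for x using YG[of x] linear_0[OF Glin] by (simp add: v_def)
    then show False using Y(2) by auto
  qed
  then have "\<exists>i. v $ i \<noteq> 0" by (simp add: vec_eq_iff)
  then obtain i where i: "v $ i \<noteq> 0" "\<And>l. v $ l \<noteq> 0 \<Longrightarrow> deg i \<le> deg l"
    using ex_has_least_nat[of "\<lambda>i. v $ i \<noteq> 0" _ deg] by blast
  have "Y x $ i = v $ i" for x
  proof -
    define \<eta> where "\<eta> n = inverse (real (Suc n))" for n
    have \<eta>: "\<eta> n > 0" "\<eta> \<longlonglongrightarrow> 0" for n
      using LIMSEQ_inverse_real_of_nat by (auto simp: \<eta>_def[abs_def])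
    \<comment> \<open>\<open>w n\<close> is the dilated v divided by the lowest power of \<eta>.
      Degrees are subtracted in nat, which is correct because components of v of degree below
      \<open>deg i\<close> vanish. In the limit 0^0 = 1 preserves the components of degree
      \<open>deg i\<close>.\<close>
    define w where "w n = (\<chi> l. \<eta> n ^ (deg l - deg i) * v $ l)" for n
    define w0 where "w0 = (\<chi> l. 0 ^ (deg l - deg i) * v $ l)"
    have w: "w \<longlonglongrightarrow> w0"
      unfolding w_def[abs_def] w0_def by (intro tendsto_vec_lambda tendsto_intros \<eta>(2))
    have wv: "?\<delta> (\<eta> n) v = \<eta> n ^ deg i *\<^sub>R w n" for n
    proof (rule vec_eq_iff[THEN iffD2], rule allI)
      fix l
      have "\<eta> n ^ deg l * v $ l = \<eta> n ^ deg i * (\<eta> n ^ (deg l - deg i) * v $ l)"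
        using i(2)[of l] by (cases "v $ l = 0") (auto simp: power_add[symmetric] mult.assoc[symmetric])
      then show "?\<delta> (\<eta> n) v $ l = (\<eta> n ^ deg i *\<^sub>R w n) $ l" by (simp add: dilation_def w_def)
    qed
    have "(\<lambda>n. ?\<delta> (\<eta> n) x) \<longlonglongrightarrow> (\<chi> l. 0 ^ deg l * x $ l)"
      unfolding dilation_def by (intro tendsto_vec_lambda tendsto_intros \<eta>(2))
    moreover have "(0::real) ^ deg l = 0" for l using deg_range[of l] by (simp add: power_0_left)
    ultimately have "(\<lambda>n. ?\<delta> (\<eta> n) x) \<longlonglongrightarrow> (\<chi> l. 0)" by simp
    then have \<delta>x: "(\<lambda>n. ?\<delta> (\<eta> n) x) \<longlonglongrightarrow> 0" by (simp add: zero_vec_def)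
    have "(\<lambda>n. G (?\<delta> (\<eta> n) x) (w n)) \<longlonglongrightarrow> G 0 w0"
      unfolding G_def by (intro tendsto_fderiv[OF C1] tendsto_Pair \<delta>x w tendsto_const)
    then have lim: "(\<lambda>n. G (?\<delta> (\<eta> n) x) (w n) $ i) \<longlonglongrightarrow> w0 $ i"
      unfolding G0 by (rule tendsto_vec_nth)
    have "G (?\<delta> (\<eta> n) x) (w n) $ i = G x v $ i" for n
    proof -
      have "\<eta> n ^ deg i *\<^sub>R G (?\<delta> (\<eta> n) x) (w n) = ?\<delta> (\<eta> n) (G x v)"
        using hom[OF \<eta>(1)[of n], of x v] unfolding wv linear_scale[OF Glin] .
      then have "\<eta> n ^ deg i * G (?\<delta> (\<eta> n) x) (w n) $ i = \<eta> n ^ deg i * G x v $ i"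
        by (simp add: vec_eq_iff dilation_def)
      then show ?thesis using \<eta>(1)[of n] by simp
    qed
    then have "G x v $ i = w0 $ i" using lim by (simp add: LIMSEQ_const_iff)
    then show ?thesis using YG[of x] by (simp add: v_def w0_def)
  qed
  with i(1) show ?thesis by blast
qed

end

context carnot_group
begin

text \<open>The bijection of \<open>direct_sum\<close> sends the family with Y in place 1 and 0
  elsewhere to Y.\<close>

lemma first_layer_left_invariant: "V 1 \<subseteq> left_invariant_fields mul"
proof
  fix Y assume Y: "Y \<in> V 1"
  \<comment> \<open>The index type is inhabited, and the degree of any index lies in {1..r}.\<close>
  have r: "1 \<in> {1..r}" using deg_range[of undefined] by auto
  define F where "F = (\<lambda>k\<in>{1..r}. if k = 1 then Y else 0)"
  have "F \<in> PiE {1..r} V"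
    unfolding F_def by (rule restrict_PiE_iff[THEN iffD2]) (use Y subspace_0[OF subspace_layer] in auto)
  then have "(\<Sum>k=1..r. F k) \<in> left_invariant_fields mul"
    using bij_betw_imp_surj_on[OF direct_sum] by blast
  moreover have "(\<Sum>k=1..r. F k) = (\<Sum>k=1..r. if k = 1 then Y else 0)"
    unfolding F_def by (rule sum.cong) auto
  ultimately show "Y \<in> left_invariant_fields mul" using r by simp
qed

end

section \<open>Passage between the energy closure and the Folland-Stein space\<close>

context horizontal_frame
begin

text \<open>On a set of finite measure this follows from t^2 \<le> \<epsilon> + c t^q: either t^2
  \<le> \<epsilon>, or t \<ge> sqrt \<epsilon> and then c t^(q-2) \<ge> 1 by the choice of c. The
  case q = 2 is included, for gradients.\<close>

lemma Lq_tendsto_imp_L2lim: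
  fixes F :: "nat \<Rightarrow> 'a \<Rightarrow> 'b::euclidean_space"
  assumes q: "q \<ge> 2" and F: "\<And>k. L2 M (F k)" and lim: "Lq_tendsto q D F u"
  shows "L2lim M F u"
proof -
  have um: "u \<in> borel_measurable M"
    and N: "(\<lambda>k. \<integral>\<^sup>+x. ennreal (norm (F k x - u x) powr q) \<partial>M) \<longlonglongrightarrow> 0"
    using lim by (auto simp: Lq_tendsto_def)
  have dm: "(\<lambda>x. F k x - u x) \<in> borel_measurable M" for k
    using L2_measurable[OF F] um by measurable
  define m where "m = measure M D"
  have m: "emeasure M D = ennreal m" "m \<ge> 0"
  proof -
    have "finite_measure M"
      by (intro finite_measure_lebesgue_on bounded_set_imp_lmeasurable bounded_D sets_D)
    then show "emeasure M D = ennreal m"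
      by (simp add: finite_measure.emeasure_eq_measure m_def space_restrict_space)
  qed (simp add: m_def)
  have ev: "\<forall>\<^sub>F k in sequentially. (\<integral>\<^sup>+x. ennreal ((norm (F k x - u x))\<^sup>2) \<partial>M) \<le> ennreal e" if e: "e > 0" for e
  proof -
    define \<epsilon> where "\<epsilon> = e / (2 * (m + 1))"
    have \<epsilon>: "\<epsilon> > 0" "\<epsilon> * m \<le> e / 2"
      using e m(2) by (auto simp: \<epsilon>_def field_simps)
    define c where "c = inverse (sqrt \<epsilon> powr (q - 2))"
    have c: "c > 0" using \<epsilon>(1) by (simp add: c_def)
    have young: "t\<^sup>2 \<le> \<epsilon> + c * t powr q" if "t \<ge> 0" for t
    proof (cases "t\<^sup>2 \<le> \<epsilon>")
      case True
      then show ?thesis using c mult_nonneg_nonneg[of c "t powr q"] powr_ge_zero[of t q] by linarith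
    next
      case False
      then have "sqrt \<epsilon> \<le> t" using that \<epsilon>(1) by (simp add: real_le_lsqrt)
      moreover have t: "t > 0" using False that \<epsilon>(1) by (cases "t = 0") auto
      ultimately have "sqrt \<epsilon> powr (q - 2) \<le> t powr (q - 2)" using q \<epsilon>(1) by (intro powr_mono2) auto
      then have "1 \<le> c * t powr (q - 2)" using \<epsilon>(1) by (simp add: c_def field_simps)
      then have "1 * t\<^sup>2 \<le> (c * t powr (q - 2)) * t\<^sup>2" by (intro mult_right_mono) auto
      also have "t powr (q - 2) * t\<^sup>2 = t powr q"
        using t powr_add[of t "q - 2" 2] by (simp add: powr_numeral)
      then have "(c * t powr (q - 2)) * t\<^sup>2 = c * t powr q" by (simp add: mult.assoc)
      finally show ?thesis using \<epsilon>(1) by linarith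
    qed
    have "\<forall>\<^sub>F k in sequentially. (\<integral>\<^sup>+x. ennreal (norm (F k x - u x) powr q) \<partial>M) < ennreal (e / (2 * c))"
      using e c by (intro order_tendstoD(2)[OF N]) simp
    then show ?thesis
    proof eventually_elim
      case (elim k)
      have "(\<integral>\<^sup>+x. ennreal ((norm (F k x - u x))\<^sup>2) \<partial>M)
          \<le> (\<integral>\<^sup>+x. ennreal \<epsilon> + ennreal c * ennreal (norm (F k x - u x) powr q) \<partial>M)"
        using \<epsilon>(1) c young by (intro nn_integral_mono) (simp flip: ennreal_mult ennreal_plus)
      also have "\<dots> = ennreal \<epsilon> * ennreal m + ennreal c * (\<integral>\<^sup>+x. ennreal (norm (F k x - u x) powr q) \<partial>M)"
        using dm by (simp add: nn_integral_add nn_integral_cmult m(1))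
      also have "\<dots> \<le> ennreal \<epsilon> * ennreal m + ennreal c * ennreal (e / (2 * c))"
        using elim by (intro add_left_mono mult_left_mono) auto
      also have "\<dots> = ennreal (\<epsilon> * m + c * (e / (2 * c)))"
        using \<epsilon>(1) c e m(2) by (simp flip: ennreal_mult ennreal_plus)
      also have "\<dots> \<le> ennreal e" using \<epsilon>(2) c by (intro ennreal_leI) simp
      finally show ?case .
    qed
  qed
  have dL2: "L2 M (\<lambda>x. F k x - u x)" if "(\<integral>\<^sup>+x. ennreal ((norm (F k x - u x))\<^sup>2) \<partial>M) \<le> ennreal e" for k e
    unfolding L2_def using dm that by (intro conjI integrableI_bounded) (auto intro: le_less_trans)
  obtain k where "(\<integral>\<^sup>+x. ennreal ((norm (F k x - u x))\<^sup>2) \<partial>M) \<le> ennreal 1"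
    using eventually_happens'[OF trivial_limit_sequentially ev[of 1]] by auto
  from L2_diff[OF F[of k] dL2[OF this]] have uL: "L2 M u" by simp
  have "(\<lambda>k. nsq M (\<lambda>x. F k x - u x)) \<longlonglongrightarrow> 0"
  proof (rule tendstoI)
    fix e :: real assume e: "e > 0"
    then have "e / 2 > 0" by simp
    from ev[OF this] show "\<forall>\<^sub>F k in sequentially. dist (nsq M (\<lambda>x. F k x - u x)) 0 < e"
    proof eventually_elim
      case (elim k)
      have "ennreal (nsq M (\<lambda>x. F k x - u x)) \<le> ennreal (e / 2)"
        using elim L2_integrable[OF L2_diff[OF F[of k] uL]] by (simp add: nsq_def nn_integral_eq_integral)
      then have "nsq M (\<lambda>x. F k x - u x) \<le> e / 2" using e by simp
      then show ?case using e by simp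
    qed
  qed
  then show ?thesis using F uL by (simp add: L2lim_def)
qed

text \<open>Assumption \<open>le\<close> is used in two cases: for q = 2 with c = 1, and for
  differences bounded by C + B with c = (C + B)^(q-2).\<close>

lemma L2lim_imp_Lq_tendsto:
  fixes F :: "nat \<Rightarrow> 'a \<Rightarrow> 'b::euclidean_space"
  assumes F: "L2lim M F u" and c: "c \<ge> 0"
    and le: "\<And>k. AE x in M. norm (F k x - u x) powr q \<le> c * (norm (F k x - u x))\<^sup>2"
  shows "Lq_tendsto q D F u"
  unfolding Lq_tendsto_def
proof
  note d = L2_diff[OF L2lim_L2_seq[OF F] L2lim_L2[OF F]]
  show "u \<in> borel_measurable M" by (rule L2_measurable[OF L2lim_L2[OF F]])
  have bound: "(\<integral>\<^sup>+x. ennreal (norm (F k x - u x) powr q) \<partial>M) \<le> ennreal (c * nsq M (\<lambda>x. F k x - u x))" for k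
  proof -
    have "(\<integral>\<^sup>+x. ennreal (norm (F k x - u x) powr q) \<partial>M) \<le> (\<integral>\<^sup>+x. ennreal (c * (norm (F k x - u x))\<^sup>2) \<partial>M)"
      using le[of k] by (intro nn_integral_mono_AE) (auto elim!: eventually_mono intro: ennreal_leI)
    also have "\<dots> = ennreal (c * nsq M (\<lambda>x. F k x - u x))"
      using c L2_integrable[OF d[of k]] by (subst nn_integral_eq_integral) (auto simp: nsq_def)
    finally show ?thesis .
  qed
  have "(\<lambda>k. c * nsq M (\<lambda>x. F k x - u x)) \<longlonglongrightarrow> 0"
    using F tendsto_mult_right_zero unfolding L2lim_def by blast
  then have "(\<lambda>k. ennreal (c * nsq M (\<lambda>x. F k x - u x))) \<longlonglongrightarrow> ennreal 0" by (rule tendsto_ennrealI)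
  then have b0: "(\<lambda>k. ennreal (c * nsq M (\<lambda>x. F k x - u x))) \<longlonglongrightarrow> 0" by simp
  show "(\<lambda>k. \<integral>\<^sup>+x. ennreal (norm (F k x - u x) powr q) \<partial>M) \<longlonglongrightarrow> 0"
    by (rule tendsto_sandwich[OF always_eventually always_eventually tendsto_const b0]) (use bound in auto)
qed

lemma fs_norm_diff:
  assumes "\<phi> \<in> \<T>" "\<psi> \<in> \<T>"
  shows "fs_norm X D (\<phi> - \<psi>) = sqrt (nsq M (\<lambda>x. grad \<phi> x - grad \<psi> x))"
proof -
  have "grad (\<phi> - \<psi>) x = grad \<phi> x - grad \<psi> x" for x
    using grad_comb[OF test_diff[OF assms(1)] test_diff[OF assms(2)], of "-1"]
    by (simp add: fun_diff_def)
  then show ?thesis by (simp add: fs_norm_def nsq_def)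
qed

lemma folland_stein_FS:
  assumes q: "q \<ge> 2" and u: "u \<in> folland_stein X q D"
  shows "FS u (fs_grad X q D u)"
proof -
  obtain \<phi> where \<phi>: "fs_represents X q D \<phi> u" using u unfolding folland_stein_def by blast
  then have t: "\<And>k. \<phi> k \<in> \<T>" by (simp add: fs_represents_def)
  have "\<exists>U. L2lim M (\<lambda>k. grad (\<phi> k)) U"
  proof (rule L2_complete[OF L2_grad_test[OF t]])
    fix e :: real assume "e > 0"
    then have "sqrt e > 0" by simp
    then obtain N where N: "\<forall>k\<ge>N. \<forall>l\<ge>N. fs_norm X D (\<phi> k - \<phi> l) < sqrt e"
      using \<phi> unfolding fs_represents_def by blast
    have "nsq M (\<lambda>x. grad (\<phi> k) x - grad (\<phi> l) x) < e" if "k \<ge> N" "l \<ge> N" for k l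
      using N that unfolding fs_norm_diff[OF t t] by simp
    then show "\<exists>N. \<forall>k\<ge>N. \<forall>l\<ge>N. nsq M (\<lambda>x. grad (\<phi> k) x - grad (\<phi> l) x) < e" by blast
  qed
  then obtain U where U: "L2lim M (\<lambda>k. grad (\<phi> k)) U" by blast
  have "Lq_tendsto 2 D (\<lambda>k. grad (\<phi> k)) U"
    by (rule L2lim_imp_Lq_tendsto[OF U zero_le_one]) (simp add: powr_numeral)
  with \<phi> have "\<exists>U \<phi>. fs_represents X q D \<phi> u \<and> Lq_tendsto 2 D (\<lambda>k. hgrad X (\<phi> k)) U" by blast
  \<comment> \<open>The choice in \<open>fs_grad\<close> need not return U. It comes with a
    representing sequence of its own, and the limits of functions and gradients are both read off
    along that sequence.\<close>
  from someI_ex[OF this] obtain \<psi> where \<psi>: "fs_represents X q D \<psi> u"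
    "Lq_tendsto 2 D (\<lambda>k. grad (\<psi> k)) (fs_grad X q D u)"
    unfolding fs_grad_def by blast
  then have t': "\<And>k. \<psi> k \<in> \<T>" and l: "Lq_tendsto q D \<psi> u" by (simp_all add: fs_represents_def)
  show ?thesis
    unfolding FS_def
    using t' Lq_tendsto_imp_L2lim[OF q L2_test[OF t'] l] Lq_tendsto_imp_L2lim[OF order.refl L2_grad_test[OF t'] \<psi>(2)]
    by blast
qed

text \<open>The test functions of \<open>FS_bounded_approximation\<close> differ from u by at most C
  + B, so the q-th power of the difference is at most (C + B)^(q-2) times its square.\<close>

lemma bounded_FS_folland_stein:
  assumes q: "q \<ge> 2" and u: "FS u U" and B: "0 \<le> B" "AE x in M. \<bar>u x\<bar> \<le> B"
  shows "u \<in> folland_stein X q D"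
proof -
  obtain \<phi> C where \<phi>: "\<And>k. \<phi> k \<in> \<T>" "\<And>k x. \<bar>\<phi> k x\<bar> \<le> C" "L2lim M \<phi> u" "L2lim M (\<lambda>k. grad (\<phi> k)) U"
    using FS_bounded_approximation[OF u B] by blast
  have "Lq_tendsto q D \<phi> u"
  proof (rule L2lim_imp_Lq_tendsto[OF \<phi>(3)])
    show "0 \<le> (C + B) powr (q - 2)" by simp
    fix k
    show "AE x in M. norm (\<phi> k x - u x) powr q \<le> (C + B) powr (q - 2) * (norm (\<phi> k x - u x))\<^sup>2"
      using B(2)
    proof eventually_elim
      case (elim x)
      let ?t = "norm (\<phi> k x - u x)"
      have le: "?t \<le> C + B" using \<phi>(2)[of k x] elim by simp
      show ?case
      proof (cases "?t = 0")
        case False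
        then have t: "?t > 0" by simp
        have "?t powr q = ?t powr (q - 2) * ?t\<^sup>2"
          using t powr_add[of ?t "q - 2" 2] by (simp add: powr_numeral)
        also have "\<dots> \<le> (C + B) powr (q - 2) * ?t\<^sup>2"
          using le q by (intro mult_right_mono powr_mono2) auto
        finally show ?thesis .
      qed simp
    qed
  qed
  moreover have "\<exists>N. \<forall>k\<ge>N. \<forall>l\<ge>N. fs_norm X D (\<phi> k - \<phi> l) < e" if e: "e > 0" for e
  proof -
    have "\<forall>\<^sub>F k in sequentially. nsq M (\<lambda>x. grad (\<phi> k) x - U x) < e\<^sup>2 / 4"
      using \<phi>(4) e unfolding L2lim_def by (intro order_tendstoD(2)[of _ 0]) auto
    then obtain N where N: "\<And>k. k \<ge> N \<Longrightarrow> nsq M (\<lambda>x. grad (\<phi> k) x - U x) < e\<^sup>2 / 4"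
      unfolding eventually_sequentially by blast
    have "fs_norm X D (\<phi> k - \<phi> l) < e" if kl: "k \<ge> N" "l \<ge> N" for k l
    proof -
      have "nsq M (\<lambda>x. grad (\<phi> k) x - grad (\<phi> l) x) < e\<^sup>2"
        using nsq_triangle[OF L2_grad_test[OF \<phi>(1)[of k]] FS_L2(2)[OF u] L2_grad_test[OF \<phi>(1)[of l]]]
          N[OF kl(1)] N[OF kl(2)] nsq_commute[of M U "grad (\<phi> l)"] by linarith
      then have "sqrt (nsq M (\<lambda>x. grad (\<phi> k) x - grad (\<phi> l) x)) < sqrt (e\<^sup>2)" by (rule real_sqrt_less_mono)
      then show ?thesis unfolding fs_norm_diff[OF \<phi>(1) \<phi>(1)] using e by simp
    qed
    then show ?thesis by blast
  qed
  ultimately show ?thesis using \<phi>(1) unfolding folland_stein_def fs_represents_def by blast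
qed

text \<open>The gradient selected by \<open>fs_grad\<close> agrees with U almost everywhere by
  \<open>FS_unique\<close>, and \<open>weak_eq_FS\<close> extends the equation from test functions
  to the Folland-Stein space. Continuous functions of the bounded u are in L^2, which gives the
  integrability claims.\<close>

lemma bounded_weak_eq_imp_weak_solution:
  assumes q: "q \<ge> 2" and g: "continuous_on UNIV g" and p: "continuous_on UNIV (\<lambda>t. abs_pow t (q - 2))"
    and u: "weak_eq u U h" and B: "0 \<le> B" "AE x in M. \<bar>u x\<bar> \<le> B"
    and h: "AE x in M. h x = \<mu> * (abs_pow (u x) (q - 2) * u x) + lam * g (u x)"
  shows "weak_solution X q D g \<mu> lam u"
  unfolding weak_solution_def
proof (intro conjI ballI)
  note uF = weak_eqD(1)[OF u] and uL = weak_eqD(3)[OF u]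
  show fs: "u \<in> folland_stein X q D" by (rule bounded_FS_folland_stein[OF q uF B])
  note guF = folland_stein_FS[OF q fs]
  fix \<phi> assume "\<phi> \<in> folland_stein X q D"
  then have \<phi>: "FS \<phi> (fs_grad X q D \<phi>)" by (rule folland_stein_FS[OF q])
  have comp: "L2 M (\<lambda>x. f (u x))" if f: "continuous_on UNIV f" for f :: "real \<Rightarrow> real"
  proof -
    obtain K where K: "\<forall>t\<in>{-B..B}. norm (f t) \<le> K"
      using continuous_bounded_on_compact[OF compact_Icc f] by blast
    show ?thesis
    proof (rule L2_bounded[OF borel_measurable_continuous_on[OF f L2_measurable[OF uL]]])
      show "AE x in M. norm (f (u x)) \<le> K" using B(2)
      proof eventually_elim
        case (elim x)
        then have "u x \<in> {-B..B}" by auto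
        then show ?case using K by blast
      qed
    qed
  qed
  have pL: "L2 M (\<lambda>x. abs_pow (u x) (q - 2) * u x)"
    by (rule comp[where f = "\<lambda>t. abs_pow t (q - 2) * t"]) (intro continuous_on_mult p continuous_on_id)
  have gL: "L2 M (\<lambda>x. g (u x))" by (rule comp[OF g])
  show i0: "integrable M (\<lambda>x. fs_grad X q D u x \<bullet> fs_grad X q D \<phi> x)"
    by (rule L2_inner[OF FS_L2(2)[OF guF] FS_L2(2)[OF \<phi>]])
  show i1: "integrable M (\<lambda>x. abs_pow (u x) (q - 2) * u x * \<phi> x)"
    by (rule L2_mult_integrable[OF pL FS_L2(1)[OF \<phi>]])
  show i2: "integrable M (\<lambda>x. g (u x) * \<phi> x)"
    by (rule L2_mult_integrable[OF gL FS_L2(1)[OF \<phi>]])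
  have "(\<integral>x. fs_grad X q D u x \<bullet> fs_grad X q D \<phi> x \<partial>M) = (\<integral>x. U x \<bullet> fs_grad X q D \<phi> x \<partial>M)"
  proof (rule integral_cong_AE)
    show "AE x in M. fs_grad X q D u x \<bullet> fs_grad X q D \<phi> x = U x \<bullet> fs_grad X q D \<phi> x"
      using FS_unique[OF guF uF] by eventually_elim simp
  qed (use i0 L2_inner[OF weak_eqD(4)[OF u] FS_L2(2)[OF \<phi>]] in auto)
  also have "\<dots> = (\<integral>x. h x * \<phi> x \<partial>M)" by (rule weak_eq_FS[OF u \<phi>])
  also have "\<dots> = (\<integral>x. \<mu> * (abs_pow (u x) (q - 2) * u x * \<phi> x) + lam * (g (u x) * \<phi> x) \<partial>M)"
  proof (rule integral_cong_AE)
    show "AE x in M. h x * \<phi> x = \<mu> * (abs_pow (u x) (q - 2) * u x * \<phi> x) + lam * (g (u x) * \<phi> x)"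
      using h by eventually_elim (simp add: algebra_simps)
    show "(\<lambda>x. h x * \<phi> x) \<in> borel_measurable M"
      using L2_mult_integrable[OF weak_eqD(2)[OF u] FS_L2(1)[OF \<phi>]] by simp
    show "(\<lambda>x. \<mu> * (abs_pow (u x) (q - 2) * u x * \<phi> x) + lam * (g (u x) * \<phi> x)) \<in> borel_measurable M"
      using i1 i2 by (intro borel_measurable_integrable Bochner_Integration.integrable_add integrable_mult_right)
  qed
  also have "\<dots> = \<mu> * (\<integral>x. abs_pow (u x) (q - 2) * u x * \<phi> x \<partial>M) + lam * (\<integral>x. g (u x) * \<phi> x \<partial>M)"
    using i1 i2 by simp
  finally show "(\<integral>x. fs_grad X q D u x \<bullet> fs_grad X q D \<phi> x \<partial>M) - \<mu> * (\<integral>x. abs_pow (u x) (q - 2) * u x * \<phi> x \<partial>M)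
    = lam * (\<integral>x. g (u x) * \<phi> x \<partial>M)" by simp
qed

end

section \<open>The critical problem\<close>

lemma abs_pow_continuous: "a > 0 \<Longrightarrow> continuous_on UNIV (\<lambda>t. abs_pow t a)"
  unfolding abs_pow_def
  by (simp, rule continuous_on_powr') (auto intro: continuous_intros)

text \<open>Since q - 1 > 1, dividing by s leaves the solvable equation s^(q-2) = 1 / (2 \<mu>
  C^(q-1)). The value s / 2 reserves half of the bound s for the term with g.\<close>

lemma exists_small_scale:
  fixes q \<mu> C :: real
  assumes q: "q > 2" and \<mu>: "\<mu> > 0" and C: "C > 0"
  shows "\<exists>s>0. \<mu> * (s * C) powr (q - 1) = s / 2"
proof -
  define a where "a = \<mu> * C powr (q - 1)"
  have a: "a > 0" using \<mu> C by (simp add: a_def)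
  define s where "s = (1 / (2 * a)) powr (1 / (q - 2))"
  have s: "s > 0" using a by (simp add: s_def)
  have "s powr (q - 2) = 1 / (2 * a)" using q a by (simp add: s_def powr_powr)
  then have "s powr (q - 1) = s / (2 * a)" using s powr_add[of s 1 "q - 2"] by simp
  then have "\<mu> * (s * C) powr (q - 1) = s / 2"
    using s C \<mu> by (simp add: powr_mult a_def field_simps)
  with s show ?thesis by blast
qed

theorem theorem4p1:
  fixes mul :: "real^'n::finite \<Rightarrow> real^'n \<Rightarrow> real^'n"
    and e :: "real^'n" and inv :: "real^'n \<Rightarrow> real^'n"
    and deg :: "'n \<Rightarrow> nat" and r :: nat
    and V :: "nat \<Rightarrow> (real^'n) vfield set"
    and X :: "'m::finite \<Rightarrow> (real^'n) vfield"
    and D :: "(real^'n) set"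
    and g :: "real \<Rightarrow> real"
  assumes carnot: "carnot_group mul e inv deg r V"
    and frame: "inj X" "independent (range X)" "span (range X) = V 1"
    and Q_ge_3: "hom_dim deg r \<ge> 3"
    and domain: "smooth_bounded_domain D"
    and g_cont: "continuous_on UNIV g"
    and growth: "\<exists>a1>0. \<exists>a2>0. \<exists>p. 1 \<le> p \<and> p < crit_exp (hom_dim deg r) \<and>
                   (\<forall>t. \<bar>g t\<bar> \<le> a1 + a2 * abs_pow t (p - 1))"
  shows "\<forall>\<mu>>0. \<exists>\<Lambda>. open \<Lambda> \<and> is_interval \<Lambda> \<and> \<Lambda> \<noteq> {} \<and> \<Lambda> \<subseteq> {0<..} \<and>
           (\<forall>lam\<in>\<Lambda>. \<exists>u. weak_solution X (crit_exp (hom_dim deg r)) D g \<mu> lam u)"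
proof (intro allI impI)
  fix \<mu> :: real assume \<mu>: "\<mu> > 0"
  interpret G: carnot_group mul e inv deg r V by (rule carnot)
  define q where "q = crit_exp (hom_dim deg r)"
  have q: "q > 2"
    using Q_ge_3 by (simp add: q_def crit_exp_def field_simps)
  have XL: "X j \<in> left_invariant_fields mul" for j
    using G.first_layer_left_invariant frame(3) span_base[of "X j" "range X"] by auto
  have D: "open D" "bounded D" using domain by (auto simp: smooth_bounded_domain_def)
  interpret F: horizontal_frame X D
  proof
    show "Ck_on 1 (X j) UNIV" for j
      using XL[of j] by (simp only: left_invariant_fields_def smooth_on_def mem_Collect_eq)
  qed (rule D)+
  \<comment> \<open>Types are inhabited, so the frame has at least one field, and independence makes
    it nonzero.\<close>
  obtain j0 :: 'm where True by blast
  have "X j0 \<noteq> 0" using frame(2) dependent_zero by (metis rangeI)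
  then obtain i c where c: "c \<noteq> 0" "\<And>x. X j0 x $ i = c"
    using G.left_invariant_constant_component[OF XL] by blast
  have "\<exists>w C. F.barrier 1 w \<and> (\<forall>x. w x \<le> C)"
    by (rule F.barrier_exists[of "axis i 1" c j0]) (simp_all add: c inner_axis axis_in_Basis_iff)
  then obtain w C0 where w: "F.barrier 1 w" "\<And>x. w x \<le> C0" by blast
  define C where "C = max C0 1"
  have C: "C > 0" "w x \<le> C" for x using w(2)[of x] by (auto simp: C_def)
  obtain s where s: "s > 0" "\<mu> * (s * C) powr (q - 1) = s / 2"
    using exists_small_scale[OF q \<mu> C(1)] by blast
  define R where "R = s * C"
  have R: "R > 0" using s(1) C(1) by (simp add: R_def)
  obtain G0 where G0: "\<forall>t\<in>{-R..R}. norm (g t) \<le> G0"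
    using continuous_bounded_on_compact[OF compact_Icc g_cont] by blast
  have G: "\<bar>g t\<bar> \<le> G0" if "\<bar>t\<bar> \<le> R" for t
  proof -
    have "t \<in> {-R..R}" using that by auto
    then show ?thesis using G0 by auto
  qed
  have G0_nonneg: "G0 \<ge> 0" using G[of 0] R by linarith
  \<comment> \<open>For \<lambda> below l0 the term \<lambda> g stays within s / 2 on [-R, R]; the
    added 1 covers the case G0 = 0.\<close>
  define l0 where "l0 = s / (2 * (G0 + 1))"
  have l0: "l0 > 0" using s(1) G0_nonneg by (simp add: l0_def)
  have "\<exists>u. weak_solution X q D g \<mu> lam u" if lam: "lam \<in> {0<..<l0}" for lam
  proof -
    define f0 where "f0 t = \<mu> * (abs_pow t (q - 2) * t) + lam * g t" for t
    \<comment> \<open>Clamping the argument makes the bound s global, as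
      \<open>solvable_between_barriers\<close> requires. Its solution satisfies |u| \<le> R, where f
      and f0 agree.\<close>
    define f where "f t = f0 (max (- R) (min R t))" for t
    have pc: "continuous_on UNIV (\<lambda>t. abs_pow t (q - 2))" using q by (intro abs_pow_continuous) simp
    have f0c: "continuous_on UNIV f0"
      unfolding f0_def[abs_def] by (intro continuous_intros pc g_cont)
    have fc: "continuous_on UNIV f"
      unfolding f_def by (intro continuous_on_compose2[OF f0c] continuous_intros) auto
    have f0_bd: "\<bar>f0 t\<bar> \<le> s" if t: "\<bar>t\<bar> \<le> R" for t
    proof -
      have "\<bar>abs_pow t (q - 2) * t\<bar> = \<bar>t\<bar> powr (q - 1)"
      proof (cases "t = 0")
        case False
        then show ?thesis using q powr_add[of "\<bar>t\<bar>" "q - 2" 1] by (simp add: abs_pow_def abs_mult)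
      qed (use q in \<open>simp add: abs_pow_def\<close>)
      also have "\<dots> \<le> R powr (q - 1)" using t q by (intro powr_mono2) auto
      finally have "\<mu> * \<bar>abs_pow t (q - 2) * t\<bar> \<le> s / 2"
        using s(2) \<mu> unfolding R_def by (metis mult_le_cancel_left_pos)
      moreover have "lam * \<bar>g t\<bar> \<le> l0 * (G0 + 1)"
        using lam G[OF t] by (intro mult_mono) auto
      moreover have "l0 * (G0 + 1) = s / 2" using G0_nonneg by (simp add: l0_def field_simps)
      moreover have "\<bar>f0 t\<bar> \<le> \<mu> * \<bar>abs_pow t (q - 2) * t\<bar> + lam * \<bar>g t\<bar>"
        unfolding f0_def using abs_triangle_ineq[of "\<mu> * (abs_pow t (q - 2) * t)" "lam * g t"] \<mu> lam
        by (simp add: abs_mult)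
      ultimately show ?thesis by linarith
    qed
    have f_bd: "\<bar>f t\<bar> \<le> s" for t unfolding f_def using R by (intro f0_bd) auto
    have "F.barrier s (\<lambda>x. s * w x)" using F.barrier_scale[OF w(1), of s] s(1) by simp
    moreover have "s * w x \<le> R" for x unfolding R_def using s(1) C(2) by (intro mult_left_mono) auto
    ultimately obtain u U where u: "F.weak_eq u U (\<lambda>x. f (u x))" "AE x in lebesgue_on D. \<bar>u x\<bar> \<le> R"
      using F.solvable_between_barriers[OF fc f_bd] by blast
    have "weak_solution X q D g \<mu> lam u"
    proof (rule F.bounded_weak_eq_imp_weak_solution[OF _ g_cont pc u(1) _ u(2)])
      show "AE x in lebesgue_on D. f (u x) = \<mu> * (abs_pow (u x) (q - 2) * u x) + lam * g (u x)"
        using u(2)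
      proof eventually_elim
        case (elim x)
        then have "max (- R) (min R (u x)) = u x" by auto
        then show ?case by (simp add: f_def f0_def)
      qed
    qed (use q R in auto)
    then show ?thesis by blast
  qed
  then show "\<exists>\<Lambda>. open \<Lambda> \<and> is_interval \<Lambda> \<and> \<Lambda> \<noteq> {} \<and> \<Lambda> \<subseteq> {0<..} \<and>
      (\<forall>lam\<in>\<Lambda>. \<exists>u. weak_solution X (crit_exp (hom_dim deg r)) D g \<mu> lam u)"
    using l0 unfolding q_def[symmetric]
    by (intro exI[of _ "{0<..<l0}"]) (auto simp: is_interval_oo)
qed

end
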